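(* Let $n\in\mathbb{N}$, $0<r_j<\infty$, $1\le p_j<\infty$ and $1\le\theta_j\le\infty$ for $j\in\{1,\ldots,n\}$. Let $$r=n\Big(\sum_{j=1}^n\frac1{r_j}\Big)^{-1},\qquad p=\frac nr\Big(\sum_{j=1}^n\frac1{p_jr_j}\Big)^{-1},\qquad \theta=\frac nr\Big(\sum_{j=1}^n\frac1{\theta_jr_j}\Big)^{-1}$$ (with $1/\infty=0$, and $\theta=\infty$ if all $\theta_j=\infty$), and suppose that for all $1\le j\le n$ $$\beta_j=\frac1{r_j}\Big(\frac rn+\frac1{p_j}-\frac1p\Big)>0.$$ Choose arbitrary $p_j<q_j<\infty$ such that $$\frac1{q_j}>\frac1p-\frac rn,$$ and denote $$\varkappa_j=1-\frac1{\beta_jr_j}\Big(\frac1{p_j}-\frac1{q_j}\Big),\qquad \alpha_j=\varkappa_jr_j,\qquad \frac1{\theta'_j}=\frac{1-\varkappa_j}{\theta}+\frac{\varkappa_j}{\theta_j}.$$ Let $k_j\in\mathbb{N}$ with $k_j>r_j$. Then there is a constant $c$, independent of $f$, such that for any function $f\in S_0(\mathbb{R}^n)$ with $f\in b_{p_1,\ldots,p_n;\theta_1,\ldots,\theta_n}^{r_1,\ldots,r_n}(\mathbb{R}^n)$ and every $j\in\{1,\ldots,n\}$, $$\Big(\int_0^\infty\big[h^{-\alpha_j}\|\Delta_j^{k_j}(h)f\|_{q_j,1}\big]^{\theta'_j}\frac{dh}{h}\Big)^{1/\theta'_j}\le c\sum_{i=1}^n\|f\|_{b_{p_i,\theta_i;i}^{r_i}}$$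 (with the left-hand side read as the essential supremum over $h>0$ of $h^{-\alpha_j}\|\Delta_j^{k_j}(h)f\|_{q_j,1}$ if $\theta'_j=\infty$). This implies the embedding $$b_{p_1,\ldots,p_n;\theta_1,\ldots,\theta_n}^{r_1,\ldots,r_n}(\mathbb{R}^n)\hookrightarrow b_{q_1,\ldots,q_n;\theta'_1,\ldots,\theta'_n}^{\alpha_1,\ldots,\alpha_n}(\mathbb{R}^n).$$
   Context: $S_0(\mathbb{R}^n)$ is the class of measurable, almost everywhere finite functions $f$ on $\mathbb{R}^n$ such that $|\{x:|f(x)|>y\}|<\infty$ for every $y>0$. For $f\in S_0(\mathbb{R}^n)$, $f^*$ is the non-increasing rearrangement, $f^*(t)=\sup_{|E|=t}\inf_{x\in E}|f(x)|$, $0<t<\infty$. For $0<q,s<\infty$, the Lorentz (quasi)norm is $\|f\|_{q,s}=\big(\int_0^\infty (t^{1/q}f^*(t))^s\,\frac{dt}{t}\big)^{1/s}$; in particular $\|f\|_{q,1}=\int_0^\infty t^{1/q-1}f^*(t)\,dt$. For $k\in\mathbb{N}$, $h\in\mathbb{R}$, $\Delta_j^k(h)f(x)=\sum_{i=0}^k(-1)^{k-i}\binom ki f(x+ihe_j)$, where $e_j$ is the $j$-th unit coordinate vector. For $r>0$, $1\le p<\infty$, $1\le\theta\le\infty$, $$\|f\|_{b_{p,\theta;j}^r}=\Big(\int_0^\infty[h^{-r}\|\Delta_j^k(h)f\|_p]^\theta\frac{dh}{h}\Big)^{1/\theta}$$ (essential supremum over $h>0$ of $h^{-r}\|\Delta_j^k(h)f\|_p$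 if $\theta=\infty$), where $k>r$ is a fixed integer; different choices of $k>r$ give equivalent seminorms. The space $b_{p_1,\ldots,p_n;\theta_1,\ldots,\theta_n}^{r_1,\ldots,r_n}(\mathbb{R}^n)$ consists of all $f\in S_0(\mathbb{R}^n)$ for which the seminorm $\sum_{j=1}^n\|f\|_{b_{p_j,\theta_j;j}^{r_j}}$ is finite. The embedding symbol $\hookrightarrow$ between two such spaces means inclusion together with the bound of the seminorm of the larger space by a constant times the seminorm of the smaller one. *)

theory Defs
  imports "HOL-Analysis.Analysis" "HOL-Probability.Essential_Supremum"
begin

text \<open>
  Norms and seminorms take values in \<^typ>\<open>ennreal\<close>, so that ``the norm is finite'' is a meaningful
  statement about an arbitrary function. Functions on Euclidean space are real-valued
  representatives, and measurability is in the sense of Lebesgue.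
\<close>

text \<open>Only used with a positive exponent.\<close>

definition ennreal_powr :: "ennreal \<Rightarrow> real \<Rightarrow> ennreal" where
  "ennreal_powr x a = (if x = \<infinity> then \<infinity> else ennreal (enn2real x powr a))"

definition S0 :: "(real ^ 'n \<Rightarrow> real) set" where
  "S0 = {f \<in> borel_measurable lebesgue.
           \<forall>y>0. emeasure lebesgue {x. \<bar>f x\<bar> > y} < \<infinity>}"

definition rearrangement :: "(real ^ 'n \<Rightarrow> real) \<Rightarrow> real \<Rightarrow> ennreal" where
  "rearrangement f t =
     (SUP E\<in>{E \<in> sets lebesgue. emeasure lebesgue E = ennreal t}. INF x\<in>E. ennreal \<bar>f x\<bar>)"

definition Lp_norm :: "real \<Rightarrow> (real ^ 'n \<Rightarrow> real) \<Rightarrow> ennreal" where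
  "Lp_norm p f = ennreal_powr (\<integral>\<^sup>+x. ennreal (\<bar>f x\<bar> powr p) \<partial>lebesgue) (1 / p)"

definition lorentz_norm :: "real \<Rightarrow> real \<Rightarrow> (real ^ 'n \<Rightarrow> real) \<Rightarrow> ennreal" where
  "lorentz_norm q s f =
     ennreal_powr
       (\<integral>\<^sup>+t\<in>{0<..}. ennreal_powr (ennreal (t powr (1 / q)) * rearrangement f t) s / ennreal t
          \<partial>lebesgue)
       (1 / s)"

definition partial_diff :: "nat \<Rightarrow> 'n \<Rightarrow> real \<Rightarrow> (real ^ 'n \<Rightarrow> real) \<Rightarrow> real ^ 'n \<Rightarrow> real" where
  "partial_diff k j h f x =
     (\<Sum>i\<le>k. (- 1) ^ (k - i) * real (k choose i) * f (x + (real i * h) *\<^sub>R axis j 1))"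

text \<open>
  The weighted $L^\theta(dh/h)$-norm of $h^{-a} N(h)$ over $h > 0$, where \<^term>\<open>N\<close> will be a norm of
  the $k$-th difference with step \<^term>\<open>h\<close>. The exponent \<^term>\<open>\<theta>\<close> may be infinite.
\<close>

definition weighted_norm :: "real \<Rightarrow> ennreal \<Rightarrow> (real \<Rightarrow> ennreal) \<Rightarrow> ennreal" where
  "weighted_norm a \<theta> N =
     (if \<theta> = \<infinity> then esssup (lebesgue_on {0<..}) (\<lambda>h. ennreal (h powr (- a)) * N h)
      else ennreal_powr
             (\<integral>\<^sup>+h\<in>{0<..}. ennreal_powr (ennreal (h powr (- a)) * N h) (enn2real \<theta>) / ennreal h
                \<partial>lebesgue)
             (1 / enn2real \<theta>))"

text \<open>
  The order \<^term>\<open>k\<close> of the differences is an explicit parameter of the seminorms and spaces;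
  it is meant to satisfy \<^prop>\<open>real k > r\<close>.
\<close>

definition besov_partial_seminorm ::
    "nat \<Rightarrow> real \<Rightarrow> real \<Rightarrow> ennreal \<Rightarrow> 'n \<Rightarrow> (real ^ 'n \<Rightarrow> real) \<Rightarrow> ennreal" where
  "besov_partial_seminorm k r p \<theta> j f =
     weighted_norm r \<theta> (\<lambda>h. Lp_norm p (partial_diff k j h f))"

definition besov_seminorm ::
    "('n \<Rightarrow> nat) \<Rightarrow> ('n \<Rightarrow> real) \<Rightarrow> ('n \<Rightarrow> real) \<Rightarrow> ('n \<Rightarrow> ennreal) \<Rightarrow> (real ^ 'n \<Rightarrow> real) \<Rightarrow> ennreal" where
  "besov_seminorm k r p \<theta> f = (\<Sum>j\<in>UNIV. besov_partial_seminorm (k j) (r j) (p j) (\<theta> j) j f)"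

definition besov_space ::
    "('n \<Rightarrow> nat) \<Rightarrow> ('n \<Rightarrow> real) \<Rightarrow> ('n \<Rightarrow> real) \<Rightarrow> ('n \<Rightarrow> ennreal) \<Rightarrow> (real ^ 'n \<Rightarrow> real) set" where
  "besov_space k r p \<theta> = {f \<in> S0. besov_seminorm k r p \<theta> f < \<infinity>}"

definition seminorm_embedding ::
    "'f set \<Rightarrow> ('f \<Rightarrow> ennreal) \<Rightarrow> 'f set \<Rightarrow> ('f \<Rightarrow> ennreal) \<Rightarrow> bool" where
  "seminorm_embedding A N B M \<longleftrightarrow>
     A \<subseteq> B \<and> (\<exists>c::real. c > 0 \<and> (\<forall>f\<in>A. M f \<le> ennreal c * N f))"

end

(*
Let S bound the Besov seminorms of f. Smoothing h^(-r_i) ||Delta_i(h) f||_{p_i} / S on the logarithmic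
scale gives weights e_i whose logarithms are s-Lipschitz with s as small as we like, so that
||Delta_i(h) f||_{p_i} <= C S h^(r_i) e_i(log_2 h) for every single h. For each real T the system
   d_1 + ... + d_n = T,    r_i d_i + log_2 e_i(d_i) - T / p_i = H   for all i
has a solution: a box with sides 2^(d_i) has volume 2^T, and in every direction f oscillates inside it
by at most about S 2^H off a set of measure 2^T. As a perturbation of a linear system it has d_i and H
growing in T with rates close to beta_i and R/n - 1/P.

Let g = Delta_j(h) f, and let T be the scale with d_j(T) = log_2 h. If |g| > Y only on a set that is small
compared with the box of some scale, then expanding g by differences with steps v in this box and
integrating over v shows that |g| > K (Y + z) only on a set that is smaller by a fixed factor. Starting
from Chebyshev's inequality at scale T and iterating towards smaller measures yields a power bound for
the distribution function of g; since 1/q_j > 1/P - R/n, the levels grow more slowly than the measure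
to the power -1/q_j. This bounds both the L^q and the Lorentz norm of g by C S 2^(H + T/q_j). By the
choice of kappa_j and alpha_j this is C S h^(alpha_j) prod_i e_i(d_i)^(nu_i) with sum_i nu_i = 1 and
sum_i nu_i / theta_i = 1 / theta'_j, and the product is controlled by the L^theta_i norms of the e_i.
Marchaud's inequality makes the orders of the differences irrelevant; this is where the finiteness of
the measure of the level sets of f enters.
*)
theory Submission
  imports Defs
begin

section \<open>Partial differences\<close>

text \<open>Chebyshev's inequality puts them on one footing: a function with L^(p_i) norm S 2^(H +
  T/p_i) is of size S 2^H off a set of measure 2^T, whatever p_i is. This is why T / p_i enters the
  equations for the scales. Without weights these are linear: with b = R/n - 1/P the solution is H =
  b T and d_i = \<beta>_i T, and the \<beta>_i add up to 1. For h = 2^(d_j) this gives 2^(H + T/q_j)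
  = h^(\<alpha>_j), as \<alpha>_j \<beta>_j = b + 1/q_j; such is the origin of \<alpha>_j.
  Positivity of \<beta>_j makes d_j increasing, so that h determines T. The Lipschitz bound for the
  logarithms of the weights keeps the perturbed system solvable with nearly the same rates, and lets
  a bound at one step serve for all smaller ones. The iteration has room because -b < 1/q_j: an
  exponent \<rho> with -b < \<rho> < 1/q_j for the levels gives the tail power 1/\<rho> > q_j. With
  p_j < q_j < 1/\<rho> the integrals over levels converge at both ends, so the Lorentz norm with
  second index 1 costs no more than the L^q norm.\<close>

lemma partial_diff_Suc:
  "partial_diff (Suc k) j h f x = partial_diff k j h f (x + h *\<^sub>R axis j 1) - partial_diff k j h f x"
proof -
  define a where "a i = f (x + (real i * h) *\<^sub>R axis j 1)" for i
  have shift: "partial_diff k j h f (x + h *\<^sub>R axis j 1)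
     = (\<Sum>i\<le>k. (- 1) ^ (k - i) * real (k choose i) * a (Suc i))"
    unfolding partial_diff_def a_def by (simp add: algebra_simps)
  have "partial_diff (Suc k) j h f x
      = (- 1) ^ Suc k * a 0 + (\<Sum>i\<le>k. (- 1) ^ (k - i) * real (Suc k choose Suc i) * a (Suc i))"
    unfolding partial_diff_def a_def[symmetric] by (subst sum.atMost_Suc_shift) simp
  also have "\<dots> = (- 1) ^ Suc k * a 0 + (\<Sum>i\<le>k. (- 1) ^ (k - i) * real (k choose Suc i) * a (Suc i))
      + (\<Sum>i\<le>k. (- 1) ^ (k - i) * real (k choose i) * a (Suc i))"
    by (simp add: sum.distrib[symmetric] algebra_simps)
  also have "(- 1) ^ Suc k * a 0 + (\<Sum>i\<le>k. (- 1) ^ (k - i) * real (k choose Suc i) * a (Suc i))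
      = - (\<Sum>i\<le>k. (- 1) ^ (k - i) * real (k choose i) * a i)"
  proof (cases k)
    case (Suc n)
    have "(\<Sum>i\<le>k. (- 1) ^ (k - i) * real (k choose Suc i) * a (Suc i))
        = - (\<Sum>i\<le>n. (- 1) ^ (n - i) * real (k choose Suc i) * a (Suc i))"
      by (simp add: Suc sum_negf[symmetric] Suc_diff_le binomial_eq_0 del: binomial_Suc_Suc)
    moreover have "(\<Sum>i\<le>k. (- 1) ^ (k - i) * real (k choose i) * a i)
        = (- 1) ^ k * a 0 + (\<Sum>i\<le>n. (- 1) ^ (n - i) * real (k choose Suc i) * a (Suc i))"
      unfolding Suc by (subst sum.atMost_Suc_shift) simp
    ultimately show ?thesis by simp
  qed simp
  finally have "partial_diff (Suc k) j h f x = (\<Sum>i\<le>k. (- 1) ^ (k - i) * real (k choose i) * a (Suc i))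
      - partial_diff k j h f x"
    unfolding partial_diff_def a_def[symmetric] by simp
  then show ?thesis
    unfolding shift by simp
qed

lemma partial_diff_commute:
  "partial_diff k i h (partial_diff m j u f) x = partial_diff m j u (partial_diff k i h f) x"
  unfolding partial_diff_def
  by (subst (1 2) sum_distrib_left, subst sum.swap)
     (intro sum.cong refl, simp add: add_ac mult_ac)

lemma partial_diff_add_order:
  "partial_diff (a + k) j h f x = partial_diff a j h (partial_diff k j h f) x"
proof (induction a arbitrary: x)
  case 0
  show ?case by (simp add: partial_diff_def)
next
  case (Suc a)
  show ?case by (simp add: partial_diff_Suc Suc)
qed

lemma borel_measurable_partial_diff [measurable (raw)]:
  fixes f :: "real ^ 'n::finite \<Rightarrow> real"
  assumes [measurable]: "f \<in> borel_measurable borel" "u \<in> borel_measurable M" "v \<in> borel_measurable M"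
  shows "(\<lambda>z. partial_diff k j (u z) f (v z)) \<in> borel_measurable M"
  unfolding partial_diff_def by measurable

text \<open>The bound \<open>A\<close> is a real number and no p-th root is taken, so that constants
  can be computed in the reals. The sign of \<open>A\<close> is left to the lemmas.\<close>

definition Lp_le :: "real \<Rightarrow> (real ^ 'n \<Rightarrow> real) \<Rightarrow> real \<Rightarrow> bool" where
  "Lp_le p g A \<longleftrightarrow> (\<integral>\<^sup>+x. ennreal (\<bar>g x\<bar> powr p) \<partial>lborel) \<le> ennreal (A powr p)"

lemma nn_integral_lborel_shift:
  fixes F :: "'a::euclidean_space \<Rightarrow> ennreal"
  assumes [measurable]: "F \<in> borel_measurable borel"
  shows "(\<integral>\<^sup>+x. F (x + a) \<partial>lborel) = (\<integral>\<^sup>+x. F x \<partial>lborel)"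
  by (subst (2) lborel_distr_plus[of a, symmetric])
     (simp add: nn_integral_distr add.commute)

lemma Lp_le_shift:
  fixes g :: "real ^ 'n::finite \<Rightarrow> real"
  assumes [measurable]: "g \<in> borel_measurable borel" and "Lp_le p g A"
  shows "Lp_le p (\<lambda>x. g (x + a)) A"
  using assms(2) nn_integral_lborel_shift[of "\<lambda>x. ennreal (\<bar>g x\<bar> powr p)" a]
  unfolding Lp_le_def by simp

lemma Lp_le_mono:
  assumes "Lp_le p g A" "p > 0" "0 \<le> A" "A \<le> B"
  shows "Lp_le p g B"
proof -
  have "ennreal (A powr p) \<le> ennreal (B powr p)"
    using assms by (intro ennreal_leI powr_mono2) auto
  then show ?thesis using assms(1) unfolding Lp_le_def by (rule order_trans[rotated])
qed

text \<open>The largest term alone controls both sides, so exponents below 1 are covered as well;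
  these occur later in the form t / p.\<close>

lemma sum_powr_le:
  fixes y :: "'i \<Rightarrow> real"
  assumes "finite I" "p > 0" "\<And>i. i \<in> I \<Longrightarrow> y i \<ge> 0"
  shows "(\<Sum>i\<in>I. y i) powr p \<le> real (card I) powr p * (\<Sum>i\<in>I. y i powr p)"
proof (cases "I = {}")
  case False
  define M where "M = Max (y ` I)"
  have M: "M \<in> y ` I" "\<And>i. i \<in> I \<Longrightarrow> y i \<le> M"
    using assms(1) False by (auto simp: M_def)
  then obtain i0 where i0: "i0 \<in> I" "M = y i0" by auto
  have "(\<Sum>i\<in>I. y i) \<le> real (card I) * M"
    using M(2) by (rule sum_bounded_above[of I y M])
  then have "(\<Sum>i\<in>I. y i) powr p \<le> (real (card I) * M) powr p"
    using assms by (intro powr_mono2 sum_nonneg) auto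
  also have "\<dots> = real (card I) powr p * M powr p"
    by (rule powr_mult)
  also have "M powr p \<le> (\<Sum>i\<in>I. y i powr p)"
    unfolding i0(2) using i0(1) assms(1) by (intro member_le_sum) auto
  finally show ?thesis by (simp add: mult_left_mono)
qed simp

lemma nn_integral_powr_sum_le:
  fixes g :: "'i \<Rightarrow> real ^ 'n::finite \<Rightarrow> real"
  assumes "finite I" "p > 0" "c \<ge> 0"
    and [measurable]: "\<And>i. i \<in> I \<Longrightarrow> g i \<in> borel_measurable borel"
    and G: "\<And>x. \<bar>G x\<bar> \<le> c * (\<Sum>i\<in>I. \<bar>g i x\<bar>)"
  shows "(\<integral>\<^sup>+x. ennreal (\<bar>G x\<bar> powr p) \<partial>lborel)
     \<le> ennreal ((c * real (card I)) powr p) * (\<Sum>i\<in>I. (\<integral>\<^sup>+x. ennreal (\<bar>g i x\<bar> powr p) \<partial>lborel))"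
proof -
  have "\<bar>G x\<bar> powr p \<le> (c * real (card I)) powr p * (\<Sum>i\<in>I. \<bar>g i x\<bar> powr p)" for x
  proof -
    have "\<bar>G x\<bar> powr p \<le> (c * (\<Sum>i\<in>I. \<bar>g i x\<bar>)) powr p"
      using G assms by (intro powr_mono2) auto
    also have "\<dots> = c powr p * (\<Sum>i\<in>I. \<bar>g i x\<bar>) powr p"
      by (rule powr_mult)
    also have "\<dots> \<le> c powr p * (real (card I) powr p * (\<Sum>i\<in>I. \<bar>g i x\<bar> powr p))"
      using assms by (intro mult_left_mono sum_powr_le) auto
    finally show ?thesis using assms by (simp add: powr_mult mult.assoc)
  qed
  then have "(\<integral>\<^sup>+x. ennreal (\<bar>G x\<bar> powr p) \<partial>lborel)
      \<le> (\<integral>\<^sup>+x. ennreal ((c * real (card I)) powr p * (\<Sum>i\<in>I. \<bar>g i x\<bar> powr p)) \<partial>lborel)"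
    by (intro nn_integral_mono ennreal_leI)
  also have "\<dots> = (\<integral>\<^sup>+x. ennreal ((c * real (card I)) powr p) * (\<Sum>i\<in>I. ennreal (\<bar>g i x\<bar> powr p)) \<partial>lborel)"
    by (subst ennreal_mult) (auto intro!: sum_nonneg)
  also have "\<dots> = ennreal ((c * real (card I)) powr p) * (\<Sum>i\<in>I. (\<integral>\<^sup>+x. ennreal (\<bar>g i x\<bar> powr p) \<partial>lborel))"
    by (subst nn_integral_cmult, simp, subst nn_integral_sum) simp_all
  finally show ?thesis .
qed

text \<open>A crude substitute for Minkowski's inequality. Of the two factors \<open>card I\<close>,
  one comes from \<open>sum_powr_le\<close>, the other from adding up the integrals.\<close>

lemma Lp_le_sum:
  fixes g :: "'i \<Rightarrow> real ^ 'n::finite \<Rightarrow> real"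
  assumes "finite I" "p \<ge> 1" "c \<ge> 0" "A \<ge> 0"
    and "\<And>i. i \<in> I \<Longrightarrow> g i \<in> borel_measurable borel"
    and le: "\<And>i. i \<in> I \<Longrightarrow> Lp_le p (g i) A"
    and G: "\<And>x. \<bar>G x\<bar> \<le> c * (\<Sum>i\<in>I. \<bar>g i x\<bar>)"
  shows "Lp_le p G (c * real (card I) ^ 2 * A)"
proof (cases "I = {}")
  case True
  then have "\<And>x. G x = 0" using G by simp
  then show ?thesis using True assms(2) by (simp add: Lp_le_def)
next
  case False
  then have card: "real (card I) \<ge> 1" using assms(1) by (simp add: Suc_leI card_gt_0_iff)
  have "(\<integral>\<^sup>+x. ennreal (\<bar>G x\<bar> powr p) \<partial>lborel)
     \<le> ennreal ((c * real (card I)) powr p) * (\<Sum>i\<in>I. (\<integral>\<^sup>+x. ennreal (\<bar>g i x\<bar> powr p) \<partial>lborel))"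
    using assms by (intro nn_integral_powr_sum_le) auto
  also have "\<dots> \<le> ennreal ((c * real (card I)) powr p) * (\<Sum>i\<in>I. ennreal (A powr p))"
    using le unfolding Lp_le_def by (intro mult_left_mono sum_mono) auto
  also have "\<dots> = ennreal ((c * real (card I)) powr p * (real (card I) * A powr p))"
    by (simp add: ennreal_mult ennreal_of_nat_eq_real_of_nat)
  also have "\<dots> \<le> ennreal ((c * real (card I)) powr p * (real (card I) powr p * A powr p))"
    using card assms(2) powr_mono[of 1 p "real (card I)"]
    by (intro ennreal_leI mult_left_mono mult_right_mono) auto
  also have "\<dots> = ennreal ((c * real (card I) ^ 2 * A) powr p)"
    using assms card by (simp add: powr_mult[symmetric] power2_eq_square mult_ac)
  finally show ?thesis unfolding Lp_le_def .
qed

lemma abs_partial_diff_le: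
  "\<bar>partial_diff k j h f x\<bar> \<le> 2 ^ k * (\<Sum>i\<le>k. \<bar>f (x + (real i * h) *\<^sub>R axis j 1)\<bar>)"
proof -
  have "\<bar>partial_diff k j h f x\<bar> \<le> (\<Sum>i\<le>k. \<bar>(- 1) ^ (k - i) * real (k choose i) * f (x + (real i * h) *\<^sub>R axis j 1)\<bar>)"
    unfolding partial_diff_def by (rule sum_abs)
  also have "\<dots> \<le> (\<Sum>i\<le>k. 2 ^ k * \<bar>f (x + (real i * h) *\<^sub>R axis j 1)\<bar>)"
  proof (intro sum_mono)
    fix i assume "i \<in> {..k}"
    then have "real (k choose i) \<le> 2 ^ k"
      using of_nat_mono[OF binomial_le_pow2[of k i], where 'a=real] by simp
    then show "\<bar>(- 1) ^ (k - i) * real (k choose i) * f (x + (real i * h) *\<^sub>R axis j 1)\<bar>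
        \<le> 2 ^ k * \<bar>f (x + (real i * h) *\<^sub>R axis j 1)\<bar>"
      by (simp add: abs_mult mult_right_mono)
  qed
  finally show ?thesis by (simp add: sum_distrib_left)
qed

lemma Lp_le_partial_diff:
  fixes g :: "real ^ 'n::finite \<Rightarrow> real"
  assumes [measurable]: "g \<in> borel_measurable borel" and "Lp_le p g A" "p \<ge> 1" "A \<ge> 0"
  shows "Lp_le p (partial_diff k j h g) (2 ^ k * real (Suc k) ^ 2 * A)"
  using Lp_le_sum[of "{..k}" p "2 ^ k" A "\<lambda>i x. g (x + (real i * h) *\<^sub>R axis j 1)" "partial_diff k j h g"]
    abs_partial_diff_le[of k j h g] assms Lp_le_shift[OF assms(1,2)]
  by simp

text \<open>Raising the order costs only a constant, because the difference of order
  \<open>k\<close> is one of order \<open>k - m\<close> applied to that of order \<open>m\<close>.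
  Lowering the order is the subject of Marchaud's inequality.\<close>

lemma Lp_le_partial_diff_order:
  fixes f :: "real ^ 'n::finite \<Rightarrow> real"
  assumes [measurable]: "f \<in> borel_measurable borel" and "Lp_le p (partial_diff m j h f) A" "p \<ge> 1" "A \<ge> 0"
    and "m \<le> k"
  shows "Lp_le p (partial_diff k j h f) (2 ^ k * real (Suc k) ^ 2 * A)"
proof -
  have "partial_diff k j h f = partial_diff (k - m) j h (partial_diff m j h f)"
    using partial_diff_add_order[of "k - m" m j h f] assms(5) by auto
  then have "Lp_le p (partial_diff k j h f) (2 ^ (k - m) * real (Suc (k - m)) ^ 2 * A)"
    using assms Lp_le_partial_diff[of "partial_diff m j h f" p A "k - m" j h] by simp
  moreover have "2 ^ (k - m) * real (Suc (k - m)) ^ 2 * A \<le> 2 ^ k * real (Suc k) ^ 2 * A"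
    using assms by (intro mult_right_mono mult_mono power_mono power_increasing) auto
  ultimately show ?thesis using assms by (intro Lp_le_mono[where B="2 ^ k * real (Suc k) ^ 2 * A"]) auto
qed

lemma Lp_le_Markov:
  fixes g :: "real ^ 'n::finite \<Rightarrow> real"
  assumes [measurable]: "g \<in> borel_measurable borel" and "Lp_le p g A" "p > 0" "z > 0" "A \<ge> 0"
  shows "emeasure lborel {x. \<bar>g x\<bar> > z} \<le> ennreal ((A / z) powr p)"
proof -
  have "{x. \<bar>g x\<bar> > z} \<subseteq> {x\<in>space lborel. 1 \<le> ennreal ((1 / z) powr p) * ennreal (\<bar>g x\<bar> powr p)}"
  proof safe
    fix x assume "z < \<bar>g x\<bar>"
    then have "1 \<le> (\<bar>g x\<bar> / z) powr p" using assms by (intro ge_one_powr_ge_zero) auto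
    then show "1 \<le> ennreal ((1 / z) powr p) * ennreal (\<bar>g x\<bar> powr p)"
      using assms by (simp add: ennreal_mult[symmetric] powr_divide)
  qed simp
  then have "emeasure lborel {x. \<bar>g x\<bar> > z}
      \<le> emeasure lborel {x\<in>space lborel. 1 \<le> ennreal ((1 / z) powr p) * ennreal (\<bar>g x\<bar> powr p)}"
    by (intro emeasure_mono) auto
  also have "\<dots> \<le> ennreal ((1 / z) powr p) * (\<integral>\<^sup>+x. ennreal (\<bar>g x\<bar> powr p) \<partial>lborel)"
    using nn_integral_Markov_inequality[of "\<lambda>x. ennreal (\<bar>g x\<bar> powr p)" UNIV lborel "ennreal ((1 / z) powr p)"]
    by simp
  also have "\<dots> \<le> ennreal ((1 / z) powr p) * ennreal (A powr p)"
    using assms(2) unfolding Lp_le_def by (intro mult_left_mono) auto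
  also have "\<dots> = ennreal ((A / z) powr p)"
    using assms by (simp add: ennreal_mult[symmetric] powr_divide)
  finally show ?thesis .
qed

section \<open>Marchaud's inequality\<close>

lemma sum_binomial_Suc:
  fixes u :: "nat \<Rightarrow> real"
  shows "(\<Sum>a\<le>Suc k. real (Suc k choose a) * u a) = (\<Sum>a\<le>k. real (k choose a) * (u a + u (Suc a)))"
proof -
  have "(\<Sum>a\<le>Suc k. real (Suc k choose a) * u a) = u 0 + (\<Sum>a\<le>k. real (Suc k choose Suc a) * u (Suc a))"
    by (subst sum.atMost_Suc_shift) simp
  also have "\<dots> = u 0 + (\<Sum>a\<le>k. real (k choose Suc a) * u (Suc a)) + (\<Sum>a\<le>k. real (k choose a) * u (Suc a))"
    by (simp add: sum.distrib[symmetric] algebra_simps)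
  also have "u 0 + (\<Sum>a\<le>k. real (k choose Suc a) * u (Suc a)) = (\<Sum>a\<le>Suc k. real (k choose a) * u a)"
    unfolding sum.atMost_Suc_shift by simp
  finally show ?thesis by (simp add: sum.distrib[symmetric] algebra_simps binomial_eq_0)
qed

text \<open>With E the shift by h this is (E^2 - 1)^k = (E + 1)^k (E - 1)^k, where (E + 1)^k is
  expanded binomially.\<close>

lemma partial_diff_double:
  "partial_diff k j (2 * h) f x = (\<Sum>a\<le>k. real (k choose a) * partial_diff k j h f (x + (real a * h) *\<^sub>R axis j 1))"
proof (induction k arbitrary: x)
  case 0
  show ?case by (simp add: partial_diff_def)
next
  case (Suc k)
  have "partial_diff (Suc k) j (2 * h) f x
     = (\<Sum>a\<le>k. real (k choose a) * (partial_diff k j h f (x + (2 * h) *\<^sub>R axis j 1 + (real a * h) *\<^sub>R axis j 1)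
         - partial_diff k j h f (x + (real a * h) *\<^sub>R axis j 1)))"
    by (simp add: partial_diff_Suc Suc sum_subtractf[symmetric] right_diff_distrib)
  also have "\<dots> = (\<Sum>a\<le>k. real (k choose a) * (partial_diff (Suc k) j h f (x + (real a * h) *\<^sub>R axis j 1)
         + partial_diff (Suc k) j h f (x + (real (Suc a) * h) *\<^sub>R axis j 1)))"
  proof (intro sum.cong refl)
    fix a
    have "x + (2 * h) *\<^sub>R axis j 1 + (real a * h) *\<^sub>R axis j 1
        = x + (real a * h) *\<^sub>R axis j 1 + h *\<^sub>R axis j 1 + h *\<^sub>R axis j 1"
      "x + (real (Suc a) * h) *\<^sub>R axis j 1 = x + (real a * h) *\<^sub>R axis j 1 + h *\<^sub>R axis j 1"
      by (simp_all add: vec_eq_iff algebra_simps)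
    then show "real (k choose a) * (partial_diff k j h f (x + (2 * h) *\<^sub>R axis j 1 + (real a * h) *\<^sub>R axis j 1)
         - partial_diff k j h f (x + (real a * h) *\<^sub>R axis j 1))
       = real (k choose a) * (partial_diff (Suc k) j h f (x + (real a * h) *\<^sub>R axis j 1)
         + partial_diff (Suc k) j h f (x + (real (Suc a) * h) *\<^sub>R axis j 1))"
      by (simp only: partial_diff_Suc) simp
  qed
  finally show ?case
    by (subst sum_binomial_Suc)
qed

lemma partial_diff_telescope:
  "partial_diff k j h f (x + (real a * h) *\<^sub>R axis j 1) - partial_diff k j h f x
     = (\<Sum>b<a. partial_diff (Suc k) j h f (x + (real b * h) *\<^sub>R axis j 1))"
  by (induction a) (simp_all add: partial_diff_Suc algebra_simps)

text \<open>In \<open>partial_diff_double\<close> every shifted difference is replaced by the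
  unshifted one. The coefficients add up to 2^k, and each error telescopes into at most k
  differences of order k + 1.\<close>

lemma Marchaud_step:
  "\<bar>partial_diff k j h f x\<bar> \<le> \<bar>partial_diff k j (2 * h) f x\<bar> / 2 ^ k
     + (\<Sum>b<k. \<bar>partial_diff (Suc k) j h f (x + (real b * h) *\<^sub>R axis j 1)\<bar>)"
proof -
  let ?G = "\<Sum>b<k. \<bar>partial_diff (Suc k) j h f (x + (real b * h) *\<^sub>R axis j 1)\<bar>"
  have two: "(\<Sum>a\<le>k. real (k choose a)) = 2 ^ k"
    by (metis (mono_tags) choose_row_sum of_nat_numeral of_nat_power of_nat_sum sum.cong)
  have "2 ^ k * partial_diff k j h f x = partial_diff k j (2 * h) f x
     - (\<Sum>a\<le>k. real (k choose a) * (partial_diff k j h f (x + (real a * h) *\<^sub>R axis j 1) - partial_diff k j h f x))"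
    unfolding partial_diff_double right_diff_distrib sum_subtractf sum_distrib_right[symmetric] two by simp
  also have "\<bar>\<dots>\<bar> \<le> \<bar>partial_diff k j (2 * h) f x\<bar>
     + (\<Sum>a\<le>k. \<bar>real (k choose a) * (partial_diff k j h f (x + (real a * h) *\<^sub>R axis j 1) - partial_diff k j h f x)\<bar>)"
    by (rule order_trans[OF abs_triangle_ineq4]) (intro add_left_mono sum_abs)
  also have "(\<Sum>a\<le>k. \<bar>real (k choose a) * (partial_diff k j h f (x + (real a * h) *\<^sub>R axis j 1) - partial_diff k j h f x)\<bar>)
      \<le> (\<Sum>a\<le>k. real (k choose a) * ?G)"
  proof (intro sum_mono)
    fix a assume "a \<in> {..k}"
    then have "\<bar>partial_diff k j h f (x + (real a * h) *\<^sub>R axis j 1) - partial_diff k j h f x\<bar> \<le> ?G"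
      unfolding partial_diff_telescope by (intro order_trans[OF sum_abs] sum_mono2) auto
    then show "\<bar>real (k choose a) * (partial_diff k j h f (x + (real a * h) *\<^sub>R axis j 1) - partial_diff k j h f x)\<bar>
        \<le> real (k choose a) * ?G"
      by (simp add: abs_mult mult_left_mono)
  qed
  also have "\<dots> = 2 ^ k * ?G"
    by (simp add: sum_distrib_right[symmetric] two)
  finally show ?thesis
    by (simp add: abs_mult field_simps)
qed

lemma Marchaud_iterate:
  "\<bar>partial_diff k j h f x\<bar> \<le> \<bar>partial_diff k j (2 ^ N * h) f x\<bar> / 2 ^ (k * N)
     + (\<Sum>i<N. (\<Sum>b<k. \<bar>partial_diff (Suc k) j (2 ^ i * h) f (x + (real b * (2 ^ i * h)) *\<^sub>R axis j 1)\<bar>) / 2 ^ (k * i))"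
proof (induction N)
  case (Suc N)
  have "\<bar>partial_diff k j (2 ^ N * h) f x\<bar> / 2 ^ (k * N)
      \<le> (\<bar>partial_diff k j (2 * (2 ^ N * h)) f x\<bar> / 2 ^ k
        + (\<Sum>b<k. \<bar>partial_diff (Suc k) j (2 ^ N * h) f (x + (real b * (2 ^ N * h)) *\<^sub>R axis j 1)\<bar>)) / 2 ^ (k * N)"
    by (intro divide_right_mono Marchaud_step) simp
  then show ?case using Suc by (simp add: add_divide_distrib power_add mult_ac)
qed simp

abbreviation finite_levels :: "('a::euclidean_space \<Rightarrow> real) \<Rightarrow> bool" where
  "finite_levels f \<equiv> \<forall>y>0. emeasure lborel {x. \<bar>f x\<bar> > y} < \<infinity>"

text \<open>Continuity from above: the sets shrink to the empty set because \<open>f\<close> has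
  real values, and the finite measures permit the passage to the limit.\<close>

lemma emeasure_level_tendsto_0:
  fixes f :: "'a::euclidean_space \<Rightarrow> real"
  assumes [measurable]: "f \<in> borel_measurable borel"
    and fin: "finite_levels f"
    and "c > 0" "k \<ge> (1::nat)"
  shows "(\<lambda>N. emeasure lborel {x. \<bar>f x\<bar> > c * 2 ^ (k * N)}) \<longlonglongrightarrow> 0"
proof -
  define A where "A N = {x. \<bar>f x\<bar> > c * 2 ^ (k * N)}" for N :: nat
  have "decseq A"
    unfolding decseq_def A_def using assms(3)
    by (auto elim!: order_le_less_trans[rotated] intro!: mult_left_mono power_increasing)
  moreover have "range A \<subseteq> sets lborel" unfolding A_def by auto
  moreover have "emeasure lborel (A N) \<noteq> \<infinity>" for N
    unfolding A_def using fin assms(3) by (auto simp: less_top[symmetric])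
  ultimately have "(\<lambda>N. emeasure lborel (A N)) \<longlonglongrightarrow> emeasure lborel (\<Inter>N. A N)"
    by (intro Lim_emeasure_decseq)
  moreover have "(\<Inter>N. A N) = {}"
  proof safe
    fix x assume x: "x \<in> (\<Inter>N. A N)"
    obtain N where "\<bar>f x\<bar> / c < 2 ^ N"
      using real_arch_pow[of 2 "\<bar>f x\<bar> / c"] by auto
    moreover have "(2::real) ^ N \<le> 2 ^ (k * N)"
      using assms(4) by (intro power_increasing) auto
    ultimately have "\<bar>f x\<bar> / c < 2 ^ (k * N)"
      by (rule less_le_trans)
    then have "\<bar>f x\<bar> < c * 2 ^ (k * N)"
      using assms(3) by (simp add: pos_divide_less_eq mult.commute)
    moreover have "x \<in> A N" using x by blast
    ultimately show "x \<in> {}" by (simp add: A_def)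
  qed
  ultimately show ?thesis unfolding A_def by simp
qed

text \<open>If a sum of k + 1 terms is large, one of the terms has its share of it, and all shifted
  copies of \<open>f\<close> have level sets of the same measure.\<close>

lemma emeasure_partial_diff_level:
  fixes f :: "real ^ 'n::finite \<Rightarrow> real"
  assumes [measurable]: "f \<in> borel_measurable borel"
  shows "emeasure lborel {x. \<bar>partial_diff k j h f x\<bar> > y}
     \<le> of_nat (Suc k) * emeasure lborel {x. \<bar>f x\<bar> > y / (2 ^ k * real (Suc k))}"
proof -
  let ?B = "{x. \<bar>f x\<bar> > y / (2 ^ k * real (Suc k))}"
  let ?B' = "\<lambda>i. {x. \<bar>f (x + (real i * h) *\<^sub>R axis j 1)\<bar> > y / (2 ^ k * real (Suc k))}"
  have "{x. \<bar>partial_diff k j h f x\<bar> > y} \<subseteq> (\<Union>i\<le>k. ?B' i)"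
  proof
    fix x assume x: "x \<in> {x. \<bar>partial_diff k j h f x\<bar> > y}"
    show "x \<in> (\<Union>i\<le>k. ?B' i)"
    proof (rule ccontr)
      assume "x \<notin> (\<Union>i\<le>k. ?B' i)"
      then have "(\<Sum>i\<le>k. \<bar>f (x + (real i * h) *\<^sub>R axis j 1)\<bar>) \<le> (\<Sum>i\<le>k. y / (2 ^ k * real (Suc k)))"
        by (intro sum_mono) (auto simp: not_less)
      then have "2 ^ k * (\<Sum>i\<le>k. \<bar>f (x + (real i * h) *\<^sub>R axis j 1)\<bar>) \<le> 2 ^ k * (real (Suc k) * (y / (2 ^ k * real (Suc k))))"
        by (intro mult_left_mono) auto
      also have "\<dots> = y" by simp
      finally show False using abs_partial_diff_le[of k j h f x] x by simp
    qed
  qed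
  then have "emeasure lborel {x. \<bar>partial_diff k j h f x\<bar> > y} \<le> emeasure lborel (\<Union>i\<le>k. ?B' i)"
    by (intro emeasure_mono) auto
  also have "\<dots> \<le> (\<Sum>i\<le>k. emeasure lborel (?B' i))"
    by (intro emeasure_subadditive_finite) auto
  also have "\<dots> = (\<Sum>i\<le>k. emeasure lborel ?B)"
  proof (intro sum.cong refl)
    fix i
    have "emeasure lborel (?B' i) = (\<integral>\<^sup>+x. indicator (?B' i) x \<partial>lborel)"
      by simp
    also have "\<dots> = (\<integral>\<^sup>+x. indicator ?B (x + (real i * h) *\<^sub>R axis j 1) \<partial>lborel)"
      by (intro nn_integral_cong) (simp add: indicator_def)
    also have "\<dots> = (\<integral>\<^sup>+x. indicator ?B x \<partial>lborel)"
      by (rule nn_integral_lborel_shift) auto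
    finally show "emeasure lborel (?B' i) = emeasure lborel ?B" by simp
  qed
  finally show ?thesis by simp
qed

text \<open>Splitting off a factor \<^term>\<open>\<sigma> ^ i\<close> leaves only the largest term to estimate; this replaces Minkowski's
  inequality for infinitely many summands.\<close>

lemma geometric_sum_powr_le:
  fixes y :: "nat \<Rightarrow> real"
  assumes "p > 0" "0 < \<sigma>" "\<sigma> < 1" "\<And>i. y i \<ge> 0"
  shows "(\<Sum>i<N. (\<sigma> ^ 2) ^ i * y i) powr p \<le> (1 / (1 - \<sigma>)) powr p * (\<Sum>i<N. (\<sigma> powr p) ^ i * y i powr p)"
proof (cases "N = 0")
  case False
  define M where "M = Max ((\<lambda>i. \<sigma> ^ i * y i) ` {..<N})"
  have M: "M \<in> (\<lambda>i. \<sigma> ^ i * y i) ` {..<N}" "\<And>i. i < N \<Longrightarrow> \<sigma> ^ i * y i \<le> M"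
    using False unfolding M_def by (auto intro!: Max_in)
  then obtain i0 where i0: "i0 < N" "M = \<sigma> ^ i0 * y i0" by auto
  then have M0: "M \<ge> 0" using assms by simp
  have geo: "(\<Sum>i<N. \<sigma> ^ i) \<le> 1 / (1 - \<sigma>)"
    using assms by (simp add: sum_gp_strict divide_right_mono)
  have "(\<Sum>i<N. (\<sigma> ^ 2) ^ i * y i) = (\<Sum>i<N. \<sigma> ^ i * (\<sigma> ^ i * y i))"
    by (simp add: power_mult[symmetric] power2_eq_square power_mult_distrib mult.assoc)
  also have "\<dots> \<le> (\<Sum>i<N. \<sigma> ^ i * M)"
    using M(2) assms by (intro sum_mono mult_left_mono) auto
  also have "\<dots> \<le> 1 / (1 - \<sigma>) * M"
    unfolding sum_distrib_right[symmetric] using geo M0 by (intro mult_right_mono)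
  finally have "(\<Sum>i<N. (\<sigma> ^ 2) ^ i * y i) powr p \<le> (1 / (1 - \<sigma>) * M) powr p"
    using assms by (intro powr_mono2 sum_nonneg) auto
  also have "\<dots> = (1 / (1 - \<sigma>)) powr p * M powr p"
    by (rule powr_mult)
  also have "M powr p = (\<sigma> powr p) ^ i0 * y i0 powr p"
    using assms by (simp add: i0 powr_mult powr_realpow[symmetric] powr_powr mult.commute)
  also have "\<dots> \<le> (\<Sum>i<N. (\<sigma> powr p) ^ i * y i powr p)"
    using i0(1) by (intro member_le_sum) auto
  finally show ?thesis by (simp add: mult_left_mono)
qed simp

text \<open>Infinite iteration of \<open>Marchaud_step\<close>. The bounds for order k + 1 may grow
  by \<rho> with each doubling of the step while each iteration gains 2^(-k), so the series is
  geometric with ratio \<rho> / 2^k < 1. The term left over after N doublings is controlled in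
  measure only.\<close>

lemma Lp_le_Marchaud:
  fixes f :: "real ^ 'n::finite \<Rightarrow> real"
  assumes [measurable]: "f \<in> borel_measurable borel"
    and fin: "finite_levels f"
    and "p \<ge> 1" "k \<ge> 1" "A \<ge> 0" "0 < \<rho>" "\<rho> < 2 ^ k"
    and le: "\<And>i. Lp_le p (partial_diff (Suc k) j (2 ^ i * h) f) (\<rho> ^ i * A)"
  shows "Lp_le p (partial_diff k j h f) ((1 / (1 - sqrt (\<rho> / 2 ^ k))) ^ 2 * real k ^ 2 * A)"
proof -
  \<comment> \<open>The square root splits the ratio \<rho> / 2^k into two equal factors, as
    \<open>geometric_sum_powr_le\<close> demands.\<close>
  define \<sigma> where "\<sigma> = sqrt (\<rho> / 2 ^ k)"
  have \<sigma>: "0 < \<sigma>" "\<sigma> < 1" "\<sigma> ^ 2 = \<rho> / 2 ^ k"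
    using assms(6,7) by (auto simp: \<sigma>_def real_sqrt_lt_1_iff)
  \<comment> \<open>Division by \<rho>^i gives all terms the same L^p bound; the factor comes back
    as a power of \<sigma>^2 in the sum \<open>s\<close>.\<close>
  define y where "y i x = (\<Sum>b<k. \<bar>partial_diff (Suc k) j (2 ^ i * h) f (x + (real b * (2 ^ i * h)) *\<^sub>R axis j 1)\<bar>) / \<rho> ^ i"
    for i x
  have [measurable]: "y i \<in> borel_measurable borel" for i
    unfolding y_def by measurable
  have y0: "y i x \<ge> 0" for i x
    unfolding y_def using assms(6) by (intro divide_nonneg_nonneg sum_nonneg) auto
  define B where "B = real k ^ 2 * A"
  have B0: "B \<ge> 0" using assms by (simp add: B_def)
  have yB: "Lp_le p (y i) B" for i
  proof -
    have "Lp_le p (y i) (1 / \<rho> ^ i * real (card {..<k}) ^ 2 * (\<rho> ^ i * A))"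
    proof (rule Lp_le_sum[where g="\<lambda>b x. partial_diff (Suc k) j (2 ^ i * h) f (x + (real b * (2 ^ i * h)) *\<^sub>R axis j 1)"])
      show "Lp_le p (\<lambda>x. partial_diff (Suc k) j (2 ^ i * h) f (x + (real b * (2 ^ i * h)) *\<^sub>R axis j 1)) (\<rho> ^ i * A)" for b
        by (intro Lp_le_shift le) simp
      show "\<bar>y i x\<bar> \<le> 1 / \<rho> ^ i * (\<Sum>b<k. \<bar>partial_diff (Suc k) j (2 ^ i * h) f (x + (real b * (2 ^ i * h)) *\<^sub>R axis j 1)\<bar>)" for x
        using y0[of i x] by (simp add: y_def)
    qed (use assms in auto)
    then show ?thesis using assms(6) by (simp add: B_def)
  qed
  define s where "s N x = (\<Sum>i<N. (\<sigma> ^ 2) ^ i * y i x)" for N x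
  have [measurable]: "s N \<in> borel_measurable borel" for N
    unfolding s_def by measurable
  have s0: "s N x \<ge> 0" for N x
    unfolding s_def using y0 by (intro sum_nonneg) auto
  have s_mono: "s N x \<le> s N' x" if "N \<le> N'" for N N' x
    unfolding s_def using y0 that by (intro sum_mono2) auto
  have iter: "\<bar>partial_diff k j h f x\<bar> \<le> \<bar>partial_diff k j (2 ^ N * h) f x\<bar> / 2 ^ (k * N) + s N x" for N x
    using Marchaud_iterate[of k j h f x N] assms(6)
    by (simp add: s_def y_def \<sigma>(3) power_divide power_mult[symmetric])
  define K where "K = 1 / (1 - \<sigma>)"
  have K1: "K \<ge> 1" using \<sigma> by (simp add: K_def)
  have sB: "(\<integral>\<^sup>+x. ennreal (s N x powr p) \<partial>lborel) \<le> ennreal ((K ^ 2 * B) powr p)" for N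
  proof -
    have "(\<integral>\<^sup>+x. ennreal (s N x powr p) \<partial>lborel)
       \<le> (\<integral>\<^sup>+x. ennreal (K powr p * (\<Sum>i<N. (\<sigma> powr p) ^ i * y i x powr p)) \<partial>lborel)"
      unfolding s_def K_def using \<sigma> y0 assms
      by (intro nn_integral_mono ennreal_leI geometric_sum_powr_le) auto
    also have "\<dots> = (\<integral>\<^sup>+x. ennreal (K powr p) * (\<Sum>i<N. ennreal ((\<sigma> powr p) ^ i) * ennreal (\<bar>y i x\<bar> powr p)) \<partial>lborel)"
      using y0 by (simp add: ennreal_mult[symmetric] sum_nonneg)
    also have "\<dots> = ennreal (K powr p) * (\<Sum>i<N. ennreal ((\<sigma> powr p) ^ i) * (\<integral>\<^sup>+x. ennreal (\<bar>y i x\<bar> powr p) \<partial>lborel))"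
      by (subst nn_integral_cmult, simp, subst nn_integral_sum) (simp_all add: nn_integral_cmult)
    also have "\<dots> \<le> ennreal (K powr p) * (\<Sum>i<N. ennreal ((\<sigma> powr p) ^ i) * ennreal (B powr p))"
      using yB unfolding Lp_le_def by (intro mult_left_mono sum_mono) auto
    also have "\<dots> = ennreal (K powr p * ((\<Sum>i<N. (\<sigma> powr p) ^ i) * B powr p))"
      by (simp add: ennreal_mult[symmetric] sum_distrib_right sum_nonneg)
    also have "\<dots> \<le> ennreal (K powr p * (K powr p * B powr p))"
    proof (intro ennreal_leI mult_left_mono mult_right_mono)
      \<comment> \<open>Here p \<ge> 1 enters twice: \<sigma>^p \<le> \<sigma> because \<sigma> < 1,
        and K \<le> K^p because K \<ge> 1.\<close>
      have *: "\<sigma> powr p \<le> \<sigma>" using powr_mono'[of 1 p \<sigma>] \<sigma> assms(3) by simp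
      have "(\<Sum>i<N. (\<sigma> powr p) ^ i) \<le> (\<Sum>i<N. \<sigma> ^ i)"
        using * by (intro sum_mono power_mono) auto
      also have "\<dots> \<le> K" using \<sigma> by (simp add: K_def sum_gp_strict divide_right_mono)
      also have "K \<le> K powr p" using powr_mono[of 1 p K] K1 assms(3) by simp
      finally show "(\<Sum>i<N. (\<sigma> powr p) ^ i) \<le> K powr p" .
    qed auto
    also have "\<dots> = ennreal ((K ^ 2 * B) powr p)"
      by (simp add: powr_mult[symmetric] power2_eq_square mult.assoc)
    finally show ?thesis .
  qed
  \<comment> \<open>The remainder \<open>\<Delta>\<^sup>k(2\<^sup>N h) f / 2\<^bsup>k N\<^esup>\<close> tends to 0 in measure because the level sets of \<open>f\<close> have finite measure.\<close>
  have null: "{x. \<forall>N. \<bar>partial_diff k j h f x\<bar> > s N x + \<epsilon>} \<in> null_sets lborel" (is "?X \<in> _") if "\<epsilon> > 0" for \<epsilon>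
  proof -
    define c where "c = \<epsilon> / (2 ^ k * real (Suc k))"
    have "emeasure lborel ?X \<le> of_nat (Suc k) * emeasure lborel {x. \<bar>f x\<bar> > c * 2 ^ (k * N)}" for N
    proof -
      have "?X \<subseteq> {x. \<bar>partial_diff k j (2 ^ N * h) f x\<bar> > \<epsilon> * 2 ^ (k * N)}"
      proof safe
        fix x assume "\<forall>N. \<bar>partial_diff k j h f x\<bar> > s N x + \<epsilon>"
        then have "\<epsilon> < \<bar>partial_diff k j (2 ^ N * h) f x\<bar> / 2 ^ (k * N)"
          using iter[of x N] by (smt (verit))
        then show "\<bar>partial_diff k j (2 ^ N * h) f x\<bar> > \<epsilon> * 2 ^ (k * N)"
          by (simp add: pos_less_divide_eq)
      qed
      then have "emeasure lborel ?X \<le> emeasure lborel {x. \<bar>partial_diff k j (2 ^ N * h) f x\<bar> > \<epsilon> * 2 ^ (k * N)}"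
        by (intro emeasure_mono) auto
      also have "\<dots> \<le> of_nat (Suc k) * emeasure lborel {x. \<bar>f x\<bar> > \<epsilon> * 2 ^ (k * N) / (2 ^ k * real (Suc k))}"
        by (rule emeasure_partial_diff_level) simp
      finally show ?thesis by (simp add: c_def)
    qed
    moreover have "(\<lambda>N. of_nat (Suc k) * emeasure lborel {x. \<bar>f x\<bar> > c * 2 ^ (k * N)}) \<longlonglongrightarrow> of_nat (Suc k) * 0"
      using that assms(4) by (intro ennreal_tendsto_cmult emeasure_level_tendsto_0 fin) (auto simp: c_def of_nat_less_top)
    ultimately have "emeasure lborel ?X \<le> 0"
      by (intro LIMSEQ_le_const[where x=0]) auto
    then show ?thesis by (intro null_setsI) auto
  qed
  \<comment> \<open>Countably many \<epsilon> = 1 / (n + 1) suffice, so the exceptional sets can be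
    united; the limit in n then shows that the supremum of the \<open>s N\<close> dominates the
    difference.\<close>
  have "AE x in lborel. \<forall>n. \<exists>N. \<bar>partial_diff k j h f x\<bar> \<le> s N x + 1 / real (Suc n)"
    unfolding AE_all_countable
  proof
    fix n
    show "AE x in lborel. \<exists>N. \<bar>partial_diff k j h f x\<bar> \<le> s N x + 1 / real (Suc n)"
      by (rule AE_I'[OF null[of "1 / real (Suc n)"]]) (auto simp: not_le)
  qed
  then have "AE x in lborel. ennreal (\<bar>partial_diff k j h f x\<bar> powr p) \<le> (SUP N. ennreal (s N x powr p))"
  proof eventually_elim
    case (elim x)
    let ?D = "\<bar>partial_diff k j h f x\<bar>"
    have "(\<lambda>n. max 0 (?D - 1 / real (Suc n)) powr p) \<longlonglongrightarrow> max 0 (?D - 0) powr p"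
      using assms(3) by (intro tendsto_powr' tendsto_max tendsto_diff tendsto_const LIMSEQ_Suc[OF lim_1_over_n]) auto
    then have "(\<lambda>n. ennreal (max 0 (?D - 1 / real (Suc n)) powr p)) \<longlonglongrightarrow> ennreal (?D powr p)"
      by (intro tendsto_ennrealI) simp
    moreover have "ennreal (max 0 (?D - 1 / real (Suc n)) powr p) \<le> (SUP N. ennreal (s N x powr p))" for n
    proof -
      obtain N where "?D \<le> s N x + 1 / real (Suc n)" using elim by blast
      then have "ennreal (max 0 (?D - 1 / real (Suc n)) powr p) \<le> ennreal (s N x powr p)"
        using s0[of N x] assms(3) by (intro ennreal_leI powr_mono2) auto
      also have "\<dots> \<le> (SUP N. ennreal (s N x powr p))" by (rule SUP_upper) simp
      finally show ?thesis .
    qed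
    ultimately show ?case by (intro LIMSEQ_le_const2[where X="\<lambda>n. ennreal (max 0 (?D - 1 / real (Suc n)) powr p)"]) auto
  qed
  then have "(\<integral>\<^sup>+x. ennreal (\<bar>partial_diff k j h f x\<bar> powr p) \<partial>lborel) \<le> (\<integral>\<^sup>+x. (SUP N. ennreal (s N x powr p)) \<partial>lborel)"
    by (rule nn_integral_mono_AE)
  also have "\<dots> = (SUP N. (\<integral>\<^sup>+x. ennreal (s N x powr p) \<partial>lborel))"
    using s_mono s0 assms(3)
    by (intro nn_integral_monotone_convergence_SUP) (auto simp: incseq_def le_fun_def intro!: ennreal_leI powr_mono2)
  also have "\<dots> \<le> ennreal ((K ^ 2 * B) powr p)"
    using sB by (intro SUP_least)
  finally show ?thesis
    unfolding Lp_le_def K_def B_def \<sigma>_def by (simp add: mult.assoc)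
qed

section \<open>Besov seminorms on a logarithmic scale\<close>

lemma ennreal_powr_ennreal: "a \<ge> 0 \<Longrightarrow> ennreal_powr (ennreal a) t = ennreal (a powr t)"
  by (simp add: ennreal_powr_def)

lemma ennreal_powr_top [simp]: "ennreal_powr \<infinity> t = \<infinity>" "ennreal_powr top t = top"
  by (simp_all add: ennreal_powr_def)

lemma ennreal_powr_mono: "x \<le> y \<Longrightarrow> t \<ge> 0 \<Longrightarrow> ennreal_powr x t \<le> ennreal_powr y t"
  by (cases x; cases y) (auto simp: ennreal_powr_ennreal powr_mono2 top_unique)

lemma ennreal_powr_powr: "ennreal_powr (ennreal_powr x a) b = ennreal_powr x (a * b)"
  by (cases x) (auto simp: ennreal_powr_ennreal powr_powr)

lemma ennreal_powr_one [simp]: "ennreal_powr x 1 = x"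
  by (cases x) (auto simp: ennreal_powr_ennreal)

lemma ennreal_powr_mult_ennreal:
  "c > 0 \<Longrightarrow> ennreal_powr (ennreal c * x) t = ennreal (c powr t) * ennreal_powr x t"
  by (cases x) (auto simp: ennreal_powr_ennreal powr_mult ennreal_mult[symmetric] ennreal_mult_top)

lemma borel_measurable_ennreal_powr [measurable (raw)]:
  assumes [measurable]: "f \<in> borel_measurable M"
  shows "(\<lambda>x. ennreal_powr (f x) t) \<in> borel_measurable M"
proof -
  have "{x \<in> space M. f x = top} \<in> sets M" by measurable
  then show ?thesis
    unfolding ennreal_powr_def infinity_ennreal_def by measurable
qed

lemma ennreal_powr_sum_le:
  fixes y :: "'i \<Rightarrow> ennreal"
  assumes "finite I" "t > 0" "I \<noteq> {}"
  shows "ennreal_powr (\<Sum>i\<in>I. y i) t \<le> ennreal (real (card I) powr t) * (\<Sum>i\<in>I. ennreal_powr (y i) t)"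
proof (cases "\<exists>i\<in>I. y i = top")
  case True
  then obtain i where "i \<in> I" "ennreal_powr (y i) t = top" by auto
  then have "top \<le> (\<Sum>i\<in>I. ennreal_powr (y i) t)"
    using assms(1) member_le_sum[of i I "\<lambda>i. ennreal_powr (y i) t"] by simp
  then have top: "(\<Sum>i\<in>I. ennreal_powr (y i) t) = top" by (simp add: top_unique)
  have "real (card I) powr t > 0" using assms by (simp add: card_gt_0_iff)
  then show ?thesis unfolding top by (simp add: ennreal_mult_top)
next
  case False
  define z where "z i = enn2real (y i)" for i
  have y: "y i = ennreal (z i)" "z i \<ge> 0" if "i \<in> I" for i
    using False that by (auto simp: z_def less_top)
  have "(\<Sum>i\<in>I. y i) = ennreal (\<Sum>i\<in>I. z i)"
    using y by (simp cong: sum.cong)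
  moreover have "(\<Sum>i\<in>I. ennreal_powr (y i) t) = ennreal (\<Sum>i\<in>I. z i powr t)"
    using y by (simp add: ennreal_powr_ennreal cong: sum.cong)
  ultimately show ?thesis
    using y sum_powr_le[OF assms(1,2), of z]
    by (simp add: ennreal_powr_ennreal sum_nonneg ennreal_mult[symmetric] ennreal_leI)
qed

lemma partial_diff_zero_step: "k \<ge> 1 \<Longrightarrow> partial_diff k j 0 f x = 0"
proof -
  assume "k \<ge> 1"
  then obtain k' where "k = Suc k'" by (cases k) auto
  then show ?thesis by (simp add: partial_diff_Suc)
qed

text \<open>The double sum of $(-1)^{i+k-l} \binom ki \binom kl f(x + (i h + i l u) e_j)$ over $i$ and $l$ is a sum of
  differences with steps $i u$ when grouped by $i$, and with steps $h + l u$ when grouped by $l$.\<close>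

lemma partial_diff_exchange:
  assumes "k \<ge> 1"
  shows "partial_diff k j h f x = (\<Sum>i\<in>{1..k}. (-1) ^ i * real (k choose i) *
     (partial_diff k j (real i * u) f (x + (real i * h) *\<^sub>R axis j 1) - partial_diff k j (h + real i * u) f x))"
proof -
  have vec: "x + (real i * h) *\<^sub>R axis j 1 + (real l * (real i * u)) *\<^sub>R axis j 1
      = x + (real i * (h + real l * u)) *\<^sub>R axis j 1" for i l
    by (simp add: vec_eq_iff algebra_simps)
  have sgn: "(-1) ^ i * (-1) ^ (k - l) = (-1) ^ l * (-1) ^ (k - i :: nat) * (1::real)" if "i \<le> k" "l \<le> k" for i l
    using that by (simp add: power_add[symmetric] minus_one_power_iff)
  have "(\<Sum>i\<le>k. (-1) ^ i * real (k choose i) * partial_diff k j (real i * u) f (x + (real i * h) *\<^sub>R axis j 1))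
      = (\<Sum>i\<le>k. \<Sum>l\<le>k. ((-1) ^ i * (-1) ^ (k - l)) * (real (k choose i) * real (k choose l)
          * f (x + (real i * (h + real l * u)) *\<^sub>R axis j 1)))"
    unfolding partial_diff_def vec by (simp add: sum_distrib_left mult_ac)
  also have "\<dots> = (\<Sum>i\<le>k. \<Sum>l\<le>k. ((-1) ^ l * (-1) ^ (k - i) * 1) * (real (k choose i) * real (k choose l)
          * f (x + (real i * (h + real l * u)) *\<^sub>R axis j 1)))"
    by (intro sum.cong refl) (use sgn in simp)
  also have "\<dots> = (\<Sum>l\<le>k. (-1) ^ l * real (k choose l) * partial_diff k j (h + real l * u) f x)"
    by (subst sum.swap) (simp add: partial_diff_def sum_distrib_left mult_ac)
  finally have *: "(\<Sum>i\<le>k. (-1) ^ i * real (k choose i) * partial_diff k j (real i * u) f (x + (real i * h) *\<^sub>R axis j 1))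
     = (\<Sum>l\<le>k. (-1) ^ l * real (k choose l) * partial_diff k j (h + real l * u) f x)" .
  have set: "{..k} = insert 0 {1..k}" by auto
  show ?thesis
    using * unfolding set
    by (simp add: partial_diff_zero_step[OF assms] right_diff_distrib sum_subtractf)
qed

text \<open>The p-th power of the norm as a function of the step. In this form Tonelli's theorem
  gives measurability in \<open>h\<close>, which permits averaging over steps.\<close>

definition diff_mass :: "nat \<Rightarrow> 'n \<Rightarrow> real \<Rightarrow> (real ^ 'n::finite \<Rightarrow> real) \<Rightarrow> real \<Rightarrow> ennreal" where
  "diff_mass k j p f h = (\<integral>\<^sup>+x. ennreal (\<bar>partial_diff k j h f x\<bar> powr p) \<partial>lborel)"

lemma borel_measurable_diff_mass [measurable]:
  fixes f :: "real ^ 'n::finite \<Rightarrow> real"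
  assumes [measurable]: "f \<in> borel_measurable borel"
  shows "diff_mass k j p f \<in> borel_measurable borel"
  unfolding diff_mass_def by measurable

text \<open>The step \<open>u\<close> is free, so a bound for one single h can be obtained by
  averaging over \<open>u\<close>. The Boolean in the index chooses between the steps h + i u and i
  u.\<close>

lemma diff_mass_exchange:
  fixes f :: "real ^ 'n::finite \<Rightarrow> real"
  assumes [measurable]: "f \<in> borel_measurable borel" and "k \<ge> 1" "p > 0"
  shows "diff_mass k j p f h \<le> ennreal ((2 ^ k * (2 * real k)) powr p)
     * (\<Sum>i\<in>{1..k} \<times> (UNIV::bool set). diff_mass k j p f ((if snd i then h else 0) + real (fst i) * u))"
proof -
  define g where "g i x = (if snd i then partial_diff k j (h + real (fst i) * u) f x
     else partial_diff k j (real (fst i) * u) f (x + (real (fst i) * h) *\<^sub>R axis j 1))" for i :: "nat \<times> bool" and x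
  have [measurable]: "g i \<in> borel_measurable borel" for i
    unfolding g_def by measurable
  have "\<bar>partial_diff k j h f x\<bar> \<le> 2 ^ k * (\<Sum>i\<in>{1..k} \<times> UNIV. \<bar>g i x\<bar>)" for x
  proof -
    have "\<bar>partial_diff k j h f x\<bar> \<le> (\<Sum>i\<in>{1..k}. \<bar>(-1) ^ i * real (k choose i) *
     (partial_diff k j (real i * u) f (x + (real i * h) *\<^sub>R axis j 1) - partial_diff k j (h + real i * u) f x)\<bar>)"
      by (subst partial_diff_exchange[OF assms(2), of j h f x u]) (rule sum_abs)
    also have "\<dots> \<le> (\<Sum>i\<in>{1..k}. 2 ^ k * (\<bar>g (i, True) x\<bar> + \<bar>g (i, False) x\<bar>))"
    proof (intro sum_mono)
      fix i assume "i \<in> {1..k}"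
      then have b: "real (k choose i) \<le> 2 ^ k"
        using of_nat_mono[OF binomial_le_pow2[of k i], where 'a=real] by simp
      have "\<bar>(-1) ^ i * real (k choose i) *
     (partial_diff k j (real i * u) f (x + (real i * h) *\<^sub>R axis j 1) - partial_diff k j (h + real i * u) f x)\<bar>
        = real (k choose i) * \<bar>g (i, False) x - g (i, True) x\<bar>"
        by (simp add: abs_mult g_def)
      also have "\<dots> \<le> 2 ^ k * (\<bar>g (i, True) x\<bar> + \<bar>g (i, False) x\<bar>)"
        using b by (intro mult_mono) auto
      finally show "\<bar>(-1) ^ i * real (k choose i) *
     (partial_diff k j (real i * u) f (x + (real i * h) *\<^sub>R axis j 1) - partial_diff k j (h + real i * u) f x)\<bar> \<le> \<dots>" .
    qed
    also have "\<dots> = 2 ^ k * (\<Sum>i\<in>{1..k} \<times> UNIV. \<bar>g i x\<bar>)"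
      by (simp add: sum.cartesian_product' UNIV_bool sum_distrib_left add_ac)
    finally show ?thesis .
  qed
  then have *: "diff_mass k j p f h \<le> ennreal ((2 ^ k * real (card ({1..k} \<times> (UNIV::bool set)))) powr p)
     * (\<Sum>i\<in>{1..k} \<times> UNIV. (\<integral>\<^sup>+x. ennreal (\<bar>g i x\<bar> powr p) \<partial>lborel))"
    unfolding diff_mass_def using assms by (intro nn_integral_powr_sum_le) auto
  have mass: "(\<integral>\<^sup>+x. ennreal (\<bar>g i x\<bar> powr p) \<partial>lborel) = diff_mass k j p f ((if snd i then h else 0) + real (fst i) * u)" for i
    using nn_integral_lborel_shift[of "\<lambda>x. ennreal (\<bar>partial_diff k j (real (fst i) * u) f x\<bar> powr p)" "(real (fst i) * h) *\<^sub>R axis j 1"]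
    by (simp add: g_def diff_mass_def)
  have card: "real (card ({1..k} \<times> (UNIV::bool set))) = 2 * real k"
    by (simp add: card_cartesian_product)
  show ?thesis using * unfolding card mass .
qed

text \<open>Average \<open>diff_mass_exchange\<close> over u in [h/2, h]; the steps i u and h + i u
  stay in [h/2, (k + 1) h]. This turns information about almost every step, or about steps in the
  mean, into a bound at every step. The leading factor 2 stems from the length h/2.\<close>

lemma diff_mass_average:
  fixes f :: "real ^ 'n::finite \<Rightarrow> real"
  assumes [measurable]: "f \<in> borel_measurable borel" and "k \<ge> 1" "p > 0" "t > 0" "h > 0"
  shows "ennreal h * ennreal_powr (diff_mass k j p f h) t
    \<le> ennreal (2 * (2 ^ k * (2 * real k)) powr (p * t) * (2 * real k) powr t * (2 * real k))
      * (\<integral>\<^sup>+v\<in>{h / 2..(real k + 1) * h}. ennreal_powr (diff_mass k j p f v) t \<partial>lborel)"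
proof -
  let ?M = "diff_mass k j p f" and ?I = "{1..k} \<times> (UNIV::bool set)"
  define w where "w i u = (if snd i then h else 0) + real (fst i) * u" for i :: "nat \<times> bool" and u
  let ?R = "\<integral>\<^sup>+v\<in>{h / 2..(real k + 1) * h}. ennreal_powr (?M v) t \<partial>lborel"
  define c where "c = (2 ^ k * (2 * real k)) powr (p * t) * (2 * real k) powr t"
  have cardI: "real (card ?I) = 2 * real k" by (simp add: card_cartesian_product)
  have pt: "ennreal_powr (?M h) t \<le> ennreal c * (\<Sum>i\<in>?I. ennreal_powr (?M (w i u)) t)" for u
  proof -
    have "ennreal_powr (?M h) t \<le> ennreal_powr (ennreal ((2 ^ k * (2 * real k)) powr p) * (\<Sum>i\<in>?I. ?M (w i u))) t"
      unfolding w_def using assms by (intro ennreal_powr_mono diff_mass_exchange) auto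
    also have "\<dots> = ennreal ((2 ^ k * (2 * real k)) powr (p * t)) * ennreal_powr (\<Sum>i\<in>?I. ?M (w i u)) t"
      using assms(2) by (subst ennreal_powr_mult_ennreal) (auto simp: powr_powr)
    also have "\<dots> \<le> ennreal ((2 ^ k * (2 * real k)) powr (p * t)) * (ennreal ((2 * real k) powr t) * (\<Sum>i\<in>?I. ennreal_powr (?M (w i u)) t))"
      using ennreal_powr_sum_le[of ?I t "\<lambda>i. ?M (w i u)"] assms(2,4) unfolding cardI
      by (intro mult_left_mono) auto
    finally show ?thesis by (simp add: c_def ennreal_mult mult.assoc)
  qed
  have sub: "(\<integral>\<^sup>+u\<in>{h / 2..h}. ennreal_powr (?M (w i u)) t \<partial>lborel) \<le> ?R" if "i \<in> ?I" for i
  proof -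
    have i1: "real (fst i) \<ge> 1" "real (fst i) \<le> real k" using that by auto
    have "(\<integral>\<^sup>+u\<in>{h / 2..h}. ennreal_powr (?M (w i u)) t \<partial>lborel)
       \<le> (\<integral>\<^sup>+u. ennreal_powr (?M (w i u)) t * indicator {h / 2..(real k + 1) * h} (w i u) \<partial>lborel)"
    proof (intro nn_integral_mono mult_left_mono)
      fix u
      show "indicator {h / 2..h} u \<le> (indicator {h / 2..(real k + 1) * h} (w i u) :: ennreal)"
      proof (cases "u \<in> {h / 2..h}")
        case True
        then have "real (fst i) * u \<ge> 1 * (h / 2)" "real (fst i) * u \<le> real k * h"
          using i1 assms(5) by (intro mult_mono; simp)+
        then have "w i u \<in> {h / 2..(real k + 1) * h}"
          using assms(5) by (auto simp: w_def algebra_simps)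
        then show ?thesis by (simp add: indicator_def)
      qed simp
    qed simp
    \<comment> \<open>The factor 1 is enlarged to i \<ge> 1, the Jacobian of the substitution v = w
      i u.\<close>
    also have "\<dots> = 1 * (\<integral>\<^sup>+u. ennreal_powr (?M (w i u)) t * indicator {h / 2..(real k + 1) * h} (w i u) \<partial>lborel)"
      by simp
    also have "\<dots> \<le> ennreal \<bar>real (fst i)\<bar> * (\<integral>\<^sup>+u. ennreal_powr (?M (w i u)) t * indicator {h / 2..(real k + 1) * h} (w i u) \<partial>lborel)"
      using ennreal_leI[OF i1(1)] by (intro mult_right_mono) simp_all
    also have "\<dots> = ?R"
      unfolding w_def using i1
      by (subst nn_integral_real_affine[where c="real (fst i)" and t="if snd i then h else 0", symmetric]) simp_all
    finally show ?thesis .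
  qed
  have "ennreal (h / 2) * ennreal_powr (?M h) t = (\<integral>\<^sup>+u\<in>{h / 2..h}. ennreal_powr (?M h) t \<partial>lborel)"
    using assms(5) by (subst nn_integral_cmult_indicator) (auto simp: mult.commute)
  also have "\<dots> \<le> (\<integral>\<^sup>+u\<in>{h / 2..h}. (ennreal c * (\<Sum>i\<in>?I. ennreal_powr (?M (w i u)) t)) \<partial>lborel)"
    using pt by (intro nn_integral_mono mult_right_mono) auto
  also have "\<dots> = ennreal c * (\<Sum>i\<in>?I. (\<integral>\<^sup>+u\<in>{h / 2..h}. ennreal_powr (?M (w i u)) t \<partial>lborel))"
  proof -
    have [measurable]: "(\<lambda>u. ennreal_powr (?M (w i u)) t) \<in> borel_measurable borel" for i
      unfolding w_def by measurable
    show ?thesis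
      by (subst nn_integral_sum[symmetric], simp, subst nn_integral_cmult[symmetric], simp)
         (simp add: sum_distrib_right mult.assoc)
  qed
  also have "\<dots> \<le> ennreal c * (\<Sum>i\<in>?I. ?R)"
    using sub by (intro mult_left_mono sum_mono) auto
  also have "\<dots> = ennreal (c * (2 * real k)) * ?R"
    by (simp only: sum_constant ennreal_of_nat_eq_real_of_nat cardI)
       (simp add: ennreal_mult c_def mult.assoc)
  finally have "ennreal 2 * (ennreal (h / 2) * ennreal_powr (?M h) t) \<le> ennreal 2 * (ennreal (c * (2 * real k)) * ?R)"
    by (rule mult_left_mono) simp
  then show ?thesis
    using assms(5) by (simp add: mult.assoc[symmetric] ennreal_mult[symmetric] c_def del: ennreal_numeral)
qed

lemma nn_integral_powr_from_0:
  fixes a c :: real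
  assumes "a > 0" "c \<ge> 0"
  shows "(\<integral>\<^sup>+x\<in>{0..c}. ennreal (x powr (a - 1)) \<partial>lborel) = ennreal (c powr a / a)"
  using nn_integral_has_integral_lebesgue'[OF _ has_integral_powr_from_0[of "a - 1" c]] assms by simp

lemma nn_integral_powr_to_inf:
  fixes a c :: real
  assumes "a > 0" "c > 0"
  shows "(\<integral>\<^sup>+x\<in>{c..}. ennreal (x powr (- a - 1)) \<partial>lborel) = ennreal (c powr (- a) / a)"
  using nn_integral_has_integral_lebesgue'[OF _ has_integral_powr_to_inf[of "- a - 1" c]] assms by simp

text \<open>With c = 2^x0 the kernel is (h/c)^a below c and (c/h)^a above, and each part contributes
  1/a. The point is that the bound does not depend on \<open>x0\<close>.\<close>

lemma nn_integral_log_kernel: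
  fixes a x0 :: real
  assumes "a > 0"
  shows "(\<integral>\<^sup>+h\<in>{0<..}. ennreal (2 powr (- a * \<bar>log 2 h - x0\<bar>) / h) \<partial>lborel) \<le> ennreal (2 / a)"
proof -
  define c where "c = (2::real) powr x0"
  have c: "c > 0" by (simp add: c_def)
  have pos: "2 powr (a * log 2 h) = h powr a" if "h > 0" for h :: real
    using that by (simp add: powr_def log_def)
  have neg: "2 powr (- a * log 2 h) = h powr (- a)" if "h > 0" for h :: real
    using that by (simp add: powr_def log_def)
  have le: "ennreal (2 powr (- a * \<bar>log 2 h - x0\<bar>) / h) * indicator {0<..} h
      \<le> ennreal (c powr (- a)) * (ennreal (h powr (a - 1)) * indicator {0..c} h)
        + ennreal (c powr a) * (ennreal (h powr (- a - 1)) * indicator {c..} h)" for h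
  proof (cases "h > 0")
    case h: True
    show ?thesis
    proof (cases "h \<le> c")
      case True
      have "log 2 h \<le> x0" using True h log_le_cancel_iff[of 2 h c] c by (simp add: c_def)
      then have "2 powr (- a * \<bar>log 2 h - x0\<bar>) = 2 powr (a * log 2 h + - a * x0)"
        by (intro arg_cong[where f="\<lambda>z. 2 powr z"]) (simp add: algebra_simps)
      also have "\<dots> = h powr a * c powr (- a)"
        using h by (simp only: powr_add pos c_def powr_powr) (simp add: mult.commute)
      finally have "2 powr (- a * \<bar>log 2 h - x0\<bar>) / h = c powr (- a) * h powr (a - 1)"
        using h by (simp add: powr_diff)
      then show ?thesis using h True by (simp add: ennreal_mult)
    next
      case False
      then have "log 2 h \<ge> x0" using h log_le_cancel_iff[of 2 c h] c by (simp add: c_def)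
      then have "2 powr (- a * \<bar>log 2 h - x0\<bar>) = 2 powr (- a * log 2 h + a * x0)"
        by (intro arg_cong[where f="\<lambda>z. 2 powr z"]) (simp add: algebra_simps)
      also have "\<dots> = h powr (- a) * c powr a"
        using h by (simp only: powr_add neg c_def powr_powr) (simp add: mult.commute)
      finally have "2 powr (- a * \<bar>log 2 h - x0\<bar>) / h = c powr a * h powr (- a - 1)"
        using h by (simp add: powr_diff)
      then show ?thesis using h False by (simp add: ennreal_mult)
    qed
  qed simp
  have "(\<integral>\<^sup>+h\<in>{0<..}. ennreal (2 powr (- a * \<bar>log 2 h - x0\<bar>) / h) \<partial>lborel)
     \<le> (\<integral>\<^sup>+h. ennreal (c powr (- a)) * (ennreal (h powr (a - 1)) * indicator {0..c} h)
        + ennreal (c powr a) * (ennreal (h powr (- a - 1)) * indicator {c..} h) \<partial>lborel)"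
    by (intro nn_integral_mono le)
  also have "\<dots> = ennreal (c powr (- a)) * ennreal (c powr a / a) + ennreal (c powr a) * ennreal (c powr (- a) / a)"
    using assms c by (simp add: nn_integral_add nn_integral_cmult nn_integral_powr_from_0 nn_integral_powr_to_inf)
  also have "\<dots> = ennreal (2 / a)"
    using assms c by (simp add: ennreal_mult[symmetric] ennreal_plus[symmetric] powr_minus field_simps del: ennreal_plus)
  finally show ?thesis .
qed

lemma Lp_norm_partial_diff: "Lp_norm p (partial_diff k j h f) = ennreal_powr (diff_mass k j p f h) (1 / p)"
  unfolding Lp_norm_def diff_mass_def by (simp add: nn_integral_completion)

lemma ennreal_powr_root_le:
  assumes "ennreal_powr x (1 / t) \<le> ennreal S" "t > 0" "S \<ge> 0"
  shows "x \<le> ennreal (S powr t)"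
  using ennreal_powr_mono[OF assms(1), of t] assms(2,3)
  by (simp add: ennreal_powr_powr ennreal_powr_ennreal)

lemma Lp_le_iff_diff_mass: "Lp_le p (partial_diff k j h f) A \<longleftrightarrow> diff_mass k j p f h \<le> ennreal (A powr p)"
  unfolding Lp_le_def diff_mass_def ..

text \<open>The essential supremum controls almost every step. Averaging over [h/2, (m + 1) h],
  where v^r exceeds h^r by at most a constant factor, extends this to every step.\<close>

lemma Besov_regularize_top:
  assumes "r > 0" "p \<ge> 1" "m \<ge> 1"
  obtains C where "C > 0"
    "\<And>(f :: real ^ 'n::finite \<Rightarrow> real) j S x. f \<in> borel_measurable borel \<Longrightarrow> S > 0 \<Longrightarrow> besov_partial_seminorm m r p top j f \<le> ennreal S \<Longrightarrow>
       Lp_le p (partial_diff m j (2 powr x) f) (C * S * 2 powr (r * x))"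
proof -
  define c where "c = 2 * (2 ^ m * (2 * real m)) powr (p * 1) * (2 * real m) powr 1 * (2 * real m)"
  have c0: "c > 0" using assms by (simp add: c_def)
  define C where "C = (c * (real m + 1) * ((real m + 1) powr r) powr p) powr (1 / p)"
  have Cp: "C powr p = c * (real m + 1) * ((real m + 1) powr r) powr p"
    using assms c0 by (simp add: C_def powr_powr)
  show thesis
  proof (rule that[of C])
    show "C > 0" using c0 by (simp add: C_def)
    fix f :: "real ^ 'n \<Rightarrow> real" and j S x
    assume [measurable]: "f \<in> borel_measurable borel" and S: "S > 0"
      and le: "besov_partial_seminorm m r p top j f \<le> ennreal S"
    let ?M = "diff_mass m j p f"
    define h where "h = (2::real) powr x"
    have h: "h > 0" by (simp add: h_def)
    have "AE v in lebesgue_on {0<..}. ennreal (v powr (- r)) * ennreal_powr (?M v) (1 / p) \<le> ennreal S"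
      using esssup_AE[of "\<lambda>v. ennreal (v powr (- r)) * ennreal_powr (?M v) (1 / p)" "lebesgue_on {0<..}"]
    proof eventually_elim
      case (elim v)
      then show ?case
        using le by (simp add: besov_partial_seminorm_def weighted_norm_def Lp_norm_partial_diff)
    qed
    then have "AE v in lebesgue. v > 0 \<longrightarrow> ennreal (v powr (- r)) * ennreal_powr (?M v) (1 / p) \<le> ennreal S"
      by (subst (asm) AE_restrict_space_iff) auto
    then have "AE v in lborel. v > 0 \<longrightarrow> ennreal (v powr (- r)) * ennreal_powr (?M v) (1 / p) \<le> ennreal S"
      by (simp add: AE_completion_iff)
    then have AE: "AE v in lborel. v > 0 \<longrightarrow> ?M v \<le> ennreal ((S * v powr r) powr p)"
    proof eventually_elim
      case (elim v)
      show ?case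
      proof
        assume v: "v > 0"
        then have "ennreal (v powr r) * (ennreal (v powr (- r)) * ennreal_powr (?M v) (1 / p)) \<le> ennreal (v powr r) * ennreal S"
          using elim by (intro mult_left_mono) auto
        then have "ennreal_powr (?M v) (1 / p) \<le> ennreal (S * v powr r)"
          using v S by (simp add: mult.assoc[symmetric] ennreal_mult[symmetric] powr_add[symmetric] mult.commute)
        then show "?M v \<le> ennreal ((S * v powr r) powr p)"
          using assms S by (intro ennreal_powr_root_le) auto
      qed
    qed
    have "ennreal h * ?M h \<le> ennreal c * (\<integral>\<^sup>+v\<in>{h / 2..(real m + 1) * h}. ?M v \<partial>lborel)"
      using diff_mass_average[of f m p 1 h j] assms h by (simp add: c_def)
    also have "(\<integral>\<^sup>+v\<in>{h / 2..(real m + 1) * h}. ?M v \<partial>lborel)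
        \<le> (\<integral>\<^sup>+v\<in>{0..(real m + 1) * h}. ennreal ((S * ((real m + 1) * h) powr r) powr p) \<partial>lborel)"
    proof (rule nn_integral_mono_AE, use AE in eventually_elim)
      case (elim v)
      show ?case
      proof (cases "v \<in> {h / 2..(real m + 1) * h}")
        case True
        then have v: "v > 0" "v \<le> (real m + 1) * h" using h by auto
        then have "?M v \<le> ennreal ((S * v powr r) powr p)" using elim by simp
        also have "\<dots> \<le> ennreal ((S * ((real m + 1) * h) powr r) powr p)"
          using v assms S by (intro ennreal_leI powr_mono2 mult_left_mono) auto
        finally show ?thesis using v by (simp add: indicator_def)
      qed simp
    qed
    also have "\<dots> = ennreal ((S * ((real m + 1) * h) powr r) powr p) * ennreal ((real m + 1) * h)"
      using h by (subst nn_integral_cmult_indicator) auto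
    finally have "ennreal (1 / h) * (ennreal h * ?M h)
        \<le> ennreal (1 / h) * (ennreal c * (ennreal ((S * ((real m + 1) * h) powr r) powr p) * ennreal ((real m + 1) * h)))"
      by (simp add: mult_left_mono)
    moreover have "ennreal (1 / h) * (ennreal h * ?M h) = ?M h"
      using h by (simp add: mult.assoc[symmetric] ennreal_mult[symmetric])
    moreover have "ennreal (1 / h) * (ennreal c * (ennreal ((S * ((real m + 1) * h) powr r) powr p) * ennreal ((real m + 1) * h)))
       = ennreal ((C * S * h powr r) powr p)"
      using h c0 by (simp add: ennreal_mult[symmetric] powr_mult Cp mult_ac)
    ultimately show "Lp_le p (partial_diff m j (2 powr x) f) (C * S * 2 powr (r * x))"
      unfolding Lp_le_iff_diff_mass by (simp add: h_def powr_powr mult.commute)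
  qed
qed

text \<open>The exponential kernel on the logarithmic scale: the average of a nonnegative function
  against it has, where positive and finite, an a-Lipschitz binary logarithm as a function of
  \<open>x\<close>.\<close>

definition log_kernel :: "real \<Rightarrow> real \<Rightarrow> real \<Rightarrow> real" where
  "log_kernel a x v = 2 powr (- a * \<bar>log 2 v - x\<bar>)"

lemma borel_measurable_log_kernel [measurable (raw)]:
  assumes [measurable]: "u \<in> borel_measurable M" "v \<in> borel_measurable M"
  shows "(\<lambda>z. log_kernel a (u z) (v z)) \<in> borel_measurable M"
  unfolding log_kernel_def by measurable

text \<open>The weight is the t-th root of an average against \<open>log_kernel (s * t)\<close>, so
  that its logarithm has Lipschitz constant (s t) / t = s. The integral clause admits
  reparametrizations \<phi> because each weight is later evaluated at its own scale d_i instead of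
  log_2 h; the condition on \<phi> says that it moves away from every value at rate at least
  \<delta>.\<close>

lemma Besov_regularize_finite:
  assumes "r > 0" "p \<ge> 1" "m \<ge> 1" "s > 0" "t \<ge> 1"
  obtains C where "C > 0"
    "\<And>(f :: real ^ 'n::finite \<Rightarrow> real) j S. f \<in> borel_measurable borel \<Longrightarrow> S > 0 \<Longrightarrow>
       besov_partial_seminorm m r p (ennreal t) j f \<le> ennreal S \<Longrightarrow>
       \<exists>e. (\<forall>x. 0 < e x \<and> e x \<le> 2) \<and> (\<forall>x y. e x \<le> 2 powr (s * \<bar>x - y\<bar>) * e y)
         \<and> e \<in> borel_measurable borel
         \<and> (\<forall>x. Lp_le p (partial_diff m j (2 powr x) f) (C * S * 2 powr (r * x) * e x))
         \<and> (\<forall>\<delta> \<phi>. \<delta> > 0 \<longrightarrow> \<phi> \<in> borel_measurable borel \<longrightarrow> (\<forall>y. \<exists>x0. \<forall>x. \<delta> * \<bar>x - x0\<bar> \<le> \<bar>\<phi> x - y\<bar>)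
              \<longrightarrow> (\<integral>\<^sup>+h\<in>{0<..}. ennreal (e (\<phi> (log 2 h)) powr t / h) \<partial>lborel) \<le> ennreal (4 / (s * t * \<delta>)))"
proof -
  define c where "c = 2 * (2 ^ m * (2 * real m)) powr (p * (t / p)) * (2 * real m) powr (t / p) * (2 * real m)"
  have c0: "c > 0" using assms by (simp add: c_def)
  \<comment> \<open>On the averaging interval v \<le> (m + 1) h and |log_2 v - x| \<le> m + 1; the
    two powers pay for these two bounds.\<close>
  define c' where "c' = c * (real m + 1) powr (1 + r * t) * 2 powr (s * t * (real m + 1))"
  have c'0: "c' > 0" using c0 by (simp add: c'_def)
  define C where "C = c' powr (1 / t)"
  show thesis
  proof (rule that[of C])
    show "C > 0" using c'0 by (simp add: C_def)
    fix f :: "real ^ 'n \<Rightarrow> real" and j S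
    assume [measurable]: "f \<in> borel_measurable borel" and S: "S > 0"
      and le: "besov_partial_seminorm m r p (ennreal t) j f \<le> ennreal S"
    let ?M = "diff_mass m j p f"
    define V where "V v = ennreal_powr (ennreal (v powr (- r)) * ennreal_powr (?M v) (1 / p)) t / ennreal v" for v
    have [measurable]: "V \<in> borel_measurable borel" unfolding V_def by measurable
    have V: "(\<integral>\<^sup>+v\<in>{0<..}. V v \<partial>lborel) \<le> ennreal (S powr t)"
    proof (rule ennreal_powr_root_le)
      show "ennreal_powr (\<integral>\<^sup>+v\<in>{0<..}. V v \<partial>lborel) (1 / t) \<le> ennreal S"
        using le assms(5)
        by (simp add: besov_partial_seminorm_def weighted_norm_def Lp_norm_partial_diff V_def nn_integral_completion)
    qed (use assms S in auto)
    have K0: "log_kernel (s * t) x v > 0" "log_kernel (s * t) x v \<le> 1" for x v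
    proof -
      have "log_kernel (s * t) x v \<le> 2 powr 0" unfolding log_kernel_def using assms by (intro powr_mono) auto
      then show "log_kernel (s * t) x v \<le> 1" by simp
    qed (simp add: log_kernel_def)
    have K_lip: "log_kernel (s * t) x v \<le> 2 powr (s * t * \<bar>x - y\<bar>) * log_kernel (s * t) y v" for x y v
    proof -
      have "s * t * (\<bar>log 2 v - y\<bar> - \<bar>x - y\<bar>) \<le> s * t * \<bar>log 2 v - x\<bar>"
        using assms by (intro mult_left_mono) auto
      then have "- (s * t) * \<bar>log 2 v - x\<bar> \<le> s * t * \<bar>x - y\<bar> + - (s * t) * \<bar>log 2 v - y\<bar>"
        by (simp add: algebra_simps)
      then show ?thesis unfolding log_kernel_def powr_add[symmetric] by (rule powr_mono) simp
    qed
    define J where "J x = (\<integral>\<^sup>+v\<in>{0<..}. (ennreal (log_kernel (s * t) x v) * V v) \<partial>lborel)" for x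
    have [measurable]: "J \<in> borel_measurable borel" unfolding J_def by measurable
    have J_le: "J x \<le> ennreal (S powr t)" for x
    proof -
      have "J x \<le> (\<integral>\<^sup>+v\<in>{0<..}. V v \<partial>lborel)"
        unfolding J_def
      proof (intro nn_integral_mono mult_right_mono)
        fix v show "ennreal (log_kernel (s * t) x v) * V v \<le> V v"
          using mult_right_mono[OF ennreal_leI[OF K0(2)], of "V v" x v] by simp
      qed simp
      then show ?thesis using V by (rule order_trans)
    qed
    then have J_fin: "ennreal (enn2real (J x)) = J x" for x
      by (metis ennreal_enn2real ennreal_less_top le_less_trans)
    \<comment> \<open>Division by S^t makes the average at most 1. The second summand, a kernel
      centred at x = 0, keeps \<open>G\<close> positive where the average vanishes, and obeys the
      same Lipschitz and integral bounds.\<close>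
    define G where "G x = enn2real (J x) / S powr t + log_kernel (s * t) x 1" for x
    have G: "0 < G x" "G x \<le> 2" for x
    proof -
      show "0 < G x" using K0(1)[of x 1] unfolding G_def by (intro add_nonneg_pos) auto
      have "enn2real (J x) \<le> S powr t"
        using J_le[of x] by (simp add: enn2real_leI)
      then have "enn2real (J x) / S powr t \<le> 1" using S by simp
      then show "G x \<le> 2" using K0(2)[of x 1] unfolding G_def by linarith
    qed
    have [measurable]: "G \<in> borel_measurable borel" unfolding G_def by measurable
    have G_lip: "G x \<le> 2 powr (s * t * \<bar>x - y\<bar>) * G y" for x y
    proof -
      have "J x \<le> (\<integral>\<^sup>+v. ennreal (2 powr (s * t * \<bar>x - y\<bar>)) * (ennreal (log_kernel (s * t) y v) * V v * indicator {0<..} v) \<partial>lborel)"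
        unfolding J_def
      proof (intro nn_integral_mono)
        fix v
        have "ennreal (log_kernel (s * t) x v) \<le> ennreal (2 powr (s * t * \<bar>x - y\<bar>)) * ennreal (log_kernel (s * t) y v)"
          using K_lip[of x v y] by (simp add: ennreal_mult[symmetric] less_imp_le[OF K0(1)] ennreal_leI)
        then have "ennreal (log_kernel (s * t) x v) * (V v * indicator {0<..} v)
             \<le> ennreal (2 powr (s * t * \<bar>x - y\<bar>)) * ennreal (log_kernel (s * t) y v) * (V v * indicator {0<..} v)"
          by (rule mult_right_mono) simp
        then show "ennreal (log_kernel (s * t) x v) * V v * indicator {0<..} v
             \<le> ennreal (2 powr (s * t * \<bar>x - y\<bar>)) * (ennreal (log_kernel (s * t) y v) * V v * indicator {0<..} v)"
          by (simp add: mult.assoc)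
      qed
      also have "\<dots> = ennreal (2 powr (s * t * \<bar>x - y\<bar>)) * J y"
        unfolding J_def by (intro nn_integral_cmult) measurable
      also have "\<dots> = ennreal (2 powr (s * t * \<bar>x - y\<bar>) * enn2real (J y))"
        by (simp add: ennreal_mult J_fin)
      finally have "enn2real (J x) \<le> 2 powr (s * t * \<bar>x - y\<bar>) * enn2real (J y)"
        by (intro enn2real_leI) auto
      then have "enn2real (J x) / S powr t \<le> 2 powr (s * t * \<bar>x - y\<bar>) * enn2real (J y) / S powr t"
        by (intro divide_right_mono) auto
      then show ?thesis using K_lip[of x 1 y] unfolding G_def by (simp add: algebra_simps)
    qed
    define e where "e x = G x powr (1 / t)" for x
    have et: "e x powr t = G x" for x
      using assms G(1)[of x] by (simp add: e_def powr_powr)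
    have e0: "0 < e x" for x using G(1)[of x] by (simp add: e_def)
    have e2: "e x \<le> 2" for x
    proof -
      have "e x \<le> 2 powr (1 / t)"
        unfolding e_def using G[of x] assms by (intro powr_mono2) auto
      also have "\<dots> \<le> 2 powr 1" using assms by (intro powr_mono) auto
      finally show ?thesis by simp
    qed
    have e_lip: "e x \<le> 2 powr (s * \<bar>x - y\<bar>) * e y" for x y
    proof -
      have "e x \<le> (2 powr (s * t * \<bar>x - y\<bar>) * G y) powr (1 / t)"
        unfolding e_def using G(1)[of x] G_lip[of x y] assms by (intro powr_mono2) auto
      then show ?thesis using assms by (simp add: powr_mult powr_powr e_def)
    qed
    have e_meas: "e \<in> borel_measurable borel" unfolding e_def by measurable
    have e_Lp: "Lp_le p (partial_diff m j (2 powr x) f) (C * S * 2 powr (r * x) * e x)" for x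
    proof -
      define h where "h = (2::real) powr x"
      have h: "h > 0" "log 2 h = x" by (simp_all add: h_def)
      let ?I = "{h / 2..(real m + 1) * h}"
      define B where "B = ((real m + 1) * h) powr (1 + r * t) * 2 powr (s * t * (real m + 1))"
      have B0: "B > 0" using h by (simp add: B_def)
      have "ennreal h * ennreal_powr (?M h) (t / p) \<le> ennreal c * (\<integral>\<^sup>+v\<in>?I. ennreal_powr (?M v) (t / p) \<partial>lborel)"
        using diff_mass_average[of f m p "t / p" h j] assms h by (simp add: c_def)
      also have "(\<integral>\<^sup>+v\<in>?I. ennreal_powr (?M v) (t / p) \<partial>lborel)
          \<le> (\<integral>\<^sup>+v. ennreal B * (ennreal (log_kernel (s * t) x v) * V v * indicator {0<..} v) \<partial>lborel)"
      proof (intro nn_integral_mono)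
        fix v
        show "ennreal_powr (?M v) (t / p) * indicator ?I v \<le> ennreal B * (ennreal (log_kernel (s * t) x v) * V v * indicator {0<..} v)"
        proof (cases "v \<in> ?I")
          case True
          then have v: "v > 0" "v \<le> (real m + 1) * h" "h / 2 \<le> v" using h by auto
          have Mv: "ennreal_powr (?M v) (t / p) = ennreal (v powr (1 + r * t)) * V v"
          proof -
            have "V v = ennreal (v powr (- r * t)) * ennreal_powr (?M v) (t / p) * ennreal (1 / v)"
              using v unfolding V_def
              by (simp add: ennreal_powr_mult_ennreal powr_powr ennreal_powr_powr divide_ennreal_def inverse_ennreal inverse_eq_divide)
            moreover have "ennreal (v powr (1 + r * t) * (v powr (- r * t) * (1 / v)))
                = ennreal (v powr (1 + r * t)) * (ennreal (v powr (- r * t)) * ennreal (1 / v))"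
              using v by (subst ennreal_mult, simp, simp, subst ennreal_mult) auto
            ultimately have "ennreal (v powr (1 + r * t)) * V v
                = ennreal (v powr (1 + r * t) * (v powr (- r * t) * (1 / v))) * ennreal_powr (?M v) (t / p)"
              by (simp only: mult_ac)
            also have "v powr (1 + r * t) * (v powr (- r * t) * (1 / v)) = 1"
              using v by (simp add: powr_add powr_minus field_simps)
            finally show ?thesis by simp
          qed
          have "\<bar>log 2 v - x\<bar> \<le> real m + 1"
          proof -
            have "real m + 1 \<le> 2 ^ m"
              using of_nat_mono[OF less_exp[of m, THEN Suc_leI], where 'a=real] by simp
            then have "log 2 (real m + 1) \<le> real m"
              by (simp add: log_le_iff powr_realpow)
            moreover have "log 2 v \<le> log 2 ((real m + 1) * h)"
              using v h by simp
            moreover have "log 2 ((real m + 1) * h) = log 2 (real m + 1) + x"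
              using h by (simp add: log_mult)
            moreover have "log 2 (h / 2) \<le> log 2 v"
              using v h by simp
            moreover have "log 2 (h / 2) = x - 1"
              using h by (simp add: log_divide)
            ultimately show ?thesis by linarith
          qed
          then have "log_kernel (s * t) x v \<ge> 2 powr (- (s * t) * (real m + 1))"
            unfolding log_kernel_def using assms by (intro powr_mono mult_left_mono_neg) auto
          then have "2 powr (s * t * (real m + 1)) * log_kernel (s * t) x v \<ge> 2 powr (s * t * (real m + 1)) * 2 powr (- (s * t) * (real m + 1))"
            by (intro mult_left_mono) auto
          then have "2 powr (s * t * (real m + 1)) * log_kernel (s * t) x v \<ge> 1"
            by (simp add: powr_add[symmetric])
          moreover have "v powr (1 + r * t) \<le> ((real m + 1) * h) powr (1 + r * t)"
            using v assms by (intro powr_mono2) auto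
          ultimately have "v powr (1 + r * t) * 1 \<le> ((real m + 1) * h) powr (1 + r * t) * (2 powr (s * t * (real m + 1)) * log_kernel (s * t) x v)"
            by (intro mult_mono) auto
          then have "v powr (1 + r * t) \<le> B * log_kernel (s * t) x v"
            by (simp add: B_def mult.assoc)
          then have "ennreal (v powr (1 + r * t)) * V v \<le> ennreal (B * log_kernel (s * t) x v) * V v"
            by (intro mult_right_mono ennreal_leI) auto
          then show ?thesis
            using True v B0 K0(1)[of x v] by (simp add: Mv ennreal_mult mult.assoc)
        qed simp
      qed
      also have "\<dots> = ennreal B * J x"
        unfolding J_def by (intro nn_integral_cmult) measurable
      also have "ennreal B * J x \<le> ennreal (B * (S powr t * G x))"
      proof -
        have "enn2real (J x) \<le> S powr t * G x"
          using S K0(1)[of x 1] by (simp add: G_def field_simps)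
        then have "J x \<le> ennreal (S powr t * G x)"
          by (metis J_fin ennreal_leI)
        then show ?thesis using B0 G(1)[of x] by (simp add: ennreal_mult mult_left_mono)
      qed
      finally have "ennreal (1 / h) * (ennreal h * ennreal_powr (?M h) (t / p))
          \<le> ennreal (1 / h) * (ennreal c * ennreal (B * (S powr t * G x)))"
        by (simp add: mult_left_mono)
      moreover have "ennreal (1 / h) * (ennreal h * ennreal_powr (?M h) (t / p)) = ennreal_powr (?M h) (t / p)"
        using h by (simp add: mult.assoc[symmetric] ennreal_mult[symmetric])
      moreover have "ennreal (1 / h) * (ennreal c * ennreal (B * (S powr t * G x)))
         = ennreal ((C * S * 2 powr (r * x) * e x) powr t)"
      proof -
        have "1 / h * (c * (B * (S powr t * G x))) = c' * h powr (r * t) * S powr t * G x"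
          using h by (simp add: B_def c'_def powr_mult powr_add)
        also have "\<dots> = (C * S * 2 powr (r * x) * e x) powr t"
          using assms c'0 by (simp add: powr_mult et C_def powr_powr h_def mult_ac)
        finally show ?thesis
          using h c0 B0 G(1)[of x] by (simp add: ennreal_mult[symmetric])
      qed
      ultimately have *: "ennreal_powr (?M h) (1 / (p / t)) \<le> ennreal ((C * S * 2 powr (r * x) * e x) powr t)"
        by simp
      have "?M h \<le> ennreal (((C * S * 2 powr (r * x) * e x) powr t) powr (p / t))"
        by (rule ennreal_powr_root_le[OF *]) (use assms in auto)
      then show ?thesis
        using assms unfolding Lp_le_iff_diff_mass by (simp add: powr_powr h_def)
    qed
    have e_int: "(\<integral>\<^sup>+h\<in>{0<..}. ennreal (e (\<phi> (log 2 h)) powr t / h) \<partial>lborel) \<le> ennreal (4 / (s * t * \<delta>))"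
      if \<delta>: "\<delta> > 0" and [measurable]: "\<phi> \<in> borel_measurable borel"
        and exp: "\<forall>y. \<exists>x0. \<forall>x. \<delta> * \<bar>x - x0\<bar> \<le> \<bar>\<phi> x - y\<bar>" for \<delta> \<phi>
    proof -
      \<comment> \<open>Uniform in v: since \<phi> expands by \<delta>, the kernel at \<phi>(log_2
        h) is dominated by a kernel in log_2 h with rate s t \<delta>.\<close>
      have ker: "(\<integral>\<^sup>+h\<in>{0<..}. ennreal (log_kernel (s * t) (\<phi> (log 2 h)) v / h) \<partial>lborel) \<le> ennreal (2 / (s * t * \<delta>))" for v
      proof -
        obtain x0 where x0: "\<And>x. \<delta> * \<bar>x - x0\<bar> \<le> \<bar>\<phi> x - log 2 v\<bar>" using exp by metis
        have "(\<integral>\<^sup>+h\<in>{0<..}. ennreal (log_kernel (s * t) (\<phi> (log 2 h)) v / h) \<partial>lborel)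
            \<le> (\<integral>\<^sup>+h\<in>{0<..}. ennreal (2 powr (- (s * t * \<delta>) * \<bar>log 2 h - x0\<bar>) / h) \<partial>lborel)"
        proof (intro nn_integral_mono)
          fix h :: real
          have "s * t * (\<delta> * \<bar>log 2 h - x0\<bar>) \<le> s * t * \<bar>\<phi> (log 2 h) - log 2 v\<bar>"
            using assms x0 by (intro mult_left_mono) auto
          then have "log_kernel (s * t) (\<phi> (log 2 h)) v \<le> 2 powr (- (s * t * \<delta>) * \<bar>log 2 h - x0\<bar>)"
            unfolding log_kernel_def by (intro powr_mono) (auto simp: abs_minus_commute mult.assoc)
          then show "ennreal (log_kernel (s * t) (\<phi> (log 2 h)) v / h) * indicator {0<..} h
             \<le> ennreal (2 powr (- (s * t * \<delta>) * \<bar>log 2 h - x0\<bar>) / h) * indicator {0<..} h"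
            by (auto simp: indicator_def intro!: ennreal_leI divide_right_mono)
        qed
        also have "\<dots> \<le> ennreal (2 / (s * t * \<delta>))"
          using assms \<delta> by (intro nn_integral_log_kernel) auto
        finally show ?thesis .
      qed
      let ?\<psi> = "\<lambda>h. \<phi> (log 2 h)"
      have "ennreal (e (?\<psi> h) powr t / h) * indicator {0<..} h
          = ennreal (1 / S powr t) * (\<integral>\<^sup>+v. (ennreal (log_kernel (s * t) (?\<psi> h) v / h) * indicator {0<..} h) * (V v * indicator {0<..} v) \<partial>lborel)
            + ennreal (log_kernel (s * t) (?\<psi> h) 1 / h) * indicator {0<..} h" for h
      proof (cases "h > 0")
        case True
        have "(\<integral>\<^sup>+v. (ennreal (log_kernel (s * t) (?\<psi> h) v / h) * indicator {0<..} h) * (V v * indicator {0<..} v) \<partial>lborel)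
           = (\<integral>\<^sup>+v. ennreal (1 / h) * (ennreal (log_kernel (s * t) (?\<psi> h) v) * V v * indicator {0<..} v) \<partial>lborel)"
        proof (intro nn_integral_cong)
          fix v
          have "ennreal (log_kernel (s * t) (?\<psi> h) v / h) = ennreal (1 / h) * ennreal (log_kernel (s * t) (?\<psi> h) v)"
            using True K0(1)[of "?\<psi> h" v] by (simp add: ennreal_mult[symmetric])
          then show "(ennreal (log_kernel (s * t) (?\<psi> h) v / h) * indicator {0<..} h) * (V v * indicator {0<..} v)
             = ennreal (1 / h) * (ennreal (log_kernel (s * t) (?\<psi> h) v) * V v * indicator {0<..} v)"
            using True by (simp add: mult.assoc)
        qed
        also have "\<dots> = ennreal (1 / h) * J (?\<psi> h)"
          unfolding J_def by (intro nn_integral_cmult) measurable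
        also have "\<dots> = ennreal (1 / h * enn2real (J (?\<psi> h)))"
          using True by (subst ennreal_mult) (auto simp: J_fin)
        finally have *: "(\<integral>\<^sup>+v. (ennreal (log_kernel (s * t) (?\<psi> h) v / h) * indicator {0<..} h) * (V v * indicator {0<..} v) \<partial>lborel)
           = ennreal (1 / h * enn2real (J (?\<psi> h)))" .
        have "e (?\<psi> h) powr t / h = 1 / S powr t * (1 / h * enn2real (J (?\<psi> h))) + log_kernel (s * t) (?\<psi> h) 1 / h"
          unfolding et G_def by (simp add: add_divide_distrib)
        then show ?thesis
          using True S K0(1)[of "?\<psi> h" 1] unfolding * by (simp add: ennreal_mult[symmetric] ennreal_plus[symmetric] del: ennreal_plus)
      qed simp
      then have "(\<integral>\<^sup>+h\<in>{0<..}. ennreal (e (?\<psi> h) powr t / h) \<partial>lborel)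
         = (\<integral>\<^sup>+h. ennreal (1 / S powr t) * (\<integral>\<^sup>+v. (ennreal (log_kernel (s * t) (?\<psi> h) v / h) * indicator {0<..} h) * (V v * indicator {0<..} v) \<partial>lborel)
            + ennreal (log_kernel (s * t) (?\<psi> h) 1 / h) * indicator {0<..} h \<partial>lborel)"
        by simp
      also have "\<dots> = ennreal (1 / S powr t) * (\<integral>\<^sup>+h. \<integral>\<^sup>+v. (ennreal (log_kernel (s * t) (?\<psi> h) v / h) * indicator {0<..} h) * (V v * indicator {0<..} v) \<partial>lborel \<partial>lborel)
            + (\<integral>\<^sup>+h\<in>{0<..}. ennreal (log_kernel (s * t) (?\<psi> h) 1 / h) \<partial>lborel)"
        by (subst nn_integral_add, measurable, subst nn_integral_cmult, measurable)
      finally have split: "(\<integral>\<^sup>+h\<in>{0<..}. ennreal (e (?\<psi> h) powr t / h) \<partial>lborel) = \<dots>" .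
      \<comment> \<open>Integrating the kernel over h first leaves only the total mass of
        \<open>V\<close>, at most S^t. Thus both summands of \<open>G\<close> contribute 2 / (s t
        \<delta>).\<close>
      have "(\<integral>\<^sup>+h. \<integral>\<^sup>+v. (ennreal (log_kernel (s * t) (?\<psi> h) v / h) * indicator {0<..} h) * (V v * indicator {0<..} v) \<partial>lborel \<partial>lborel)
         = (\<integral>\<^sup>+v. \<integral>\<^sup>+h. (ennreal (log_kernel (s * t) (?\<psi> h) v / h) * indicator {0<..} h) * (V v * indicator {0<..} v) \<partial>lborel \<partial>lborel)"
        by (rule lborel_pair.Fubini') measurable
      also have "\<dots> = (\<integral>\<^sup>+v. (\<integral>\<^sup>+h\<in>{0<..}. ennreal (log_kernel (s * t) (?\<psi> h) v / h) \<partial>lborel) * (V v * indicator {0<..} v) \<partial>lborel)"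
        by (intro nn_integral_cong nn_integral_multc) measurable
      also have "\<dots> \<le> (\<integral>\<^sup>+v. ennreal (2 / (s * t * \<delta>)) * (V v * indicator {0<..} v) \<partial>lborel)"
        by (intro nn_integral_mono mult_right_mono ker) simp
      also have "\<dots> = ennreal (2 / (s * t * \<delta>)) * (\<integral>\<^sup>+v\<in>{0<..}. V v \<partial>lborel)"
        by (intro nn_integral_cmult) measurable
      also have "\<dots> \<le> ennreal (2 / (s * t * \<delta>)) * ennreal (S powr t)"
        by (intro mult_left_mono V) simp
      finally have "(\<integral>\<^sup>+h\<in>{0<..}. ennreal (e (?\<psi> h) powr t / h) \<partial>lborel)
         \<le> ennreal (1 / S powr t) * (ennreal (2 / (s * t * \<delta>)) * ennreal (S powr t)) + ennreal (2 / (s * t * \<delta>))"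
        unfolding split by (intro add_mono mult_left_mono ker) simp_all
      also have "\<dots> = ennreal (4 / (s * t * \<delta>))"
        using S assms \<delta> by (simp add: ennreal_mult[symmetric] ennreal_plus[symmetric] del: ennreal_plus)
      finally show ?thesis .
    qed
    show "\<exists>e. (\<forall>x. 0 < e x \<and> e x \<le> 2) \<and> (\<forall>x y. e x \<le> 2 powr (s * \<bar>x - y\<bar>) * e y)
         \<and> e \<in> borel_measurable borel
         \<and> (\<forall>x. Lp_le p (partial_diff m j (2 powr x) f) (C * S * 2 powr (r * x) * e x))
         \<and> (\<forall>\<delta> \<phi>. \<delta> > 0 \<longrightarrow> \<phi> \<in> borel_measurable borel \<longrightarrow> (\<forall>y. \<exists>x0. \<forall>x. \<delta> * \<bar>x - x0\<bar> \<le> \<bar>\<phi> x - y\<bar>)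
              \<longrightarrow> (\<integral>\<^sup>+h\<in>{0<..}. ennreal (e (\<phi> (log 2 h)) powr t / h) \<partial>lborel) \<le> ennreal (4 / (s * t * \<delta>)))"
      using e0 e2 e_lip e_meas e_Lp e_int by blast
  qed
qed

section \<open>Balanced scales\<close>

lemma surj_of_expanding:
  fixes F :: "real \<Rightarrow> real"
  assumes "c > 0" "continuous_on UNIV F" and exp: "\<And>x y. x \<le> y \<Longrightarrow> c * (y - x) \<le> F y - F x"
  shows "\<exists>x. F x = z"
proof -
  define a where "a = - (\<bar>z - F 0\<bar> / c)"
  define b where "b = \<bar>z - F 0\<bar> / c"
  have ab: "a \<le> 0" "0 \<le> b" using assms(1) by (auto simp: a_def b_def)
  have "c * (0 - a) = \<bar>z - F 0\<bar>" "c * (b - 0) = \<bar>z - F 0\<bar>"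
    using assms(1) by (auto simp: a_def b_def)
  then have "F a \<le> z" "z \<le> F b"
    using exp[OF ab(1)] exp[OF ab(2)] by linarith+
  then show ?thesis
    using IVT'[of F a z b] ab continuous_on_subset[OF assms(2)] by auto
qed

lemma Lipschitz_inverse:
  fixes F :: "real \<Rightarrow> real"
  assumes "c > 0" "C > 0" and exp: "\<And>x y. x \<le> y \<Longrightarrow> c * (y - x) \<le> F y - F x"
    and lip: "\<And>x y. x \<le> y \<Longrightarrow> F y - F x \<le> C * (y - x)"
  obtains G where "\<And>z. F (G z) = z" "\<And>x. G (F x) = x"
    "\<And>z w. z \<le> w \<Longrightarrow> (w - z) / C \<le> G w - G z" "\<And>z w. z \<le> w \<Longrightarrow> G w - G z \<le> (w - z) / c"
    "continuous_on UNIV G"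
proof -
  have cont: "continuous_on UNIV H" if "D \<ge> 0" "\<And>x y. x \<le> y \<Longrightarrow> \<bar>H y - H x\<bar> \<le> D * (y - x)" for H :: "real \<Rightarrow> real" and D
  proof (rule lipschitz_on_continuous_on[where L=D], rule lipschitz_onI)
    fix x y :: real
    show "dist (H x) (H y) \<le> D * dist x y"
    proof (cases "x \<le> y")
      case True
      then show ?thesis using that(2)[OF True] by (simp add: dist_real_def abs_minus_commute)
    next
      case False
      then show ?thesis using that(2)[of y x] by (simp add: dist_real_def)
    qed
  qed (use that in simp)
  have mono: "F x \<le> F y" if "x \<le> y" for x y
  proof -
    have "0 \<le> c * (y - x)" using assms(1) that by (intro mult_nonneg_nonneg) auto
    then show ?thesis using exp[OF that] by linarith
  qed
  have "\<bar>F y - F x\<bar> \<le> C * (y - x)" if "x \<le> y" for x y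
    using mono[OF that] lip[OF that] by simp
  then have "continuous_on UNIV F" using assms(2) by (intro cont[of C]) auto
  then have "\<forall>z. \<exists>x. F x = z" using surj_of_expanding[OF assms(1)] exp by blast
  then obtain G where G: "\<And>z. F (G z) = z" by metis
  have inj: "x = y" if "F x = F y" for x y
  proof -
    have "c * \<bar>y - x\<bar> \<le> 0"
    proof (cases "x \<le> y")
      case True
      then show ?thesis using exp[OF True] that by simp
    next
      case False
      then show ?thesis using exp[of y x] that by simp
    qed
    then show ?thesis using assms(1) by (simp add: mult_le_0_iff)
  qed
  have Gm: "G z \<le> G w" if "z \<le> w" for z w
  proof (rule ccontr)
    assume "\<not> G z \<le> G w"
    then have "c * (G z - G w) > 0" using assms(1) by (intro mult_pos_pos) auto
    moreover have "c * (G z - G w) \<le> z - w"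
      using exp[of "G w" "G z"] \<open>\<not> G z \<le> G w\<close> by (simp add: G)
    ultimately show False using that by linarith
  qed
  have lo: "(w - z) / C \<le> G w - G z" if "z \<le> w" for z w
    using lip[OF Gm[OF that]] assms(2) by (simp add: G divide_le_eq mult.commute)
  have hi: "G w - G z \<le> (w - z) / c" if "z \<le> w" for z w
    using exp[OF Gm[OF that]] assms(1) by (simp add: G le_divide_eq mult.commute)
  have "\<bar>G w - G z\<bar> \<le> 1 / c * (w - z)" if "z \<le> w" for z w
    using hi[OF that] Gm[OF that] by simp
  then have "continuous_on UNIV G" using assms(1) by (intro cont[of "1 / c"]) auto
  then show thesis using that[of G] G inj lo hi by blast
qed

text \<open>Each r_i x + L_i x is bi-Lipschitz, so d_i is determined by H and T, and the condition
  on the sum becomes a single equation for H, solved by the intermediate value theorem. The rates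
  follow by comparing increments with those of the linear system.\<close>

lemma Lipschitz_scales:
  fixes r p \<beta> :: "'n::finite \<Rightarrow> real" and R P \<epsilon> s0 :: real
  assumes r: "\<And>j. r j > 0" and p: "\<And>j. p j > 0"
    and R: "R = real CARD('n) * inverse (\<Sum>j\<in>UNIV. 1 / r j)"
    and P: "P = real CARD('n) / R * inverse (\<Sum>j\<in>UNIV. 1 / (p j * r j))"
    and \<beta>: "\<And>j. \<beta> j = 1 / r j * (R / real CARD('n) + 1 / p j - 1 / P)" and \<beta>0: "\<And>j. \<beta> j > 0"
    and "\<epsilon> > 0" "s0 > 0"
  obtains s where "0 < s" "s \<le> s0"
    "\<And>L. (\<And>i x y. \<bar>L i x - L i y\<bar> \<le> s * \<bar>x - y\<bar>) \<Longrightarrow>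
       \<exists>d H. (\<forall>T. (\<Sum>i\<in>UNIV. d i T) = T) \<and> (\<forall>i T. r i * d i T + L i (d i T) = H T + T / p i)
         \<and> (\<forall>i T T'. \<bar>(d i T - d i T') - \<beta> i * (T - T')\<bar> \<le> \<epsilon> * \<bar>T - T'\<bar>)
         \<and> (\<forall>T T'. \<bar>(H T - H T') - (R / real CARD('n) - 1 / P) * (T - T')\<bar> \<le> \<epsilon> * \<bar>T - T'\<bar>)"
proof -
  define n where "n = real CARD('n)"
  define A where "A = (\<Sum>j\<in>UNIV. 1 / r j)"
  define B where "B = (\<Sum>j\<in>UNIV. 1 / (p j * r j))"
  define b where "b = R / n - 1 / P"
  have n0: "n > 0" by (simp add: n_def)
  have A0: "A > 0" unfolding A_def using r by (intro sum_pos) auto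
  have B0: "B > 0" unfolding B_def using r p by (intro sum_pos) auto
  have RA: "R / n = 1 / A" using n0 A0 by (simp add: R A_def[symmetric] n_def[symmetric] field_simps)
  have PA: "1 / P = B / A"
    using n0 A0 B0 by (simp add: P R A_def[symmetric] B_def[symmetric] n_def[symmetric] field_simps)
  have bA: "b * A = 1 - B" using A0 by (simp add: b_def RA PA field_simps)
  have \<beta>': "\<beta> j = (b + 1 / p j) / r j" for j
    by (simp add: \<beta> b_def n_def)
  have \<beta>sum: "(\<Sum>j\<in>UNIV. \<beta> j) = 1"
  proof -
    have "(\<Sum>j\<in>UNIV. \<beta> j) = (\<Sum>j\<in>UNIV. b * (1 / r j) + 1 / (p j * r j))"
      by (simp add: \<beta>' add_divide_distrib)
    also have "\<dots> = b * A + B"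
      by (simp add: sum.distrib sum_distrib_left A_def B_def)
    finally show ?thesis using bA by simp
  qed
  have rA: "1 / r j \<le> A" for j
    unfolding A_def using r by (intro member_le_sum) (auto simp: less_imp_le)
  \<comment> \<open>The bounds after \<open>s0\<close> serve, in turn, to get s \<le> r_i / 2 from 1
    / r_i \<le> A, to absorb the total increment \<open>M\<close>, to get \<epsilon> for H, and to
    get \<epsilon> for the d_i.\<close>
  define s where "s = min s0 (min (1 / (2 * A)) (min (1 / (4 * n * A)) (min (\<epsilon> / 2) (\<epsilon> / (4 * A)))))"
  have s0: "s > 0" using assms A0 n0 by (simp add: s_def)
  have s: "s \<le> s0" "s \<le> 1 / (2 * A)" "s \<le> 1 / (4 * n * A)" "s \<le> \<epsilon> / 2" "s \<le> \<epsilon> / (4 * A)"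
    by (auto simp: s_def)
  have sr: "s \<le> r j / 2" for j
  proof -
    have "1 / A \<le> r j" using rA[of j] A0 r[of j] by (simp add: field_simps)
    then show ?thesis using s(2) by simp
  qed
  show thesis
  proof (rule that[OF s0 s(1)])
    fix L :: "'n \<Rightarrow> real \<Rightarrow> real"
    assume L: "\<And>i x y. \<bar>L i x - L i y\<bar> \<le> s * \<bar>x - y\<bar>"
    define \<Phi> where "\<Phi> i x = r i * x + L i x" for i x
    have \<Phi>lo: "r i / 2 * (y - x) \<le> \<Phi> i y - \<Phi> i x" if "x \<le> y" for i x y
    proof -
      have "L i y - L i x \<ge> - (s * (y - x))" using L[of i y x] that by auto
      moreover have "s * (y - x) \<le> r i / 2 * (y - x)" using sr that by (intro mult_right_mono) auto
      moreover have "\<Phi> i y - \<Phi> i x = 2 * (r i / 2 * (y - x)) + (L i y - L i x)" by (simp add: \<Phi>_def field_simps)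
      ultimately show ?thesis by linarith
    qed
    have \<Phi>hi: "\<Phi> i y - \<Phi> i x \<le> 2 * r i * (y - x)" if "x \<le> y" for i x y
    proof -
      have "L i y - L i x \<le> s * (y - x)" using L[of i y x] that by auto
      moreover have "s * (y - x) \<le> r i * (y - x)" using sr[of i] r[of i] that by (intro mult_right_mono) auto
      moreover have "\<Phi> i y - \<Phi> i x = r i * (y - x) + (L i y - L i x)" by (simp add: \<Phi>_def algebra_simps)
      ultimately show ?thesis by simp
    qed
    have "\<forall>i. \<exists>\<Psi>. (\<forall>z. \<Phi> i (\<Psi> z) = z) \<and> (\<forall>z w. z \<le> w \<longrightarrow> (w - z) / (2 * r i) \<le> \<Psi> w - \<Psi> z) \<and> continuous_on UNIV \<Psi>"
    proof
      fix i
      show "\<exists>\<Psi>. (\<forall>z. \<Phi> i (\<Psi> z) = z) \<and> (\<forall>z w. z \<le> w \<longrightarrow> (w - z) / (2 * r i) \<le> \<Psi> w - \<Psi> z) \<and> continuous_on UNIV \<Psi>"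
        using Lipschitz_inverse[of "r i / 2" "2 * r i" "\<Phi> i"] \<Phi>lo \<Phi>hi r[of i] by (smt (verit, best) divide_pos_pos)
    qed
    then obtain \<Psi> where \<Psi>: "\<And>i z. \<Phi> i (\<Psi> i z) = z"
      "\<And>i z w. z \<le> w \<Longrightarrow> (w - z) / (2 * r i) \<le> \<Psi> i w - \<Psi> i z" "\<And>i. continuous_on UNIV (\<Psi> i)" by metis
    \<comment> \<open>The sum increases in h at rate at least A/2, because the i-th inverse
      increases at rate at least 1 / (2 r_i).\<close>
    have "\<exists>h. (\<Sum>i\<in>UNIV. \<Psi> i (h + T / p i)) = T" for T
    proof (rule surj_of_expanding[of "A / 2"])
      show "continuous_on UNIV (\<lambda>h. \<Sum>i\<in>UNIV. \<Psi> i (h + T / p i))"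
        by (intro continuous_on_sum continuous_on_compose2[OF \<Psi>(3)] continuous_intros) auto
      fix x y :: real assume xy: "x \<le> y"
      have "A / 2 * (y - x) = (\<Sum>i\<in>UNIV. ((y + T / p i) - (x + T / p i)) / (2 * r i))"
        unfolding A_def sum_divide_distrib sum_distrib_right by (intro sum.cong refl) (simp add: field_simps)
      also have "\<dots> \<le> (\<Sum>i\<in>UNIV. \<Psi> i (y + T / p i) - \<Psi> i (x + T / p i))"
        using xy by (intro sum_mono \<Psi>(2)) auto
      finally show "A / 2 * (y - x) \<le> (\<Sum>i\<in>UNIV. \<Psi> i (y + T / p i)) - (\<Sum>i\<in>UNIV. \<Psi> i (x + T / p i))"
        by (simp add: sum_subtractf)
    qed (use A0 in simp)
    then obtain H where H: "\<And>T. (\<Sum>i\<in>UNIV. \<Psi> i (H T + T / p i)) = T" by metis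
    define d where "d i T = \<Psi> i (H T + T / p i)" for i T
    have d\<Phi>: "r i * d i T + L i (d i T) = H T + T / p i" for i T
      using \<Psi>(1)[of i "H T + T / p i"] by (simp add: d_def \<Phi>_def)
    have dsum: "(\<Sum>i\<in>UNIV. d i T) = T" for T using H[of T] by (simp add: d_def)
    have incr: "\<bar>(H T - H T') - b * (T - T')\<bar> \<le> \<epsilon> * \<bar>T - T'\<bar> \<and> (\<forall>i. \<bar>(d i T - d i T') - \<beta> i * (T - T')\<bar> \<le> \<epsilon> * \<bar>T - T'\<bar>)" for T T'
    proof -
      define \<delta> where "\<delta> = T - T'"
      define D where "D i = d i T - d i T'" for i
      define h where "h = H T - H T'"
      define l where "l i = L i (d i T) - L i (d i T')" for i
      define M where "M = (\<Sum>i\<in>UNIV. \<bar>D i\<bar>)"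
      have M0: "M \<ge> 0" by (simp add: M_def sum_nonneg)
      have DM: "\<bar>D i\<bar> \<le> M" for i unfolding M_def by (intro member_le_sum) auto
      have lD: "\<bar>l i\<bar> \<le> s * \<bar>D i\<bar>" for i unfolding l_def D_def by (rule L)
      have eq: "r i * D i = h + \<delta> / p i - l i" for i
        using d\<Phi>[of i T] d\<Phi>[of i T'] by (simp add: D_def h_def \<delta>_def l_def algebra_simps diff_divide_distrib)
      have D: "D i = h * (1 / r i) + \<delta> * (1 / (p i * r i)) - l i / r i" for i
      proof -
        have "D i = (h + \<delta> / p i - l i) / r i"
          using r[of i] by (simp add: eq[symmetric])
        then show ?thesis by (simp add: add_divide_distrib diff_divide_distrib)
      qed
      have "\<delta> = (\<Sum>i\<in>UNIV. D i)"
        by (simp add: D_def sum_subtractf dsum \<delta>_def)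
      also have "\<dots> = h * A + \<delta> * B - (\<Sum>i\<in>UNIV. l i / r i)"
        by (subst D) (simp only: sum_subtractf sum.distrib sum_distrib_left A_def B_def)
      finally have \<delta>eq: "\<delta> = \<dots>" .
      \<comment> \<open>Because b A = 1 - B, the linear parts cancel, and only increments of the
        perturbations remain.\<close>
      have hA: "(h - b * \<delta>) * A = (\<Sum>i\<in>UNIV. l i / r i)"
      proof -
        have "\<delta> * B = \<delta> * (1 - b * A)" using bA by simp
        moreover have "(h - b * \<delta>) * A = h * A - \<delta> + \<delta> * (1 - b * A)" by (simp add: algebra_simps)
        ultimately show ?thesis using \<delta>eq by linarith
      qed
      have "\<bar>h - b * \<delta>\<bar> * A = \<bar>\<Sum>i\<in>UNIV. l i / r i\<bar>"
        unfolding hA[symmetric] using A0 by (simp add: abs_mult)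
      also have "\<dots> \<le> (\<Sum>i\<in>UNIV. \<bar>l i / r i\<bar>)" by (rule sum_abs)
      also have "\<dots> \<le> (\<Sum>i\<in>UNIV. s * \<bar>D i\<bar> * A)"
      proof (intro sum_mono)
        fix i
        have "\<bar>l i\<bar> * (1 / r i) \<le> s * \<bar>D i\<bar> * A"
          using lD rA s0 r by (intro mult_mono) (auto simp: less_imp_le)
        then show "\<bar>l i / r i\<bar> \<le> s * \<bar>D i\<bar> * A" using r[of i] by (simp add: abs_divide)
      qed
      also have "\<dots> = s * M * A" by (simp add: M_def sum_distrib_left sum_distrib_right)
      finally have h: "\<bar>h - b * \<delta>\<bar> \<le> s * M" using A0 by simp
      have Di: "\<bar>D i - \<beta> i * \<delta>\<bar> \<le> 2 * s * A * M" for i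
      proof -
        have "D i - \<beta> i * \<delta> = (h - b * \<delta> - l i) * (1 / r i)"
          using r[of i] eq[of i] by (simp add: \<beta>' field_simps)
        also have "\<bar>\<dots>\<bar> \<le> (2 * s * M) * A"
        proof -
          have "s * \<bar>D i\<bar> \<le> s * M" using DM s0 by (intro mult_left_mono) auto
          then have "\<bar>h - b * \<delta> - l i\<bar> \<le> 2 * s * M" using h lD[of i] by linarith
          then show ?thesis unfolding abs_mult using rA[of i] r[of i] s0 M0 by (intro mult_mono) auto
        qed
        finally show ?thesis by (simp add: mult_ac)
      qed
      \<comment> \<open>The bounds for the \<open>D i\<close> contain \<open>M\<close> itself.
        Summed over i, with the \<beta>_i adding up to 1, they give M \<le> |\<delta>| + M/2 by s
        \<le> 1 / (4 n A).\<close>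
      have "M \<le> (\<Sum>i\<in>UNIV. \<beta> i * \<bar>\<delta>\<bar> + 2 * s * A * M)"
        unfolding M_def
      proof (intro sum_mono)
        fix i
        have "\<bar>\<beta> i * \<delta>\<bar> = \<beta> i * \<bar>\<delta>\<bar>" using \<beta>0[of i] by (simp add: abs_mult)
        then show "\<bar>D i\<bar> \<le> \<beta> i * \<bar>\<delta>\<bar> + 2 * s * A * (\<Sum>i\<in>UNIV. \<bar>D i\<bar>)"
          using Di[of i] unfolding M_def by linarith
      qed
      also have "\<dots> = \<bar>\<delta>\<bar> + n * (2 * s * A * M)"
        by (simp add: sum.distrib sum_distrib_right[symmetric] \<beta>sum n_def)
      also have "n * (2 * s * A * M) = (4 * n * A * s) * M / 2" by simp
      also have "(4 * n * A * s) * M \<le> 1 * M"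
        using s(3) n0 A0 M0 by (intro mult_right_mono) (auto simp: field_simps)
      finally have M: "M \<le> 2 * \<bar>\<delta>\<bar>" by simp
      have "s * M \<le> \<epsilon> / 2 * (2 * \<bar>\<delta>\<bar>)" using s(4) M s0 M0 assms(7) by (intro mult_mono) auto
      then have 1: "\<bar>h - b * \<delta>\<bar> \<le> \<epsilon> * \<bar>\<delta>\<bar>" using h by simp
      have "(2 * A) * (s * M) \<le> (2 * A) * (\<epsilon> / (4 * A) * (2 * \<bar>\<delta>\<bar>))"
        using s(5) M s0 M0 assms(7) A0 by (intro mult_left_mono mult_mono) auto
      also have "\<dots> = \<epsilon> * \<bar>\<delta>\<bar>" using A0 by simp
      finally have "2 * s * A * M \<le> \<epsilon> * \<bar>\<delta>\<bar>" by (simp add: mult_ac)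
      then have "\<bar>D i - \<beta> i * \<delta>\<bar> \<le> \<epsilon> * \<bar>\<delta>\<bar>" for i using Di[of i] by linarith
      with 1 show ?thesis by (simp add: h_def \<delta>_def D_def)
    qed
    then show "\<exists>d H. (\<forall>T. (\<Sum>i\<in>UNIV. d i T) = T) \<and> (\<forall>i T. r i * d i T + L i (d i T) = H T + T / p i)
         \<and> (\<forall>i T T'. \<bar>(d i T - d i T') - \<beta> i * (T - T')\<bar> \<le> \<epsilon> * \<bar>T - T'\<bar>)
         \<and> (\<forall>T T'. \<bar>(H T - H T') - (R / real CARD('n) - 1 / P) * (T - T')\<bar> \<le> \<epsilon> * \<bar>T - T'\<bar>)"
      using dsum d\<Phi> unfolding b_def n_def by blast
  qed
qed

section \<open>Level sets and differences\<close>

definition coord_scale :: "('n \<Rightarrow> nat) \<Rightarrow> real ^ 'n \<Rightarrow> real ^ 'n::finite" where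
  "coord_scale a v = (\<chi> i. real (a i) * v $ i)"

lemma coord_scale_zero [simp]: "coord_scale (\<lambda>i. 0) v = 0"
  by (simp add: coord_scale_def vec_eq_iff)

lemma coord_scale_upd:
  "a i = 0 \<Longrightarrow> coord_scale (a(i := b)) v = (real b * v $ i) *\<^sub>R axis i 1 + coord_scale a v"
  by (auto simp: coord_scale_def vec_eq_iff axis_def)

lemma borel_measurable_coord_scale [measurable (raw)]:
  "f \<in> borel_measurable M \<Longrightarrow> (\<lambda>x. coord_scale a (f x)) \<in> borel_measurable M"
  unfolding coord_scale_def
  by (erule measurable_compose)
     (intro borel_measurable_continuous_onI continuous_on_vec_lambda continuous_intros)

lemma borel_measurable_vec_nth_raw [measurable (raw)]:
  fixes f :: "'a \<Rightarrow> real ^ 'n::finite"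
  shows "f \<in> borel_measurable M \<Longrightarrow> (\<lambda>x. f x $ i) \<in> borel_measurable M"
  by (erule measurable_compose) (intro borel_measurable_continuous_onI continuous_intros)

lemma abs_le_partial_diff:
  "\<bar>f x\<bar> \<le> \<bar>partial_diff m j h f x\<bar> + (\<Sum>b\<in>{1..m}. real (m choose b) * \<bar>f (x + (real b * h) *\<^sub>R axis j 1)\<bar>)"
proof -
  let ?t = "\<lambda>b. (- 1) ^ (m - b) * real (m choose b) * f (x + (real b * h) *\<^sub>R axis j 1)"
  have "{..m} = insert 0 {1..m}" by auto
  then have "partial_diff m j h f x = (- 1) ^ m * f x + (\<Sum>b\<in>{1..m}. ?t b)"
    unfolding partial_diff_def by simp
  then have "(- 1) ^ m * f x = partial_diff m j h f x - (\<Sum>b\<in>{1..m}. ?t b)"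
    by simp
  moreover have "\<bar>(- 1) ^ m * f x\<bar> = \<bar>f x\<bar>" by (simp add: abs_mult)
  moreover have "\<bar>\<Sum>b\<in>{1..m}. ?t b\<bar> \<le> (\<Sum>b\<in>{1..m}. \<bar>?t b\<bar>)" by (rule sum_abs)
  moreover have "(\<Sum>b\<in>{1..m}. \<bar>?t b\<bar>) = (\<Sum>b\<in>{1..m}. real (m choose b) * \<bar>f (x + (real b * h) *\<^sub>R axis j 1)\<bar>)"
    by (simp add: abs_mult)
  ultimately show ?thesis by linarith
qed

text \<open>Coordinate by coordinate: either the difference in direction i exceeds z at the current
  point, or \<open>abs_le_partial_diff\<close> hands the largeness on to a point moved by b v_i with
  b \<ge> 1, at the cost of a factor 1 + 2^(m i). In the first alternative all multipliers are
  therefore at least 1, and the final point depends on v in a nondegenerate way; in the second they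
  may vanish, as there only a translation in x is used.\<close>

lemma difference_dichotomy:
  fixes g :: "real ^ 'n::finite \<Rightarrow> real"
  assumes "finite I" "Y \<ge> 0" "z \<ge> 0"
    and "\<bar>g x\<bar> > (\<Prod>i\<in>I. 1 + 2 ^ m i) * (Y + z)"
  shows "(\<exists>a. (\<forall>i\<in>I. 1 \<le> a i \<and> a i \<le> m i) \<and> (\<forall>i. i \<notin> I \<longrightarrow> a i = 0) \<and> \<bar>g (x + coord_scale a v)\<bar> > Y)
    \<or> (\<exists>i\<in>I. \<exists>a. (\<forall>i. a i \<le> m i) \<and> (\<forall>i. i \<notin> I \<longrightarrow> a i = 0)
          \<and> \<bar>partial_diff (m i) i (v $ i) g (x + coord_scale a v)\<bar> > z)"
  using assms(1,4)
proof (induction I arbitrary: x rule: finite_induct)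
  case empty
  then have "\<bar>g (x + coord_scale (\<lambda>i. 0) v)\<bar> > Y" using assms(3) by simp
  then show ?case by auto
next
  case (insert i I)
  define K where "K = (\<Prod>i\<in>I. 1 + 2 ^ m i :: real)"
  have K1: "K \<ge> 1" unfolding K_def by (intro prod_ge_1) simp
  let ?D = "\<bar>partial_diff (m i) i (v $ i) g x\<bar>"
  show ?case
  proof (cases "?D > z")
    case True
    then have "\<bar>partial_diff (m i) i (v $ i) g (x + coord_scale (\<lambda>i. 0) v)\<bar> > z" by simp
    then show ?thesis by (intro disjI2) auto
  next
    case False
    have "\<exists>b\<in>{1..m i}. \<bar>g (x + (real b * v $ i) *\<^sub>R axis i 1)\<bar> > K * (Y + z)"
    proof (rule ccontr)
      assume "\<not> ?thesis"
      then have "(\<Sum>b\<in>{1..m i}. real (m i choose b) * \<bar>g (x + (real b * v $ i) *\<^sub>R axis i 1)\<bar>)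
          \<le> (\<Sum>b\<in>{1..m i}. real (m i choose b) * (K * (Y + z)))"
        by (intro sum_mono mult_left_mono) (auto simp: not_less)
      also have "\<dots> = (\<Sum>b\<in>{1..m i}. real (m i choose b)) * (K * (Y + z))"
        by (simp add: sum_distrib_right)
      also have "\<dots> \<le> 2 ^ m i * (K * (Y + z))"
      proof (intro mult_right_mono)
        have "(\<Sum>b\<in>{1..m i}. real (m i choose b)) \<le> (\<Sum>b\<le>m i. real (m i choose b))"
          by (intro sum_mono2) auto
        also have "\<dots> = 2 ^ m i"
          by (metis (mono_tags) choose_row_sum of_nat_numeral of_nat_power of_nat_sum)
        finally show "(\<Sum>b\<in>{1..m i}. real (m i choose b)) \<le> 2 ^ m i" .
      qed (use K1 assms in auto)
      finally have "\<bar>g x\<bar> \<le> z + 2 ^ m i * (K * (Y + z))"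
        using abs_le_partial_diff[of g x "m i" i "v $ i"] False by linarith
      moreover have "z \<le> K * (Y + z)"
        using mult_right_mono[OF K1, of "Y + z"] assms(2,3) by simp
      moreover have "(1 + 2 ^ m i) * K * (Y + z) = K * (Y + z) + 2 ^ m i * (K * (Y + z))"
        by (simp add: algebra_simps)
      ultimately have "\<bar>g x\<bar> \<le> (1 + 2 ^ m i) * K * (Y + z)" by linarith
      then show False using insert by (simp add: K_def)
    qed
    then obtain b where b: "1 \<le> b" "b \<le> m i" and gb: "\<bar>g (x + (real b * v $ i) *\<^sub>R axis i 1)\<bar> > K * (Y + z)" by auto
    let ?y = "x + (real b * v $ i) *\<^sub>R axis i 1"
    have shift: "?y + coord_scale a v = x + coord_scale (a(i := b)) v" if "\<forall>i. i \<notin> I \<longrightarrow> a i = 0" for a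
      using coord_scale_upd[of a i b v] that insert.hyps by (simp add: add.assoc)
    from insert.IH[OF gb[unfolded K_def]] show ?thesis
    proof (elim disjE exE bexE conjE)
      fix a assume a: "\<forall>i\<in>I. 1 \<le> a i \<and> a i \<le> m i" "\<forall>i. i \<notin> I \<longrightarrow> a i = 0" "\<bar>g (?y + coord_scale a v)\<bar> > Y"
      define a' where "a' = a(i := b)"
      have "\<bar>g (x + coord_scale a' v)\<bar> > Y" using a(3) unfolding a'_def shift[OF a(2)] .
      moreover have "\<forall>i'\<in>insert i I. 1 \<le> a' i' \<and> a' i' \<le> m i'" "\<forall>i'. i' \<notin> insert i I \<longrightarrow> a' i' = 0"
        using a(1,2) b by (auto simp: a'_def)
      ultimately show ?thesis by blast
    next
      fix i' a assume a: "i' \<in> I" "\<forall>i. a i \<le> m i" "\<forall>i. i \<notin> I \<longrightarrow> a i = 0"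
        "\<bar>partial_diff (m i') i' (v $ i') g (?y + coord_scale a v)\<bar> > z"
      define a' where "a' = a(i := b)"
      have "\<bar>partial_diff (m i') i' (v $ i') g (x + coord_scale a' v)\<bar> > z" using a(4) unfolding a'_def shift[OF a(3)] .
      moreover have "\<forall>i. a' i \<le> m i" "\<forall>i'. i' \<notin> insert i I \<longrightarrow> a' i' = 0"
        using a(2,3) b by (auto simp: a'_def)
      ultimately show ?thesis using a(1) by blast
    qed
  qed
qed

lemma Basis_vec_real: "(Basis :: (real ^ 'n::finite) set) = range (\<lambda>i. axis i 1)"
  by (auto simp: Basis_vec_def)

lemma prod_Basis_vec: "(\<Prod>b\<in>(Basis :: (real ^ 'n::finite) set). F b) = (\<Prod>i\<in>UNIV. F (axis i 1))"
  unfolding Basis_vec_real by (subst prod.reindex) (auto simp: inj_on_def axis_eq_axis)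

text \<open>The affine map has Jacobian equal to the product of the \<open>a i\<close>, which is at
  least 1.\<close>

lemma emeasure_coord_scale_vimage_le:
  fixes B :: "(real ^ 'n::finite) set"
  assumes [measurable]: "B \<in> sets borel" and a: "\<And>i. 1 \<le> a i"
  shows "emeasure lborel {v. x + coord_scale a v \<in> B} \<le> emeasure lborel B"
proof -
  define c where "c b = (\<Sum>i\<in>UNIV. real (a i) * b $ i)" for b :: "real ^ 'n"
  have c: "c (axis i 1) = real (a i)" for i
    unfolding c_def by (simp add: axis_def if_distrib cong: if_cong)
  define T where "T v = x + (\<Sum>b\<in>Basis. (c b * (v \<bullet> b)) *\<^sub>R b)" for v
  have T: "T v = x + coord_scale a v" for v
  proof -
    have "(\<Sum>b\<in>Basis. (c b * (v \<bullet> b)) *\<^sub>R b) $ i = real (a i) * v $ i" for i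
    proof -
      have "(\<Sum>b\<in>Basis. (c b * (v \<bullet> b)) *\<^sub>R b) \<bullet> axis i 1 = c (axis i 1) * (v \<bullet> axis i 1)"
        by (rule inner_sum_left_Basis) simp
      then show ?thesis by (simp add: inner_axis c)
    qed
    then show ?thesis by (simp add: T_def coord_scale_def vec_eq_iff)
  qed
  have [measurable]: "T \<in> borel_measurable borel"
    unfolding T by measurable
  have c0: "c b \<noteq> 0" if "b \<in> Basis" for b
  proof -
    obtain i where "b = axis i 1" using \<open>b \<in> Basis\<close> unfolding Basis_vec_real by auto
    then show ?thesis using a[of i] by (simp add: c)
  qed
  have "emeasure lborel B = emeasure (density (distr lborel borel T) (\<lambda>_. ennreal (\<Prod>j\<in>Basis. \<bar>c j\<bar>))) B"
    using lborel_affine_euclidean[of c x, OF c0] unfolding T_def by simp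
  also have "\<dots> = ennreal (\<Prod>j\<in>Basis. \<bar>c j\<bar>) * emeasure lborel (T -` B)"
    by (simp add: emeasure_density nn_integral_cmult emeasure_distr)
  finally have eq: "emeasure lborel B = \<dots>" .
  have "(\<Prod>j\<in>Basis. \<bar>c j\<bar>) \<ge> 1"
    unfolding prod_Basis_vec c using a by (intro prod_ge_1) (simp add: Suc_leI)
  then have "1 * emeasure lborel (T -` B) \<le> emeasure lborel B"
    unfolding eq by (intro mult_right_mono) (simp_all add: ennreal_leI[of 1, simplified])
  then show ?thesis by (simp add: vimage_def T)
qed

text \<open>If $|g(x)|$ is large, then for at least half of the steps $v$ in the box no point $x + a v$ lies in
  the exceptional set of \<^term>\<open>Y\<close>, so that some difference of \<^term>\<open>g\<close> with steps $v$ must be large; count the pairs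
  $(x, v)$ in two ways.\<close>

lemma level_step:
  fixes g :: "real ^ 'n::finite \<Rightarrow> real"
  assumes [measurable]: "g \<in> borel_measurable borel"
    and "Y \<ge> 0" "z \<ge> 0" "\<gamma> \<ge> 0" and \<delta>: "\<And>i. \<delta> i > 0"
    and B: "ennreal (\<Prod>i\<in>UNIV. real (Suc (m i))) * emeasure lborel {x. \<bar>g x\<bar> > Y} \<le> ennreal ((\<Prod>i\<in>UNIV. \<delta> i) / 2)"
    and D: "\<And>i u. 0 < u \<Longrightarrow> u < \<delta> i \<Longrightarrow> emeasure lborel {x. \<bar>partial_diff (m i) i u g x\<bar> > z} \<le> ennreal \<gamma>"
  shows "emeasure lborel {x. \<bar>g x\<bar> > (\<Prod>i\<in>UNIV. 1 + 2 ^ m i) * (Y + z)}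
     \<le> ennreal (2 * real CARD('n) * (\<Prod>i\<in>UNIV. real (Suc (m i))) * \<gamma>)"
proof -
  define N where "N = (\<Prod>i\<in>UNIV. real (Suc (m i)))"
  define q where "q = (\<Prod>i\<in>UNIV. \<delta> i)"
  have q0: "q > 0" unfolding q_def using \<delta> by (intro prod_pos) auto
  have N0: "N > 0" unfolding N_def by (intro prod_pos) auto
  define A where "A = {a :: 'n \<Rightarrow> nat. \<forall>i. a i \<le> m i}"
  have A: "A = PiE UNIV (\<lambda>i. {..m i})" by (auto simp: A_def PiE_def)
  have finA [simp]: "finite A" unfolding A by (intro finite_PiE) auto
  have cardA: "real (card A) = N" unfolding A by (simp add: card_PiE N_def)
  define Q where "Q = box 0 (\<chi> i. \<delta> i)"
  have Qiff: "v \<in> Q \<longleftrightarrow> (\<forall>i. 0 < v $ i \<and> v $ i < \<delta> i)" for v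
    by (auto simp: Q_def mem_box_cart)
  have Q: "emeasure lborel Q = ennreal q"
  proof -
    have "emeasure lborel Q = ennreal (\<Prod>b\<in>Basis. ((\<chi> i. \<delta> i) - 0) \<bullet> b)"
      unfolding Q_def by (rule emeasure_lborel_box) (use \<delta> in \<open>auto simp: Basis_vec_real inner_axis less_imp_le\<close>)
    then show ?thesis unfolding prod_Basis_vec by (simp add: inner_axis q_def)
  qed
  have [measurable]: "Q \<in> sets borel" by (simp add: Q_def)
  let ?B = "{x. \<bar>g x\<bar> > Y}" and ?X = "{x. \<bar>g x\<bar> > (\<Prod>i\<in>UNIV. 1 + 2 ^ m i) * (Y + z)}"
  define F where "F i a x v = (of_bool (v \<in> Q \<and> \<bar>partial_diff (m i) i (v $ i) g (x + coord_scale a v)\<bar> > z) :: ennreal)"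
    for i a x v
  have [measurable]: "(\<lambda>w. F i a (fst w) (snd w)) \<in> borel_measurable (borel \<Otimes>\<^sub>M borel)" for i a
    unfolding F_def by measurable
  have [measurable]: "(\<lambda>w. F i a (snd w) (fst w)) \<in> borel_measurable (borel \<Otimes>\<^sub>M borel)" for i a
    unfolding F_def by measurable
  have [measurable]: "F i a x \<in> borel_measurable borel" for i a x
    unfolding F_def by measurable
  have [measurable]: "(\<lambda>x. F i a x v) \<in> borel_measurable borel" for i a v
    unfolding F_def by measurable
  \<comment> \<open>Of the volume q of the box, at most half is taken by steps v for which some x +
    a v lies in the level set of Y: there are at most N multipliers a with all entries \<ge> 1, and
    hypothesis \<open>B\<close> bounds N times the measure by q/2.\<close>
  have half: "ennreal (q / 2) \<le> (\<Sum>i\<in>UNIV. \<Sum>a\<in>A. (\<integral>\<^sup>+v. F i a x v \<partial>lborel))" if x: "x \<in> ?X" for x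
  proof -
    define A1 where "A1 = {a \<in> A. \<forall>i. 1 \<le> a i}"
    have pt: "indicator Q v \<le> (\<Sum>a\<in>A1. indicator {v. x + coord_scale a v \<in> ?B} v) + (\<Sum>i\<in>UNIV. \<Sum>a\<in>A. F i a x v)" for v
    proof (cases "v \<in> Q")
      case True
      from difference_dichotomy[of UNIV Y z m g x v] x assms(2,3)
      have "(\<exists>a. (\<forall>i. 1 \<le> a i \<and> a i \<le> m i) \<and> \<bar>g (x + coord_scale a v)\<bar> > Y)
        \<or> (\<exists>i a. (\<forall>i. a i \<le> m i) \<and> \<bar>partial_diff (m i) i (v $ i) g (x + coord_scale a v)\<bar> > z)" by auto
      then show ?thesis
      proof (elim disjE exE conjE)
        fix a assume a: "\<forall>i. 1 \<le> a i \<and> a i \<le> m i" "\<bar>g (x + coord_scale a v)\<bar> > Y"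
        have "(1::ennreal) = indicator {v. x + coord_scale a v \<in> ?B} v" using a by simp
        also have "\<dots> \<le> (\<Sum>a\<in>A1. indicator {v. x + coord_scale a v \<in> ?B} v)"
          using a by (intro member_le_sum) (auto simp: A1_def A_def finA[unfolded A_def])
        finally show ?thesis by (simp add: True add_increasing2)
      next
        fix i a assume a: "\<forall>i. a i \<le> m i" "\<bar>partial_diff (m i) i (v $ i) g (x + coord_scale a v)\<bar> > z"
        have "1 = F i a x v" using a True by (simp add: F_def)
        also have "\<dots> \<le> (\<Sum>a\<in>A. F i a x v)" using a by (intro member_le_sum) (auto simp: A_def finA[unfolded A_def])
        also have "\<dots> \<le> (\<Sum>i\<in>UNIV. \<Sum>a\<in>A. F i a x v)" by (intro member_le_sum) auto
        finally show ?thesis by (simp add: True add_increasing)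
      qed
    qed simp
    have finA1 [simp]: "finite A1" by (simp add: A1_def)
    have "ennreal q = (\<integral>\<^sup>+v. indicator Q v \<partial>lborel)" by (simp add: Q)
    also have "\<dots> \<le> (\<integral>\<^sup>+v. (\<Sum>a\<in>A1. indicator {v. x + coord_scale a v \<in> ?B} v) + (\<Sum>i\<in>UNIV. \<Sum>a\<in>A. F i a x v) \<partial>lborel)"
      by (intro nn_integral_mono pt)
    also have "\<dots> = (\<Sum>a\<in>A1. emeasure lborel {v. x + coord_scale a v \<in> ?B}) + (\<Sum>i\<in>UNIV. \<Sum>a\<in>A. (\<integral>\<^sup>+v. F i a x v \<partial>lborel))"
    proof -
      have [measurable]: "{v. x + coord_scale a v \<in> ?B} \<in> sets borel" for a by measurable
      show ?thesis by (subst nn_integral_add; (measurable)?) (simp add: nn_integral_sum)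
    qed
    also have "(\<Sum>a\<in>A1. emeasure lborel {v. x + coord_scale a v \<in> ?B}) \<le> (\<Sum>a\<in>A1. emeasure lborel ?B)"
      by (intro sum_mono emeasure_coord_scale_vimage_le) (auto simp: A1_def)
    also have "\<dots> \<le> ennreal N * emeasure lborel ?B"
    proof -
      have "card A1 \<le> card A" by (intro card_mono) (auto simp: A1_def)
      then show ?thesis
        by (simp add: ennreal_of_nat_eq_real_of_nat cardA[symmetric] ennreal_leI mult_right_mono)
    qed
    also have "\<dots> \<le> ennreal (q / 2)" using B by (simp add: N_def q_def)
    finally have "ennreal (q / 2) + ennreal (q / 2) \<le> ennreal (q / 2) + (\<Sum>i\<in>UNIV. \<Sum>a\<in>A. (\<integral>\<^sup>+v. F i a x v \<partial>lborel))"
      using q0 by (simp add: ennreal_plus[symmetric] del: ennreal_plus)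
    then show ?thesis by (simp add: ennreal_add_left_cancel_le)
  qed
  have "ennreal (q / 2) * emeasure lborel ?X = (\<integral>\<^sup>+x\<in>?X. ennreal (q / 2) \<partial>lborel)"
    by (subst nn_integral_cmult_indicator) auto
  also have "\<dots> \<le> (\<integral>\<^sup>+x. (\<Sum>i\<in>UNIV. \<Sum>a\<in>A. (\<integral>\<^sup>+v. F i a x v \<partial>lborel)) \<partial>lborel)"
    using half by (intro nn_integral_mono) (auto simp: indicator_def)
  also have "\<dots> = (\<Sum>i\<in>UNIV. \<Sum>a\<in>A. (\<integral>\<^sup>+x. \<integral>\<^sup>+v. F i a x v \<partial>lborel \<partial>lborel))"
    by (simp add: nn_integral_sum)
  also have "\<dots> = (\<Sum>i\<in>UNIV. \<Sum>a\<in>A. (\<integral>\<^sup>+v. \<integral>\<^sup>+x. F i a x v \<partial>lborel \<partial>lborel))"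
    by (intro sum.cong refl lborel_pair.Fubini') measurable
  \<comment> \<open>For fixed v the translation by a v preserves measure, so each of the n N pairs
    of a direction and a multiplier contributes at most \<gamma> q. Against the factor q/2 on the
    left this gives 2 n N \<gamma>.\<close>
  also have "\<dots> \<le> (\<Sum>i\<in>(UNIV::'n set). \<Sum>a\<in>A. (\<integral>\<^sup>+v. ennreal \<gamma> * indicator Q v \<partial>lborel))"
  proof (intro sum_mono nn_integral_mono)
    fix i a v
    show "(\<integral>\<^sup>+x. F i a x v \<partial>lborel) \<le> ennreal \<gamma> * indicator Q v"
    proof (cases "v \<in> Q")
      case True
      let ?E = "{x. \<bar>partial_diff (m i) i (v $ i) g x\<bar> > z}"
      have "(\<integral>\<^sup>+x. F i a x v \<partial>lborel) = (\<integral>\<^sup>+x. indicator ?E (x + coord_scale a v) \<partial>lborel)"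
        using True by (intro nn_integral_cong) (simp add: F_def indicator_def)
      also have "\<dots> = (\<integral>\<^sup>+x. indicator ?E x \<partial>lborel)"
        by (rule nn_integral_lborel_shift) measurable
      also have "\<dots> = emeasure lborel ?E" by simp
      also have "\<dots> \<le> ennreal \<gamma>" using True Qiff by (intro D) auto
      finally show ?thesis using True by simp
    qed (simp add: F_def)
  qed
  also have "\<dots> = ennreal (q / 2) * ennreal (2 * real CARD('n) * N * \<gamma>)"
    using q0 N0 assms(4)
    by (simp add: nn_integral_cmult_indicator Q ennreal_of_nat_eq_real_of_nat cardA ennreal_mult[symmetric] mult_ac)
  finally show ?thesis
    using q0 by (subst (asm) ennreal_mult_le_mult_iff) (auto simp: N_def)
qed

lemma prod_two_powr:
  fixes d :: "'n::finite \<Rightarrow> real"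
  shows "(\<Prod>i\<in>UNIV. 2 powr d i) = 2 powr (\<Sum>i\<in>UNIV. d i)"
  by (simp add: powr_sum)

text \<open>At scale \<^term>\<open>T\<close> the steps \<^term>\<open>2 powr d i T\<close> span a box of volume \<^term>\<open>2 powr T\<close>, and each
  difference of \<^term>\<open>g\<close> with steps inside the box is of size \<^term>\<open>S * 2 powr H T\<close> off a set of that measure.\<close>

definition scale_system ::
    "('n::finite \<Rightarrow> real) \<Rightarrow> ('n \<Rightarrow> nat) \<Rightarrow> real \<Rightarrow> real \<Rightarrow> real \<Rightarrow> (real ^ 'n \<Rightarrow> real) \<Rightarrow> real
      \<Rightarrow> (real \<Rightarrow> real) \<Rightarrow> ('n \<Rightarrow> real \<Rightarrow> real) \<Rightarrow> bool" where
  "scale_system p m B \<sigma> \<sigma>' g S H d \<longleftrightarrow> g \<in> borel_measurable borel \<and> S > 0 \<and>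
     (\<forall>T i u. 0 < u \<longrightarrow> u < 2 powr d i T \<longrightarrow> Lp_le (p i) (partial_diff (m i) i u g) (B * S * 2 powr (H T + T / p i))) \<and>
     (\<forall>T. (\<Sum>i\<in>UNIV. d i T) = T) \<and>
     (\<forall>T y. y \<ge> 0 \<longrightarrow> H (T - y) \<le> H T + \<sigma> * y) \<and> (\<forall>T y. y \<ge> 0 \<longrightarrow> H (T + y) \<le> H T + \<sigma>' * y)"

lemma scale_systemD:
  assumes "scale_system p m B \<sigma> \<sigma>' g S H d"
  shows "g \<in> borel_measurable borel" "S > 0"
    "\<And>T i u. 0 < u \<Longrightarrow> u < 2 powr d i T \<Longrightarrow> Lp_le (p i) (partial_diff (m i) i u g) (B * S * 2 powr (H T + T / p i))"
    "\<And>T. (\<Sum>i\<in>UNIV. d i T) = T"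
    "\<And>T y. y \<ge> 0 \<Longrightarrow> H (T - y) \<le> H T + \<sigma> * y" "\<And>T y. y \<ge> 0 \<Longrightarrow> H (T + y) \<le> H T + \<sigma>' * y"
  using assms unfolding scale_system_def by blast+

text \<open>One application of \<open>level_step\<close> multiplies the level by 2^(\<rho> N) and
  divides the measure by 2^N. Since H grows at rate at most \<sigma> \<le> \<rho> as T decreases,
  the height z of the differences at the next scale never overtakes the current level, and the step
  can be repeated.\<close>

lemma level_iteration:
  fixes p :: "'n::finite \<Rightarrow> real" and m :: "'n \<Rightarrow> nat" and B \<rho> \<sigma> \<sigma>' :: real
  assumes p: "\<And>i. p i \<ge> 1" and "B > 0" "\<rho> > 0" "\<sigma> \<le> \<rho>" "\<sigma>' \<ge> 0"
  obtains N D where "N > 0" "D \<ge> B"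
    "\<And>(g :: real ^ 'n \<Rightarrow> real) S H d T0 j \<nu>. scale_system p m B \<sigma> \<sigma>' g S H d \<Longrightarrow>
       Lp_le (p j) g (B * S * 2 powr (H T0 + T0 / p j)) \<Longrightarrow>
       emeasure lborel {x. \<bar>g x\<bar> > D * S * 2 powr H T0 * 2 powr (\<rho> * N * real \<nu>)} \<le> ennreal (2 powr (T0 - N * real \<nu>))"
proof -
  define K where "K = (\<Prod>i\<in>(UNIV::'n set). 1 + 2 ^ m i :: real)"
  define N0 where "N0 = (\<Prod>i\<in>(UNIV::'n set). real (Suc (m i)))"
  define n where "n = real CARD('n)"
  have K1: "K \<ge> 1" unfolding K_def by (intro prod_ge_1) simp
  have N01: "N0 \<ge> 1" unfolding N0_def by (intro prod_ge_1) simp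
  have n1: "n \<ge> 1" by (simp add: n_def Suc_leI)
  \<comment> \<open>At the scale T0 - N \<nu> + a the box has 2 N0 times the volume that bounds the
    current level set, as \<open>level_step\<close> requires.\<close>
  define a where "a = log 2 (2 * N0)"
  have a: "2 powr a = 2 * N0" "a \<ge> 0" using N01 by (simp_all add: a_def)
  \<comment> \<open>2 K is the growth of the level from Y to K (Y + z) when z \<le> Y.\<close>
  define N where "N = log 2 (2 * K) / \<rho>"
  have N: "N > 0" "2 powr (\<rho> * N) = 2 * K" using K1 assms(3) by (simp_all add: N_def)
  \<comment> \<open>Cancels the factor 2 n N0 of \<open>level_step\<close> and the factor 2 N0 of
    the box, leaving the gain 2^(-N).\<close>
  define D' where "D' = 4 * n * N0 ^ 2 * B * 2 powr N"
  have D'B: "D' \<ge> B"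
  proof -
    have "1 * 1 \<le> (4 * n) * N0 ^ 2" using n1 N01 by (intro mult_mono) (auto simp: one_le_power)
    moreover have "1 \<le> 2 powr N" using N(1) by (simp add: ge_one_powr_ge_zero)
    ultimately have "1 * 1 \<le> (4 * n * N0 ^ 2) * 2 powr N" by (intro mult_mono) auto
    then have "1 * B \<le> (4 * n * N0 ^ 2) * 2 powr N * B" using assms(2) by (intro mult_right_mono) auto
    then show ?thesis by (simp add: D'_def mult_ac)
  qed
  then have D'0: "D' > 0" using assms(2) by linarith
  \<comment> \<open>The additional factor pays for evaluating H at a scale higher by
    \<open>a\<close>.\<close>
  define D where "D = D' * 2 powr (\<sigma>' * a)"
  have DD': "D \<ge> D'"
  proof -
    have "1 \<le> 2 powr (\<sigma>' * a)" using assms(5) a by (simp add: ge_one_powr_ge_zero)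
    then show ?thesis using D'0 by (simp add: D_def)
  qed
  show thesis
  proof (rule that[OF N(1), of D])
    show "B \<le> D" using D'B DD' by linarith
    fix g :: "real ^ 'n \<Rightarrow> real" and S H d T0 j \<nu>
    assume sys: "scale_system p m B \<sigma> \<sigma>' g S H d" and g: "Lp_le (p j) g (B * S * 2 powr (H T0 + T0 / p j))"
    note [measurable] = scale_systemD(1)[OF sys]
    note S = scale_systemD(2)[OF sys] and small = scale_systemD(3)[OF sys] and dsum = scale_systemD(4)[OF sys]
      and H1 = scale_systemD(5)[OF sys] and H2 = scale_systemD(6)[OF sys]
    define Y where "Y \<nu> = D * S * 2 powr H T0 * 2 powr (\<rho> * N * real \<nu>)" for \<nu> :: nat
    have D0: "D > 0" using DD' D'0 by linarith
    have Y0: "Y \<nu> > 0" for \<nu> using D0 S by (simp add: Y_def)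
    \<comment> \<open>The quantity of Chebyshev's inequality. As q \<ge> 1 and B / E \<le> 1, the
      power of B / E may be replaced by B / E, so that the bound is the same for all
      \<open>p i\<close>.\<close>
    have ratio: "(B * S * 2 powr (h + T / q) / (E * S * 2 powr h)) powr q \<le> B / E * 2 powr T"
      if "q \<ge> 1" "E \<ge> B" for h T q E
    proof -
      have E0: "E > 0" using that assms(2) by linarith
      have eq: "(B * S * 2 powr (h + T / q) / (E * S * 2 powr h)) = B / E * 2 powr (T / q)"
        using S E0 by (simp add: powr_add field_simps)
      have r1: "(B * S * 2 powr (h + T / q) / (E * S * 2 powr h)) powr q = (B / E) powr q * 2 powr T"
        unfolding eq powr_mult using that by (simp add: powr_powr)
      have r2: "(B / E) powr q \<le> (B / E) powr 1"
        using that E0 assms(2) by (intro powr_mono') auto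
      show ?thesis unfolding r1 using r2 assms(2) E0 by (intro mult_right_mono) auto
    qed
    have "emeasure lborel {x. \<bar>g x\<bar> > Y \<nu>} \<le> ennreal (2 powr (T0 - N * real \<nu>))"
    proof (induction \<nu>)
      case 0
      have "emeasure lborel {x. \<bar>g x\<bar> > Y 0} \<le> ennreal ((B * S * 2 powr (H T0 + T0 / p j) / Y 0) powr p j)"
        using p[of j] assms(2) S Y0 by (intro Lp_le_Markov g) auto
      also have "\<dots> \<le> ennreal (B / D * 2 powr T0)"
        using ratio[OF p[of j], of D "H T0" T0] D'B DD' by (intro ennreal_leI) (simp add: Y_def)
      also have "\<dots> \<le> ennreal (1 * 2 powr T0)"
        using D'B DD' D0 by (intro ennreal_leI mult_right_mono) auto
      finally show ?case by simp
    next
      case (Suc \<nu>)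
      define T' where "T' = T0 - N * real \<nu> + a"
      define z where "z = D' * S * 2 powr H T'"
      have z0: "z > 0" using D'0 S by (simp add: z_def)
      have T': "2 powr T' = 2 powr (T0 - N * real \<nu>) * (2 * N0)"
        unfolding T'_def powr_add a ..
      have zY: "z \<le> Y \<nu>"
      proof -
        have "H T' \<le> H (T0 - N * real \<nu>) + \<sigma>' * a" unfolding T'_def by (rule H2[OF a(2)])
        also have "H (T0 - N * real \<nu>) \<le> H T0 + \<sigma> * (N * real \<nu>)" using N(1) by (intro H1) auto
        also have "\<sigma> * (N * real \<nu>) \<le> \<rho> * (N * real \<nu>)" using assms(4) N(1) by (intro mult_right_mono) auto
        finally have "2 powr H T' \<le> 2 powr (H T0 + \<rho> * (N * real \<nu>) + \<sigma>' * a)" by (intro powr_mono) auto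
        then have "z \<le> D' * S * 2 powr (H T0 + \<rho> * (N * real \<nu>) + \<sigma>' * a)"
          unfolding z_def using D'0 S by (intro mult_left_mono) auto
        also have "\<dots> = Y \<nu>" by (simp add: Y_def D_def powr_add mult_ac)
        finally show ?thesis .
      qed
      have "emeasure lborel {x. \<bar>g x\<bar> > (\<Prod>i\<in>UNIV. 1 + 2 ^ m i) * (Y \<nu> + z)}
         \<le> ennreal (2 * real CARD('n) * (\<Prod>i\<in>UNIV. real (Suc (m i))) * (B / D' * 2 powr T'))"
      proof (rule level_step[where \<delta>="\<lambda>i. 2 powr d i T'"])
        have "ennreal N0 * emeasure lborel {x. \<bar>g x\<bar> > Y \<nu>} \<le> ennreal N0 * ennreal (2 powr (T0 - N * real \<nu>))"
          using Suc by (intro mult_left_mono) auto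
        also have "\<dots> = ennreal (2 powr T' / 2)"
          using N01 by (simp add: T' ennreal_mult[symmetric] mult.commute)
        finally show "ennreal (\<Prod>i\<in>UNIV. real (Suc (m i))) * emeasure lborel {x. \<bar>g x\<bar> > Y \<nu>}
            \<le> ennreal ((\<Prod>i\<in>UNIV. 2 powr d i T') / 2)"
          unfolding prod_two_powr dsum N0_def .
      next
        fix i u assume u: "0 < u" "u < 2 powr d i T'"
        have "emeasure lborel {x. \<bar>partial_diff (m i) i u g x\<bar> > z}
            \<le> ennreal ((B * S * 2 powr (H T' + T' / p i) / z) powr p i)"
          using p[of i] assms(2) S z0 u by (intro Lp_le_Markov small) auto
        also have "\<dots> \<le> ennreal (B / D' * 2 powr T')"
          using ratio[OF p[of i] D'B, of "H T'" T'] by (intro ennreal_leI) (simp add: z_def)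
        finally show "emeasure lborel {x. \<bar>partial_diff (m i) i u g x\<bar> > z} \<le> ennreal (B / D' * 2 powr T')" .
      qed (use Y0[of \<nu>] z0 assms(2) D'0 in auto)
      also have "2 * real CARD('n) * (\<Prod>i\<in>UNIV. real (Suc (m i))) * (B / D' * 2 powr T') = 2 powr (T0 - N * real (Suc \<nu>))"
      proof -
        have "2 * n * N0 * (B / D' * 2 powr T') = 2 powr (T0 - N * real \<nu>) / 2 powr N"
          using n1 N01 assms(2) unfolding T' D'_def by (simp add: field_simps power2_eq_square)
        also have "\<dots> = 2 powr (T0 - N * real (Suc \<nu>))"
          by (simp add: powr_diff[symmetric] algebra_simps)
        finally show ?thesis by (simp add: n_def N0_def)
      qed
      finally have "emeasure lborel {x. \<bar>g x\<bar> > K * (Y \<nu> + z)} \<le> ennreal (2 powr (T0 - N * real (Suc \<nu>)))"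
        by (simp add: K_def)
      moreover have "K * (Y \<nu> + z) \<le> Y (Suc \<nu>)"
      proof -
        have "K * (Y \<nu> + z) \<le> K * (Y \<nu> + Y \<nu>)" using zY K1 by (intro mult_left_mono) auto
        also have "\<dots> = Y \<nu> * 2 powr (\<rho> * N)" using N(2) by simp
        also have "\<dots> = Y (Suc \<nu>)" by (simp add: Y_def powr_add[symmetric] algebra_simps)
        finally show ?thesis .
      qed
      then have "emeasure lborel {x. \<bar>g x\<bar> > Y (Suc \<nu>)} \<le> emeasure lborel {x. \<bar>g x\<bar> > K * (Y \<nu> + z)}"
        by (intro emeasure_mono) auto
      ultimately show ?case by (rule order_trans[rotated])
    qed
    then show "emeasure lborel {x. \<bar>g x\<bar> > D * S * 2 powr H T0 * 2 powr (\<rho> * N * real \<nu>)} \<le> ennreal (2 powr (T0 - N * real \<nu>))"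
      unfolding Y_def .
  qed
qed

text \<open>The shape of the bounds for distribution functions: below the turning level
  \<open>Y\<close> the power from Chebyshev's inequality, above it the power from the
  iteration.\<close>

definition two_powers :: "real \<Rightarrow> real \<Rightarrow> real \<Rightarrow> real \<Rightarrow> real" where
  "two_powers Y u v y = (if y \<le> Y then (Y / y) powr u else (Y / y) powr v)"

text \<open>\<open>D\<close> and \<open>E\<close> have to be fixed before the function, the step and
  the scale are known; hence all of these are quantified inside.\<close>

definition distribution_constants ::
    "('n::finite \<Rightarrow> real) \<Rightarrow> ('n \<Rightarrow> nat) \<Rightarrow> real \<Rightarrow> real \<Rightarrow> real \<Rightarrow> real \<Rightarrow> real \<Rightarrow> real \<Rightarrow> bool" where
  "distribution_constants p m B \<sigma> \<sigma>' \<rho> D E \<longleftrightarrow> D > 0 \<and> E > 0 \<and>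
     (\<forall>g S H d T0 j y. scale_system p m B \<sigma> \<sigma>' g S H d \<longrightarrow> Lp_le (p j) g (B * S * 2 powr (H T0 + T0 / p j)) \<longrightarrow> y > 0 \<longrightarrow>
       emeasure lborel {x. \<bar>g x\<bar> > y} \<le> ennreal (E * 2 powr T0 * two_powers (D * S * 2 powr H T0) (p j) (1 / \<rho>) y))"

lemma distribution_constants_exist:
  fixes p :: "'n::finite \<Rightarrow> real" and m :: "'n \<Rightarrow> nat" and B \<rho> \<sigma> \<sigma>' :: real
  assumes p: "\<And>i. p i \<ge> 1" and "B > 0" "\<rho> > 0" "\<sigma> \<le> \<rho>" "\<sigma>' \<ge> 0"
  shows "\<exists>D E. distribution_constants p m B \<sigma> \<sigma>' \<rho> D E"
proof -
  obtain N D where N: "N > 0" and D: "D \<ge> B" and iter: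
    "\<And>(g :: real ^ 'n \<Rightarrow> real) S H d T0 j \<nu>. scale_system p m B \<sigma> \<sigma>' g S H d \<Longrightarrow>
       Lp_le (p j) g (B * S * 2 powr (H T0 + T0 / p j)) \<Longrightarrow>
       emeasure lborel {x. \<bar>g x\<bar> > D * S * 2 powr H T0 * 2 powr (\<rho> * N * real \<nu>)} \<le> ennreal (2 powr (T0 - N * real \<nu>))"
    by (rule level_iteration[of p B \<rho> \<sigma> \<sigma>' m, OF p assms(2-5)]) blast
  have D0: "D > 0" using D assms(2) by linarith
  define E where "E = 2 powr N"
  have E1: "E \<ge> 1" using N by (simp add: E_def ge_one_powr_ge_zero)
  have "emeasure lborel {x. \<bar>g x\<bar> > y} \<le> ennreal (E * 2 powr T0 * two_powers (D * S * 2 powr H T0) (p j) (1 / \<rho>) y)"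
    if sys: "scale_system p m B \<sigma> \<sigma>' g S H d" and gp: "Lp_le (p j) g (B * S * 2 powr (H T0 + T0 / p j))" and y: "y > 0"
    for g :: "real ^ 'n \<Rightarrow> real" and S H d T0 j y
  proof -
    note [measurable] = scale_systemD(1)[OF sys] and S = scale_systemD(2)[OF sys]
    define Y where "Y = D * S * 2 powr H T0"
    have Y0: "Y > 0" using D0 S by (simp add: Y_def)
    have "emeasure lborel {x. \<bar>g x\<bar> > y} \<le> ennreal (E * 2 powr T0 * (if y \<le> Y then (Y / y) powr p j else (Y / y) powr (1 / \<rho>)))"
    proof (cases "y \<le> Y")
      case True
      have "emeasure lborel {x. \<bar>g x\<bar> > y} \<le> ennreal ((B * S * 2 powr (H T0 + T0 / p j) / y) powr p j)"
        using p[of j] assms(2) S y by (intro Lp_le_Markov gp) auto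
      also have "\<dots> \<le> ennreal ((Y / y * 2 powr (T0 / p j)) powr p j)"
      proof (intro ennreal_leI powr_mono2)
        have "B * (S * 2 powr H T0 * 2 powr (T0 / p j)) \<le> D * (S * 2 powr H T0 * 2 powr (T0 / p j))"
          using D S by (intro mult_right_mono) auto
        then show "B * S * 2 powr (H T0 + T0 / p j) / y \<le> Y / y * 2 powr (T0 / p j)"
          using y by (simp add: Y_def powr_add divide_right_mono mult_ac)
      qed (use p[of j] y S assms(2) in auto)
      also have "(Y / y * 2 powr (T0 / p j)) powr p j = 1 * (2 powr T0 * (Y / y) powr p j)"
        unfolding powr_mult using p[of j] by (simp add: powr_powr)
      also have "ennreal \<dots> \<le> ennreal (E * (2 powr T0 * (Y / y) powr p j))"
        using E1 by (intro ennreal_leI mult_right_mono) auto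
      finally show ?thesis using True by (simp add: mult.assoc)
    next
      case False
      \<comment> \<open>The last iteration whose level does not exceed y. Rounding down costs at
        most a factor 2^N, which is \<open>E\<close>.\<close>
      define \<nu> where "\<nu> = nat \<lfloor>log 2 (y / Y) / (\<rho> * N)\<rfloor>"
      have yY: "y / Y > 1" using False Y0 by simp
      have l: "log 2 (y / Y) / (\<rho> * N) \<ge> 0" using yY assms(3) N by simp
      have \<nu>: "real \<nu> \<le> log 2 (y / Y) / (\<rho> * N)" "log 2 (y / Y) / (\<rho> * N) < real \<nu> + 1"
        unfolding \<nu>_def using l by (simp_all add: of_nat_nat)
      have "\<rho> * N * real \<nu> \<le> log 2 (y / Y)"
        using \<nu>(1) assms(3) N by (simp add: le_divide_eq mult.commute)
      then have "2 powr (\<rho> * N * real \<nu>) \<le> y / Y"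
        using yY by (simp add: le_log_iff)
      then have "Y * 2 powr (\<rho> * N * real \<nu>) \<le> y"
        using Y0 by (simp add: le_divide_eq mult.commute)
      then have "emeasure lborel {x. \<bar>g x\<bar> > y} \<le> emeasure lborel {x. \<bar>g x\<bar> > D * S * 2 powr H T0 * 2 powr (\<rho> * N * real \<nu>)}"
        unfolding Y_def by (intro emeasure_mono) auto
      also have "\<dots> \<le> ennreal (2 powr (T0 - N * real \<nu>))"
        by (rule iter[OF sys gp])
      also have "\<dots> \<le> ennreal (E * 2 powr T0 * (Y / y) powr (1 / \<rho>))"
      proof (intro ennreal_leI)
        have "log 2 (y / Y) / \<rho> < N * (real \<nu> + 1)"
          using \<nu>(2) assms(3) N by (simp add: field_simps)
        then have "2 powr (T0 - N * real \<nu>) \<le> 2 powr (N + T0 + - (log 2 (y / Y) / \<rho>))"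
          by (intro powr_mono) (auto simp: algebra_simps)
        also have "\<dots> = E * 2 powr T0 * 2 powr (- (log 2 (y / Y) / \<rho>))"
          by (simp only: powr_add E_def)
        also have "- (log 2 (y / Y) / \<rho>) = log 2 (Y / y) * (1 / \<rho>)"
          using y Y0 by (simp add: log_divide minus_divide_left)
        also have "2 powr (log 2 (Y / y) * (1 / \<rho>)) = (Y / y) powr (1 / \<rho>)"
          using y Y0 by (simp only: powr_powr[symmetric]) simp
        finally show "2 powr (T0 - N * real \<nu>) \<le> E * 2 powr T0 * (Y / y) powr (1 / \<rho>)" .
      qed
      finally show ?thesis using False by simp
    qed
    then show ?thesis unfolding Y_def two_powers_def .
  qed
  then show ?thesis
    unfolding distribution_constants_def using D0 E1 by (intro exI[of _ D] exI[of _ E]) force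
qed

section \<open>Lorentz norms and distribution functions\<close>

text \<open>Both inequalities are provided because the rearrangement will be squeezed between them;
  they differ only at the single point t = L.\<close>

lemma nn_integral_powr_less:
  fixes a :: real and L :: ennreal
  assumes "a > 0"
  shows "(\<integral>\<^sup>+t\<in>{0<..}. ennreal (t powr (a - 1)) * of_bool (ennreal t < L) \<partial>lborel) = ennreal (1 / a) * ennreal_powr L a"
    and "(\<integral>\<^sup>+t\<in>{0<..}. ennreal (t powr (a - 1)) * of_bool (ennreal t \<le> L) \<partial>lborel) = ennreal (1 / a) * ennreal_powr L a"
proof -
  have le: "(\<integral>\<^sup>+t\<in>{0<..}. ennreal (t powr (a - 1)) * of_bool (ennreal t \<le> L) \<partial>lborel) = ennreal (1 / a) * ennreal_powr L a"
  proof (cases L)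
    case (real l)
    have "(\<integral>\<^sup>+t\<in>{0<..}. ennreal (t powr (a - 1)) * of_bool (ennreal t \<le> L) \<partial>lborel)
       = (\<integral>\<^sup>+t\<in>{0..l}. ennreal (t powr (a - 1)) \<partial>lborel)"
      using AE_lborel_singleton[of 0]
      by (intro nn_integral_cong_AE, eventually_elim) (use real in \<open>auto simp: indicator_def\<close>)
    then show ?thesis using real assms
      by (simp add: nn_integral_powr_from_0 ennreal_powr_ennreal ennreal_mult[symmetric])
  next
    case top
    have "ennreal c \<le> (\<integral>\<^sup>+t\<in>{0<..}. ennreal (t powr (a - 1)) * of_bool (ennreal t \<le> L) \<partial>lborel)" if "c \<ge> 0" for c
    proof -
      define l where "l = (a * c) powr (1 / a)"
      have "ennreal c = ennreal (l powr a / a)" using that assms by (simp add: l_def powr_powr)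
      also have "\<dots> = (\<integral>\<^sup>+t\<in>{0..l}. ennreal (t powr (a - 1)) \<partial>lborel)"
        using assms by (intro nn_integral_powr_from_0[symmetric]) (auto simp: l_def)
      also have "\<dots> \<le> (\<integral>\<^sup>+t\<in>{0<..}. ennreal (t powr (a - 1)) * of_bool (ennreal t \<le> L) \<partial>lborel)"
        using AE_lborel_singleton[of 0]
        by (intro nn_integral_mono_AE, eventually_elim) (use top in \<open>auto simp: indicator_def\<close>)
      finally show ?thesis .
    qed
    note ge = this
    have "(\<integral>\<^sup>+t\<in>{0<..}. ennreal (t powr (a - 1)) * of_bool (ennreal t \<le> L) \<partial>lborel) = top" (is "?X = _")
    proof (cases ?X)
      case (real c)
      then have "ennreal (c + 1) \<le> ennreal c" using ge[of "c + 1"] by simp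
      then show ?thesis using real by simp
    qed
    then show ?thesis using top assms by (simp add: ennreal_mult_top)
  qed
  have "(\<integral>\<^sup>+t\<in>{0<..}. ennreal (t powr (a - 1)) * of_bool (ennreal t < L) \<partial>lborel)
     = (\<integral>\<^sup>+t\<in>{0<..}. ennreal (t powr (a - 1)) * of_bool (ennreal t \<le> L) \<partial>lborel)"
    using AE_lborel_singleton[of "enn2real L"]
    by (intro nn_integral_cong_AE, eventually_elim) (cases L, auto simp: indicator_def less_le)
  with le show "(\<integral>\<^sup>+t\<in>{0<..}. ennreal (t powr (a - 1)) * of_bool (ennreal t < L) \<partial>lborel) = ennreal (1 / a) * ennreal_powr L a"
    and "(\<integral>\<^sup>+t\<in>{0<..}. ennreal (t powr (a - 1)) * of_bool (ennreal t \<le> L) \<partial>lborel) = ennreal (1 / a) * ennreal_powr L a"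
    by auto
qed

lemma layer_cake:
  fixes g :: "'a::euclidean_space \<Rightarrow> real"
  assumes [measurable]: "g \<in> borel_measurable borel" and "q > 0"
  shows "(\<integral>\<^sup>+x. ennreal (\<bar>g x\<bar> powr q) \<partial>lborel)
     = ennreal q * (\<integral>\<^sup>+y\<in>{0<..}. ennreal (y powr (q - 1)) * emeasure lborel {x. \<bar>g x\<bar> > y} \<partial>lborel)"
proof -
  have "ennreal (\<bar>g x\<bar> powr q) = ennreal q * (\<integral>\<^sup>+y\<in>{0<..}. ennreal (y powr (q - 1)) * of_bool (y < \<bar>g x\<bar>) \<partial>lborel)" for x
  proof -
    have "(\<integral>\<^sup>+y\<in>{0<..}. ennreal (y powr (q - 1)) * of_bool (y < \<bar>g x\<bar>) \<partial>lborel)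
       = (\<integral>\<^sup>+y\<in>{0<..}. ennreal (y powr (q - 1)) * of_bool (ennreal y < ennreal \<bar>g x\<bar>) \<partial>lborel)"
      by (intro nn_integral_cong) (auto simp: indicator_def ennreal_less_iff)
    also have "\<dots> = ennreal (1 / q) * ennreal (\<bar>g x\<bar> powr q)"
      by (simp add: nn_integral_powr_less(1)[OF assms(2)] ennreal_powr_ennreal)
    finally show ?thesis using assms(2) by (simp add: ennreal_mult[symmetric])
  qed
  then have "(\<integral>\<^sup>+x. ennreal (\<bar>g x\<bar> powr q) \<partial>lborel)
     = (\<integral>\<^sup>+x. ennreal q * (\<integral>\<^sup>+y\<in>{0<..}. ennreal (y powr (q - 1)) * of_bool (y < \<bar>g x\<bar>) \<partial>lborel) \<partial>lborel)"
    by simp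
  also have "\<dots> = ennreal q * (\<integral>\<^sup>+x. \<integral>\<^sup>+y. ennreal (y powr (q - 1)) * of_bool (y < \<bar>g x\<bar>) * indicator {0<..} y \<partial>lborel \<partial>lborel)"
    by (intro nn_integral_cmult) measurable
  also have "(\<integral>\<^sup>+x. \<integral>\<^sup>+y. ennreal (y powr (q - 1)) * of_bool (y < \<bar>g x\<bar>) * indicator {0<..} y \<partial>lborel \<partial>lborel)
     = (\<integral>\<^sup>+y. \<integral>\<^sup>+x. ennreal (y powr (q - 1)) * of_bool (y < \<bar>g x\<bar>) * indicator {0<..} y \<partial>lborel \<partial>lborel)"
    by (rule lborel_pair.Fubini') measurable
  also have "\<dots> = (\<integral>\<^sup>+y\<in>{0<..}. ennreal (y powr (q - 1)) * emeasure lborel {x. \<bar>g x\<bar> > y} \<partial>lborel)"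
  proof (intro nn_integral_cong)
    fix y :: real
    have "(\<integral>\<^sup>+x. ennreal (y powr (q - 1)) * of_bool (y < \<bar>g x\<bar>) * indicator {0<..} y \<partial>lborel)
       = (\<integral>\<^sup>+x. (ennreal (y powr (q - 1)) * indicator {0<..} y) * indicator {x. \<bar>g x\<bar> > y} x \<partial>lborel)"
      by (intro nn_integral_cong) (simp add: indicator_def)
    also have "\<dots> = ennreal (y powr (q - 1)) * indicator {0<..} y * emeasure lborel {x. \<bar>g x\<bar> > y}"
      by (intro nn_integral_cmult_indicator) auto
    finally show "(\<integral>\<^sup>+x. ennreal (y powr (q - 1)) * of_bool (y < \<bar>g x\<bar>) * indicator {0<..} y \<partial>lborel)
       = ennreal (y powr (q - 1)) * emeasure lborel {x. \<bar>g x\<bar> > y} * indicator {0<..} y"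
      by (simp add: mult_ac)
  qed
  finally show ?thesis .
qed

text \<open>Nonatomicity of Lebesgue measure: the measure of the part of \<open>A\<close> inside a
  ball is continuous in the radius, so some ball cuts off measure exactly \<open>t\<close>.\<close>

lemma exists_subset_emeasure_eq:
  fixes A :: "'a::euclidean_space set"
  assumes A [measurable]: "A \<in> sets lebesgue" and "t \<ge> 0" and less: "ennreal t < emeasure lebesgue A"
  shows "\<exists>E\<in>sets lebesgue. E \<subseteq> A \<and> emeasure lebesgue E = ennreal t"
proof -
  define F where "F s = measure lebesgue (A \<inter> ball 0 s)" for s
  define c where "c = unit_ball_vol (real DIM('a))"
  have lm: "A \<inter> ball 0 s \<in> lmeasurable" for s
    by (rule fmeasurableI2[OF lmeasurable_ball[of 0 s]]) auto
  have em: "emeasure lebesgue (A \<inter> ball 0 s) = ennreal (F s)" for s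
    unfolding F_def using lm by (simp add: emeasure_eq_measure2)
  have "(\<lambda>n::nat. emeasure lebesgue (A \<inter> ball 0 (real n))) \<longlonglongrightarrow> emeasure lebesgue (\<Union>n::nat. A \<inter> ball 0 (real n))"
    by (intro Lim_emeasure_incseq) (auto simp: incseq_def)
  moreover have "(\<Union>n::nat. A \<inter> ball 0 (real n)) = A"
    using reals_Archimedean2 by auto
  ultimately have "eventually (\<lambda>n::nat. ennreal t < emeasure lebesgue (A \<inter> ball 0 (real n))) sequentially"
    using less by (simp add: order_tendstoD(1))
  then obtain N :: nat where "ennreal t < emeasure lebesgue (A \<inter> ball 0 (real N))"
    unfolding eventually_sequentially by auto
  then have tN: "t \<le> F (real N)" unfolding em using assms(2) by (simp add: ennreal_less_iff)
  \<comment> \<open>The increment is at most the volume of the shell between the two balls, which is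
    continuous in the radii.\<close>
  have incr: "\<bar>F s' - F s\<bar> \<le> \<bar>c * s' ^ DIM('a) - c * s ^ DIM('a)\<bar>" if "0 \<le> s" "s \<le> s'" for s s'
  proof -
    have "F s \<le> F s'" unfolding F_def using lm that by (intro measure_mono_fmeasurable) (auto intro: fmeasurableD)
    moreover have "F s' - F s = measure lebesgue ((A \<inter> ball 0 s') - (A \<inter> ball 0 s))"
      unfolding F_def using lm that by (intro measurable_measure_Diff[symmetric]) (auto intro: fmeasurableD)
    moreover have "\<dots> \<le> measure lebesgue (ball 0 s' - ball 0 s :: 'a set)"
      using lm that by (intro measure_mono_fmeasurable) (auto intro: fmeasurableD)
    moreover have "\<dots> = c * s' ^ DIM('a) - c * s ^ DIM('a)"
      using that by (subst measurable_measure_Diff) (auto simp: content_ball c_def intro: fmeasurableD)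
    ultimately show ?thesis by linarith
  qed
  have "continuous_on {0..real N} (\<lambda>s. c * s ^ DIM('a))" by (intro continuous_intros)
  moreover have "dist (F s') (F s) \<le> dist (c * s' ^ DIM('a)) (c * s ^ DIM('a))" if "s \<in> {0..real N}" "s' \<in> {0..real N}" for s s'
    using that incr[of s s'] incr[of s' s] by (cases "s \<le> s'") (auto simp: dist_real_def abs_minus_commute)
  ultimately have "continuous_on {0..real N} F"
    unfolding continuous_on_iff by (meson le_less_trans)
  then obtain s where "F s = t"
    using IVT'[of F 0 t "real N"] assms(2) tN by (auto simp: F_def)
  then show ?thesis
    using em[of s] lm[of s] by (intro bexI[of _ "A \<inter> ball 0 s"]) (auto intro: fmeasurableD)
qed

lemma level_set_lebesgue:
  fixes g :: "'a::euclidean_space \<Rightarrow> real"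
  assumes "g \<in> borel_measurable lebesgue"
  shows "{x. \<bar>g x\<bar> > y} \<in> sets lebesgue"
proof -
  have "(\<lambda>x. \<bar>g x\<bar>) \<in> borel_measurable lebesgue" using assms by measurable
  from measurable_sets[OF this, of "{y<..}"] show ?thesis by (simp add: vimage_def)
qed

text \<open>Only a weak inequality can be expected, since a set of measure \<open>t\<close> inside
  the level set may exhaust it.\<close>

lemma rearrangement_gtD:
  fixes g :: "real ^ 'n::finite \<Rightarrow> real"
  assumes [measurable]: "g \<in> borel_measurable lebesgue" and "ennreal y < rearrangement g t" "y \<ge> 0"
  shows "ennreal t \<le> emeasure lebesgue {x. \<bar>g x\<bar> > y}"
proof -
  obtain E where E: "E \<in> sets lebesgue" "emeasure lebesgue E = ennreal t" "ennreal y < (INF x\<in>E. ennreal \<bar>g x\<bar>)"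
    using assms(2) unfolding rearrangement_def less_SUP_iff by auto
  have "ennreal y < ennreal \<bar>g x\<bar>" if "x \<in> E" for x
    using E(3) INF_lower[OF that, of "\<lambda>x. ennreal \<bar>g x\<bar>"] by (rule less_le_trans)
  then have "E \<subseteq> {x. \<bar>g x\<bar> > y}"
    using assms(3) by (auto simp: ennreal_less_iff)
  then have "emeasure lebesgue E \<le> emeasure lebesgue {x. \<bar>g x\<bar> > y}"
    using level_set_lebesgue[OF assms(1)] by (intro emeasure_mono)
  then show ?thesis using E by simp
qed

text \<open>Strictness leaves room: the level set of some y + 1 / (n + 1) still has measure above
  \<open>t\<close>, and contains a set of measure exactly \<open>t\<close>.\<close>

lemma rearrangement_gtI:
  fixes g :: "real ^ 'n::finite \<Rightarrow> real"
  assumes [measurable]: "g \<in> borel_measurable lebesgue" and less: "ennreal t < emeasure lebesgue {x. \<bar>g x\<bar> > y}"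
    and "y \<ge> 0" "t > 0"
  shows "ennreal y < rearrangement g t"
proof -
  define A where "A n = {x. \<bar>g x\<bar> > y + 1 / real (Suc n)}" for n
  have [measurable]: "A n \<in> sets lebesgue" for n
    unfolding A_def by (rule level_set_lebesgue) fact
  have "incseq A"
    unfolding incseq_def A_def
    by (auto intro!: divide_left_mono elim!: le_less_trans[rotated])
  then have "(\<lambda>n. emeasure lebesgue (A n)) \<longlonglongrightarrow> emeasure lebesgue (\<Union>n. A n)"
    by (intro Lim_emeasure_incseq) auto
  moreover have "(\<Union>n. A n) = {x. \<bar>g x\<bar> > y}"
  proof (intro set_eqI iffI)
    fix x assume "x \<in> {x. \<bar>g x\<bar> > y}"
    then obtain n where "1 / real (Suc n) < \<bar>g x\<bar> - y"
      using nat_approx_posE[of "\<bar>g x\<bar> - y"] by auto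
    then have "x \<in> A n" by (simp add: A_def)
    then show "x \<in> (\<Union>n. A n)" by blast
  next
    fix x assume "x \<in> (\<Union>n. A n)"
    then obtain n where "x \<in> A n" by blast
    then have "y + 1 / real (Suc n) < \<bar>g x\<bar>" by (simp add: A_def)
    moreover have "1 / real (Suc n) > 0" by simp
    ultimately have "y < \<bar>g x\<bar>" by linarith
    then show "x \<in> {x. \<bar>g x\<bar> > y}" by simp
  qed
  ultimately have "eventually (\<lambda>n. ennreal t < emeasure lebesgue (A n)) sequentially"
    using less by (simp add: order_tendstoD(1))
  then obtain n where "ennreal t < emeasure lebesgue (A n)"
    unfolding eventually_sequentially by auto
  then obtain E where E: "E \<in> sets lebesgue" "E \<subseteq> A n" "emeasure lebesgue E = ennreal t"
    using exists_subset_emeasure_eq[of "A n" t] assms(4) by auto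
  have "ennreal y < ennreal (y + 1 / real (Suc n))"
    using assms(3) by (intro ennreal_lessI) (auto intro: add_nonneg_pos)
  also have "\<dots> \<le> (INF x\<in>E. ennreal \<bar>g x\<bar>)"
    using E(2) by (intro INF_greatest ennreal_leI) (auto simp: A_def)
  also have "\<dots> \<le> rearrangement g t"
    unfolding rearrangement_def using E by (intro SUP_upper) auto
  finally show ?thesis .
qed

lemma emeasure_level_AE_cong:
  fixes g g' :: "'a::euclidean_space \<Rightarrow> real"
  assumes "AE x in lebesgue. g x = g' x" "g \<in> borel_measurable lebesgue" "g' \<in> borel_measurable borel"
  shows "emeasure lebesgue {x. \<bar>g x\<bar> > y} = emeasure lborel {x. \<bar>g' x\<bar> > y}"
proof -
  have "emeasure lebesgue {x. \<bar>g x\<bar> > y} = (\<integral>\<^sup>+x. indicator {x. \<bar>g x\<bar> > y} x \<partial>lebesgue)"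
    by (rule nn_integral_indicator[symmetric]) (rule level_set_lebesgue[OF assms(2)])
  also have "\<dots> = (\<integral>\<^sup>+x. indicator {x. \<bar>g' x\<bar> > y} x \<partial>lebesgue)"
    by (intro nn_integral_cong_AE, use assms(1) in eventually_elim) (simp add: indicator_def)
  also have "\<dots> = (\<integral>\<^sup>+x. indicator {x. \<bar>g' x\<bar> > y} x \<partial>lborel)"
    by (rule nn_integral_completion)
  also have "\<dots> = emeasure lborel {x. \<bar>g' x\<bar> > y}"
    using assms(3) by simp
  finally show ?thesis .
qed

text \<open>Both sides measure the region under the graph of the rearrangement, sliced in t or in y.
  The slice at y contributes the integral of t^(1/q - 1) up to the measure of the level set. The
  Borel function \<open>g'\<close> supplies the joint measurability for Tonelli's theorem.\<close>

lemma lorentz_norm_eq: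
  fixes g g' :: "real ^ 'n::finite \<Rightarrow> real"
  assumes AE: "AE x in lebesgue. g x = g' x" and g: "g \<in> borel_measurable lebesgue"
    and g' [measurable]: "g' \<in> borel_measurable borel" and "q > 0"
  shows "lorentz_norm q 1 g = ennreal q * (\<integral>\<^sup>+y\<in>{0<..}. ennreal_powr (emeasure lborel {x. \<bar>g' x\<bar> > y}) (1 / q) \<partial>lborel)"
proof -
  define \<Lambda> where "\<Lambda> y = emeasure lborel {x. \<bar>g' x\<bar> > y}" for y
  have \<Lambda>eq: "\<Lambda> y = (\<integral>\<^sup>+x. of_bool (\<bar>g' x\<bar> > y) \<partial>lborel)" for y
  proof -
    have "\<Lambda> y = (\<integral>\<^sup>+x. indicator {x. \<bar>g' x\<bar> > y} x \<partial>lborel)" by (simp add: \<Lambda>_def)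
    then show ?thesis by (simp add: indicator_def)
  qed
  have [measurable]: "\<Lambda> \<in> borel_measurable borel" unfolding \<Lambda>eq by measurable
  define w where "w t = ennreal (t powr (1 / q - 1)) * indicator {0<..} t" for t :: real
  have [measurable]: "w \<in> borel_measurable borel" unfolding w_def by measurable
  have lor: "lorentz_norm q 1 g = (\<integral>\<^sup>+t. w t * rearrangement g t \<partial>lborel)"
    unfolding lorentz_norm_def nn_integral_completion ennreal_powr_one div_by_1
  proof (intro nn_integral_cong)
    fix t :: real
    show "ennreal (t powr (1 / q)) * rearrangement g t / ennreal t * indicator {0<..} t = w t * rearrangement g t"
    proof (cases "t > 0")
      case True
      have "ennreal (t powr (1 / q)) * rearrangement g t / ennreal t
         = (ennreal (t powr (1 / q)) * ennreal (1 / t)) * rearrangement g t"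
        using True by (simp add: divide_ennreal_def inverse_ennreal inverse_eq_divide mult_ac)
      also have "ennreal (t powr (1 / q)) * ennreal (1 / t) = w t"
        using True by (simp add: w_def ennreal_mult[symmetric] powr_diff)
      finally show ?thesis using True by simp
    qed (simp add: w_def)
  qed
  have val: "r = (\<integral>\<^sup>+y\<in>{0<..}. of_bool (ennreal y < r) \<partial>lborel)" for r
  proof -
    have "r = (\<integral>\<^sup>+y\<in>{0<..}. ennreal (y powr (1 - 1)) * of_bool (ennreal y < r) \<partial>lborel)"
      using nn_integral_powr_less(1)[of 1 r] by simp
    also have "\<dots> = (\<integral>\<^sup>+y\<in>{0<..}. of_bool (ennreal y < r) \<partial>lborel)"
      by (intro nn_integral_cong) (auto simp: indicator_def)
    finally show ?thesis .
  qed
  define X where "X = ennreal q * (\<integral>\<^sup>+y\<in>{0<..}. ennreal_powr (\<Lambda> y) (1 / q) \<partial>lborel)"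
  \<comment> \<open>Proved once for a relation \<open>rel\<close>, to be taken as < for the lower
    bound and as \<le> for the upper bound of the norm.\<close>
  have swap: "(\<integral>\<^sup>+t. w t * (\<integral>\<^sup>+y\<in>{0<..}. of_bool (rel (ennreal t) (\<Lambda> y)) \<partial>lborel) \<partial>lborel) = X"
    if rel [measurable]: "(\<lambda>z. of_bool (rel (ennreal (fst z)) (\<Lambda> (snd z))) :: ennreal) \<in> borel_measurable (borel \<Otimes>\<^sub>M borel)"
      and val: "\<And>y. (\<integral>\<^sup>+t\<in>{0<..}. ennreal (t powr (1 / q - 1)) * of_bool (rel (ennreal t) (\<Lambda> y)) \<partial>lborel)
        = ennreal (1 / (1 / q)) * ennreal_powr (\<Lambda> y) (1 / q)" for rel :: "ennreal \<Rightarrow> ennreal \<Rightarrow> bool"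
  proof -
    have [measurable]: "(\<lambda>z. of_bool (rel (ennreal (snd z)) (\<Lambda> (fst z))) :: ennreal) \<in> borel_measurable (borel \<Otimes>\<^sub>M borel)"
      using measurable_compose[OF measurable_pair_swap' rel] by (simp add: split_beta')
    have [measurable]: "(\<lambda>y. of_bool (rel (ennreal t) (\<Lambda> y)) :: ennreal) \<in> borel_measurable borel" for t
      using measurable_compose[OF measurable_Pair1'[of t borel borel] rel] by simp
    have [measurable]: "(\<lambda>t. of_bool (rel (ennreal t) (\<Lambda> y)) :: ennreal) \<in> borel_measurable borel" for y
      using measurable_compose[OF measurable_Pair2'[of y borel borel] rel] by simp
    have "(\<integral>\<^sup>+t. w t * (\<integral>\<^sup>+y\<in>{0<..}. of_bool (rel (ennreal t) (\<Lambda> y)) \<partial>lborel) \<partial>lborel)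
       = (\<integral>\<^sup>+t. \<integral>\<^sup>+y. w t * (of_bool (rel (ennreal t) (\<Lambda> y)) * indicator {0<..} y) \<partial>lborel \<partial>lborel)"
      by (intro nn_integral_cong nn_integral_cmult[symmetric]) measurable
    also have "\<dots> = (\<integral>\<^sup>+y. \<integral>\<^sup>+t. w t * (of_bool (rel (ennreal t) (\<Lambda> y)) * indicator {0<..} y) \<partial>lborel \<partial>lborel)"
      by (rule lborel_pair.Fubini') measurable
    also have "\<dots> = (\<integral>\<^sup>+y. ennreal q * (ennreal_powr (\<Lambda> y) (1 / q) * indicator {0<..} y) \<partial>lborel)"
    proof (intro nn_integral_cong)
      fix y :: real
      have "(\<integral>\<^sup>+t. w t * (of_bool (rel (ennreal t) (\<Lambda> y)) * indicator {0<..} y) \<partial>lborel)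
         = (\<integral>\<^sup>+t. (w t * of_bool (rel (ennreal t) (\<Lambda> y))) * indicator {0<..} y \<partial>lborel)"
        by (simp only: mult.assoc)
      also have "\<dots> = (\<integral>\<^sup>+t. w t * of_bool (rel (ennreal t) (\<Lambda> y)) \<partial>lborel) * indicator {0<..} y"
        by (rule nn_integral_multc) measurable
      also have "(\<integral>\<^sup>+t. w t * of_bool (rel (ennreal t) (\<Lambda> y)) \<partial>lborel)
         = (\<integral>\<^sup>+t\<in>{0<..}. ennreal (t powr (1 / q - 1)) * of_bool (rel (ennreal t) (\<Lambda> y)) \<partial>lborel)"
        by (intro nn_integral_cong) (simp add: w_def mult_ac)
      also have "\<dots> = ennreal q * ennreal_powr (\<Lambda> y) (1 / q)"
        using val[of y] assms(4) by simp
      finally show "(\<integral>\<^sup>+t. w t * (of_bool (rel (ennreal t) (\<Lambda> y)) * indicator {0<..} y) \<partial>lborel)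
         = ennreal q * (ennreal_powr (\<Lambda> y) (1 / q) * indicator {0<..} y)"
        by (simp only: mult.assoc)
    qed
    also have "\<dots> = X" unfolding X_def by (intro nn_integral_cmult) measurable
    finally show ?thesis .
  qed
  have X1: "(\<integral>\<^sup>+t. w t * (\<integral>\<^sup>+y\<in>{0<..}. of_bool (ennreal t < \<Lambda> y) \<partial>lborel) \<partial>lborel) = X"
    using assms(4) by (intro swap nn_integral_powr_less) measurable
  have X2: "(\<integral>\<^sup>+t. w t * (\<integral>\<^sup>+y\<in>{0<..}. of_bool (ennreal t \<le> \<Lambda> y) \<partial>lborel) \<partial>lborel) = X"
    using assms(4) by (intro swap nn_integral_powr_less) measurable
  \<comment> \<open>The definition of \<open>rearrangement\<close> does not decide directly whether \<open>g\<^sup>*(t) > y\<close> when \<open>t = \<Lambda> y\<close>, but these \<open>t\<close> do not matter.\<close>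
  have lev: "emeasure lebesgue {x. \<bar>g x\<bar> > y} = \<Lambda> y" for y
    unfolding \<Lambda>_def by (rule emeasure_level_AE_cong[OF AE g g'])
  have "lorentz_norm q 1 g \<le> X"
    unfolding lor X2[symmetric]
  proof (intro nn_integral_mono)
    fix t :: real
    show "w t * rearrangement g t \<le> w t * (\<integral>\<^sup>+y\<in>{0<..}. of_bool (ennreal t \<le> \<Lambda> y) \<partial>lborel)"
    proof (subst val[of "rearrangement g t"], intro mult_left_mono nn_integral_mono)
      fix y :: real
      show "of_bool (ennreal y < rearrangement g t) * indicator {0<..} y \<le> (of_bool (ennreal t \<le> \<Lambda> y) * indicator {0<..} y :: ennreal)"
        using rearrangement_gtD[OF g, of y t] lev by (auto simp: indicator_def)
    qed auto
  qed
  moreover have "X \<le> lorentz_norm q 1 g"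
    unfolding lor X1[symmetric]
  proof (intro nn_integral_mono)
    fix t :: real
    show "w t * (\<integral>\<^sup>+y\<in>{0<..}. of_bool (ennreal t < \<Lambda> y) \<partial>lborel) \<le> w t * rearrangement g t"
    proof (cases "t > 0")
      case True
      show ?thesis
      proof (subst val[of "rearrangement g t"], intro mult_left_mono nn_integral_mono)
        fix y :: real
        show "of_bool (ennreal t < \<Lambda> y) * indicator {0<..} y \<le> (of_bool (ennreal y < rearrangement g t) * indicator {0<..} y :: ennreal)"
          using rearrangement_gtI[OF g, of t y] lev True by (auto simp: indicator_def)
      qed auto
    qed (simp add: w_def)
  qed
  ultimately show ?thesis unfolding X_def \<Lambda>_def by (rule antisym)
qed

lemma borel_measurable_two_powers [measurable]: "two_powers Y u v \<in> borel_measurable borel"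
  unfolding two_powers_def[abs_def] by measurable

text \<open>The first power makes the integral converge at 0 because u < a, the second at infinity
  because a < v.\<close>

lemma nn_integral_two_powers:
  fixes a u v Y :: real
  assumes "u < a" "a < v" "Y > 0"
  shows "(\<integral>\<^sup>+y\<in>{0<..}. ennreal (y powr (a - 1) * two_powers Y u v y) \<partial>lborel)
     \<le> ennreal ((1 / (a - u) + 1 / (v - a)) * Y powr a)"
proof -
  have "(\<integral>\<^sup>+y\<in>{0<..}. ennreal (y powr (a - 1) * two_powers Y u v y) \<partial>lborel)
     \<le> (\<integral>\<^sup>+y. ennreal (Y powr u) * (ennreal (y powr ((a - u) - 1)) * indicator {0..Y} y)
          + ennreal (Y powr v) * (ennreal (y powr (- (v - a) - 1)) * indicator {Y..} y) \<partial>lborel)"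
  proof (intro nn_integral_mono)
    fix y :: real
    have e: "y powr (a - 1) * (Y / y) powr c = Y powr c * y powr (a - c - 1)" if "y > 0" for c
      using that assms(3) by (simp add: powr_divide powr_diff mult_ac)
    show "ennreal (y powr (a - 1) * two_powers Y u v y) * indicator {0<..} y
       \<le> ennreal (Y powr u) * (ennreal (y powr ((a - u) - 1)) * indicator {0..Y} y)
          + ennreal (Y powr v) * (ennreal (y powr (- (v - a) - 1)) * indicator {Y..} y)"
      by (cases "y > 0"; cases "y \<le> Y") (simp_all add: e ennreal_mult two_powers_def)
  qed
  also have "\<dots> = ennreal (Y powr u) * ennreal (Y powr (a - u) / (a - u)) + ennreal (Y powr v) * ennreal (Y powr (- (v - a)) / (v - a))"
    using assms nn_integral_powr_from_0[of "a - u" Y] nn_integral_powr_to_inf[of "v - a" Y]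
    by (simp add: nn_integral_add nn_integral_cmult)
  also have "\<dots> = ennreal (Y powr u * (Y powr (a - u) / (a - u)) + Y powr v * (Y powr (- (v - a)) / (v - a)))"
    using assms by (simp add: ennreal_mult[symmetric] ennreal_plus[symmetric] del: ennreal_plus)
  also have "Y powr u * (Y powr (a - u) / (a - u)) + Y powr v * (Y powr (- (v - a)) / (v - a)) = (1 / (a - u) + 1 / (v - a)) * Y powr a"
    by (simp add: powr_add[symmetric] distrib_right)
  finally show ?thesis by simp
qed

text \<open>The layer-cake formula needs exponents on both sides of q. The Lorentz norm involves the
  power 1/q of the distribution function, whose exponents p/q < 1 < v/q lie on both sides of 1. Up
  to constants both norms are those of height \<open>Y\<close> on a set of measure \<tau>.\<close>

lemma norms_of_distribution_bound:
  fixes g :: "real ^ 'n::finite \<Rightarrow> real"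
  assumes [measurable]: "g \<in> borel_measurable borel"
    and "1 \<le> p" "p < q" "q < v" "E > 0" "\<tau> > 0" "Y > 0"
    and bd: "\<And>y. y > 0 \<Longrightarrow> emeasure lborel {x. \<bar>g x\<bar> > y} \<le> ennreal (E * \<tau> * two_powers Y p v y)"
  shows "Lp_le q g ((q * E * (1 / (q - p) + 1 / (v - q))) powr (1 / q) * \<tau> powr (1 / q) * Y)"
    and "lorentz_norm q 1 g \<le> ennreal (q * E powr (1 / q) * (1 / (1 - p / q) + 1 / (v / q - 1)) * \<tau> powr (1 / q) * Y)"
proof -
  have q: "q > 0" using assms by linarith
  let ?b = "two_powers Y"
  have b0: "?b u v y \<ge> 0" for u v y by (simp add: two_powers_def)
  have "(\<integral>\<^sup>+x. ennreal (\<bar>g x\<bar> powr q) \<partial>lborel)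
     = ennreal q * (\<integral>\<^sup>+y\<in>{0<..}. ennreal (y powr (q - 1)) * emeasure lborel {x. \<bar>g x\<bar> > y} \<partial>lborel)"
    using q by (intro layer_cake) auto
  also have "\<dots> \<le> ennreal q * (\<integral>\<^sup>+y. ennreal (E * \<tau>) * (ennreal (y powr (q - 1) * ?b p v y) * indicator {0<..} y) \<partial>lborel)"
  proof (intro mult_left_mono nn_integral_mono)
    fix y :: real
    show "ennreal (y powr (q - 1)) * emeasure lborel {x. \<bar>g x\<bar> > y} * indicator {0<..} y
       \<le> ennreal (E * \<tau>) * (ennreal (y powr (q - 1) * ?b p v y) * indicator {0<..} y)"
    proof (cases "y > 0")
      case True
      have "ennreal (y powr (q - 1)) * emeasure lborel {x. \<bar>g x\<bar> > y} \<le> ennreal (y powr (q - 1)) * ennreal (E * \<tau> * ?b p v y)"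
        by (intro mult_left_mono bd[OF True]) simp
      also have "\<dots> = ennreal (y powr (q - 1) * (E * \<tau> * ?b p v y))"
        using assms b0[of p v y] by (intro ennreal_mult[symmetric]) auto
      also have "y powr (q - 1) * (E * \<tau> * ?b p v y) = E * \<tau> * (y powr (q - 1) * ?b p v y)" by (simp add: mult_ac)
      also have "ennreal \<dots> = ennreal (E * \<tau>) * ennreal (y powr (q - 1) * ?b p v y)"
        using assms b0[of p v y] by (intro ennreal_mult) auto
      finally show ?thesis using True by simp
    qed simp
  qed simp
  also have "\<dots> = ennreal q * (ennreal (E * \<tau>) * (\<integral>\<^sup>+y\<in>{0<..}. ennreal (y powr (q - 1) * ?b p v y) \<partial>lborel))"
    by (subst nn_integral_cmult) simp_all
  also have "\<dots> \<le> ennreal q * (ennreal (E * \<tau>) * ennreal ((1 / (q - p) + 1 / (v - q)) * Y powr q))"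
    using assms by (intro mult_left_mono nn_integral_two_powers) auto
  also have "\<dots> = ennreal (q * (E * \<tau> * ((1 / (q - p) + 1 / (v - q)) * Y powr q)))"
    using assms q by (simp add: ennreal_mult)
  also have "q * (E * \<tau> * ((1 / (q - p) + 1 / (v - q)) * Y powr q)) = ((q * E * (1 / (q - p) + 1 / (v - q))) powr (1 / q) * \<tau> powr (1 / q) * Y) powr q"
  proof -
    have "q * E * (1 / (q - p) + 1 / (v - q)) \<ge> 0" using assms q by (intro mult_nonneg_nonneg add_nonneg_nonneg) auto
    then have "((q * E * (1 / (q - p) + 1 / (v - q))) powr (1 / q)) powr q = q * E * (1 / (q - p) + 1 / (v - q))"
      using q by (simp add: powr_powr)
    then show ?thesis using assms q by (simp only: powr_mult powr_powr) (simp add: mult_ac)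
  qed
  finally show "Lp_le q g ((q * E * (1 / (q - p) + 1 / (v - q))) powr (1 / q) * \<tau> powr (1 / q) * Y)"
    unfolding Lp_le_def .
  have "lorentz_norm q 1 g = ennreal q * (\<integral>\<^sup>+y\<in>{0<..}. ennreal_powr (emeasure lborel {x. \<bar>g x\<bar> > y}) (1 / q) \<partial>lborel)"
    using q by (intro lorentz_norm_eq) (auto intro: measurable_completion)
  also have "\<dots> \<le> ennreal q * (\<integral>\<^sup>+y. ennreal ((E * \<tau>) powr (1 / q)) * (ennreal (y powr (1 - 1) * ?b (p / q) (v / q) y) * indicator {0<..} y) \<partial>lborel)"
  proof (intro mult_left_mono nn_integral_mono)
    fix y :: real
    show "ennreal_powr (emeasure lborel {x. \<bar>g x\<bar> > y}) (1 / q) * indicator {0<..} y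
       \<le> ennreal ((E * \<tau>) powr (1 / q)) * (ennreal (y powr (1 - 1) * ?b (p / q) (v / q) y) * indicator {0<..} y)"
    proof (cases "y > 0")
      case True
      have "ennreal_powr (emeasure lborel {x. \<bar>g x\<bar> > y}) (1 / q) \<le> ennreal_powr (ennreal (E * \<tau> * ?b p v y)) (1 / q)"
        using q by (intro ennreal_powr_mono bd[OF True]) simp
      also have "\<dots> = ennreal ((E * \<tau> * ?b p v y) powr (1 / q))"
        using assms b0[of p v y] by (intro ennreal_powr_ennreal) auto
      also have "(E * \<tau> * ?b p v y) powr (1 / q) = (E * \<tau>) powr (1 / q) * ?b (p / q) (v / q) y"
        by (simp add: powr_mult powr_powr two_powers_def)
      also have "ennreal \<dots> = ennreal ((E * \<tau>) powr (1 / q)) * ennreal (?b (p / q) (v / q) y)"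
        using b0 by (intro ennreal_mult) auto
      finally show ?thesis using True by simp
    qed simp
  qed simp
  also have "\<dots> = ennreal q * (ennreal ((E * \<tau>) powr (1 / q)) * (\<integral>\<^sup>+y\<in>{0<..}. ennreal (y powr (1 - 1) * ?b (p / q) (v / q) y) \<partial>lborel))"
    by (subst nn_integral_cmult) simp_all
  also have "\<dots> \<le> ennreal q * (ennreal ((E * \<tau>) powr (1 / q)) * ennreal ((1 / (1 - p / q) + 1 / (v / q - 1)) * Y powr 1))"
    using assms q by (intro mult_left_mono nn_integral_two_powers) auto
  also have "\<dots> = ennreal (q * ((E * \<tau>) powr (1 / q) * ((1 / (1 - p / q) + 1 / (v / q - 1)) * Y powr 1)))"
  proof -
    have "1 / (1 - p / q) + 1 / (v / q - 1) \<ge> 0" using assms q by (intro add_nonneg_nonneg) auto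
    then show ?thesis using assms q by (simp add: ennreal_mult)
  qed
  also have "q * ((E * \<tau>) powr (1 / q) * ((1 / (1 - p / q) + 1 / (v / q - 1)) * Y powr 1)) = q * E powr (1 / q) * (1 / (1 - p / q) + 1 / (v / q - 1)) * \<tau> powr (1 / q) * Y"
    using assms by (simp add: powr_mult mult_ac)
  finally show "lorentz_norm q 1 g \<le> ennreal (q * E powr (1 / q) * (1 / (1 - p / q) + 1 / (v / q - 1)) * \<tau> powr (1 / q) * Y)" .
qed

section \<open>Weights and orders of differences\<close>

text \<open>Transfers a bound \<open>A\<close> from order \<open>K\<close> to order \<open>l\<close>
  in either direction, with \<open>C\<close> uniform in f, p and A. The doubling condition on
  \<open>A\<close> is what lets Marchaud's series converge.\<close>

definition order_constant :: "nat \<Rightarrow> nat \<Rightarrow> real \<Rightarrow> 'n::finite \<Rightarrow> real \<Rightarrow> bool" where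
  "order_constant K l \<rho> j C \<longleftrightarrow> C > 0 \<and> (\<forall>(f :: real ^ 'n \<Rightarrow> real) p A. f \<in> borel_measurable borel \<longrightarrow>
      finite_levels f \<longrightarrow> p \<ge> 1 \<longrightarrow> (\<forall>h>0. A h \<ge> 0 \<and> A (2 * h) \<le> \<rho> * A h) \<longrightarrow>
      (\<forall>h>0. Lp_le p (partial_diff K j h f) (A h)) \<longrightarrow> (\<forall>h>0. Lp_le p (partial_diff l j h f) (C * A h)))"

lemma order_constantD:
  assumes "order_constant K l \<rho> j C"
  shows "C > 0"
    "f \<in> borel_measurable borel \<Longrightarrow> finite_levels f \<Longrightarrow> p \<ge> 1 \<Longrightarrow> \<forall>h>0. A h \<ge> 0 \<and> A (2 * h) \<le> \<rho> * A h \<Longrightarrow>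
      \<forall>h>0. Lp_le p (partial_diff K j h f) (A h) \<Longrightarrow> h > 0 \<Longrightarrow> Lp_le p (partial_diff l j h f) (C * A h)"
proof -
  show "C > 0" using assms by (simp add: order_constant_def)
  note inst = assms[unfolded order_constant_def, THEN conjunct2, THEN spec[of _ f], THEN spec[of _ p], THEN spec[of _ A]]
  show "Lp_le p (partial_diff l j h f) (C * A h)"
    if "f \<in> borel_measurable borel" "finite_levels f" "p \<ge> 1" "\<forall>h>0. A h \<ge> 0 \<and> A (2 * h) \<le> \<rho> * A h"
      "\<forall>h>0. Lp_le p (partial_diff K j h f) (A h)" "h > 0"
    by (rule inst[THEN mp, THEN mp, THEN mp, THEN mp, THEN mp, THEN spec, THEN mp, OF that])
qed

text \<open>If K \<le> l the order is raised directly. Otherwise it is lowered one unit at a time,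
  and \<rho> < 2^l \<le> 2^i covers every intermediate order i \<ge> l.\<close>

lemma order_constant_exists:
  fixes j :: "'n::finite"
  assumes "1 \<le> l" "0 < \<rho>" "\<rho> < 2 ^ l"
  shows "\<exists>C. order_constant K l \<rho> j C"
proof (cases "K \<le> l")
  case True
  have "order_constant K l \<rho> j (2 ^ l * real (Suc l) ^ 2)"
    unfolding order_constant_def
  proof (intro conjI allI impI)
    fix f :: "real ^ 'n \<Rightarrow> real" and p A and h :: real
    assume "f \<in> borel_measurable borel" "p \<ge> 1" "\<forall>h>0. A h \<ge> 0 \<and> A (2 * h) \<le> \<rho> * A h"
      "\<forall>h>0. Lp_le p (partial_diff K j h f) (A h)" "h > 0"
    then show "Lp_le p (partial_diff l j h f) (2 ^ l * real (Suc l) ^ 2 * A h)"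
      using True by (intro Lp_le_partial_diff_order[where m=K]) auto
  qed simp
  then show ?thesis by blast
next
  case False
  define c where "c i = (1 / (1 - sqrt (\<rho> / 2 ^ i))) ^ 2 * real i ^ 2" for i :: nat
  have c0: "c i > 0" if "l \<le> i" for i
  proof -
    have "\<rho> < 2 ^ i" using assms(3) power_increasing[OF that, of "2::real"] by linarith
    then have "sqrt (\<rho> / 2 ^ i) < 1" using assms(2) by (simp add: real_sqrt_lt_1_iff)
    then show ?thesis using assms(1) that by (simp add: c_def)
  qed
  have "\<exists>C. order_constant (l + N) l \<rho> j C" for N
  proof (induction N)
    case 0
    have "order_constant (l + 0) l \<rho> j 1" unfolding order_constant_def by simp
    then show ?case by blast
  next
    case (Suc N)
    then obtain C where C: "order_constant (l + N) l \<rho> j C" by blast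
    have "order_constant (l + Suc N) l \<rho> j (C * c (l + N))"
      unfolding order_constant_def
    proof (intro conjI allI impI)
      show "C * c (l + N) > 0" using order_constantD(1)[OF C] c0 by simp
      fix f :: "real ^ 'n \<Rightarrow> real" and p A and h :: real
      assume f: "f \<in> borel_measurable borel" "finite_levels f" "p \<ge> 1"
        and A: "\<forall>h>0. A h \<ge> 0 \<and> A (2 * h) \<le> \<rho> * A h"
        and D: "\<forall>h>0. Lp_le p (partial_diff (l + Suc N) j h f) (A h)" and h: "h > 0"
      have "Lp_le p (partial_diff l j h f) (C * (c (l + N) * A h))"
      proof -
        have 1: "\<forall>h>0. 0 \<le> c (l + N) * A h \<and> c (l + N) * A (2 * h) \<le> \<rho> * (c (l + N) * A h)"
        proof (intro allI impI)
          fix h :: real assume "h > 0"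
          then have "0 \<le> A h" "A (2 * h) \<le> \<rho> * A h" using A by auto
          then show "0 \<le> c (l + N) * A h \<and> c (l + N) * A (2 * h) \<le> \<rho> * (c (l + N) * A h)"
            using c0[of "l + N"] mult_left_mono[of "A (2 * h)" "\<rho> * A h" "c (l + N)"] by (simp add: mult_ac)
        qed
        have 2: "\<forall>h>0. Lp_le p (partial_diff (l + N) j h f) (c (l + N) * A h)"
        proof (intro allI impI)
          fix h :: real assume h: "h > 0"
          have Ai: "A (2 ^ i * h) \<le> \<rho> ^ i * A h \<and> 0 \<le> A (2 ^ i * h)" for i
          proof (induction i)
            case (Suc i)
            have "A (2 * (2 ^ i * h)) \<le> \<rho> * A (2 ^ i * h)" "0 \<le> A (2 * (2 ^ i * h))"
              using A h by auto
            moreover have "\<rho> * A (2 ^ i * h) \<le> \<rho> * (\<rho> ^ i * A h)" using Suc assms(2) by (intro mult_left_mono) auto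
            ultimately show ?case by (simp add: mult.assoc)
          qed (use A h in auto)
          show "Lp_le p (partial_diff (l + N) j h f) (c (l + N) * A h)"
            unfolding c_def
          proof (rule Lp_le_Marchaud[where \<rho>=\<rho>])
            show "\<rho> < 2 ^ (l + N)" using assms(3) power_increasing[of l "l + N" "2::real"] by linarith
            show "Lp_le p (partial_diff (Suc (l + N)) j (2 ^ i * h) f) (\<rho> ^ i * A h)" for i
            proof (rule Lp_le_mono[of _ _ "A (2 ^ i * h)"])
              have "2 ^ i * h > 0" using h by simp
              then show "Lp_le p (partial_diff (Suc (l + N)) j (2 ^ i * h) f) (A (2 ^ i * h))"
                using D by simp
            qed (use Ai[of i] f(3) in auto)
          qed (use f A h assms in auto)
        qed
        show ?thesis by (rule order_constantD(2)[OF C f 1 2 h])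
      qed
      then show "Lp_le p (partial_diff l j h f) (C * c (l + N) * A h)" by (simp add: mult.assoc)
    qed
    then show ?case by blast
  qed
  from this[of "K - l"] show ?thesis using False by simp
qed

text \<open>The weight \<^term>\<open>e\<close> is $h^{-r} \|\Delta_j^m(h) f\|_p / S$ at $h = 2^x$, smoothed so that
  $\log_2 e$ is $s$-Lipschitz; the last clause is its membership in $L^\theta(dh/h)$, stated in a form
  that is stable under expanding reparametrizations.\<close>

definition Besov_envelope ::
    "real \<Rightarrow> real \<Rightarrow> nat \<Rightarrow> real \<Rightarrow> ennreal \<Rightarrow> real \<Rightarrow> 'n::finite \<Rightarrow> (real ^ 'n \<Rightarrow> real) \<Rightarrow> real \<Rightarrow> (real \<Rightarrow> real) \<Rightarrow> bool" where
  "Besov_envelope r p m s \<theta> C j f S e \<longleftrightarrow>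
     (\<forall>x. 0 < e x \<and> e x \<le> 2) \<and> (\<forall>x y. e x \<le> 2 powr (s * \<bar>x - y\<bar>) * e y)
     \<and> e \<in> borel_measurable borel
     \<and> (\<forall>x. Lp_le p (partial_diff m j (2 powr x) f) (C * S * 2 powr (r * x) * e x))
     \<and> (\<theta> = top \<longrightarrow> (\<forall>x. e x = 1))
     \<and> (\<forall>\<delta> \<phi>. \<theta> \<noteq> top \<longrightarrow> \<delta> > 0 \<longrightarrow> \<phi> \<in> borel_measurable borel \<longrightarrow> (\<forall>y. \<exists>x0. \<forall>x. \<delta> * \<bar>x - x0\<bar> \<le> \<bar>\<phi> x - y\<bar>)
          \<longrightarrow> (\<integral>\<^sup>+h\<in>{0<..}. ennreal (e (\<phi> (log 2 h)) powr enn2real \<theta> / h) \<partial>lborel) \<le> ennreal (4 / (s * enn2real \<theta> * \<delta>)))"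

lemma ennreal_ge_1_cases:
  fixes \<theta> :: ennreal
  assumes "\<theta> \<ge> 1" "\<theta> \<noteq> top"
  shows "\<theta> = ennreal (enn2real \<theta>)" "enn2real \<theta> \<ge> 1"
proof -
  show th: "\<theta> = ennreal (enn2real \<theta>)" using assms(2) by (simp add: less_top)
  show "enn2real \<theta> \<ge> 1"
  proof (rule ccontr)
    assume "\<not> enn2real \<theta> \<ge> 1"
    then have "ennreal (enn2real \<theta>) < ennreal 1" by (intro ennreal_lessI) auto
    then show False using assms(1) th by simp
  qed
qed

text \<open>For infinite \<theta> the weight is the constant 1, so that the direction will drop out
  of the product of weights.\<close>

lemma Besov_regularize:
  fixes \<theta> :: ennreal
  assumes "r > 0" "p \<ge> 1" "m \<ge> 1" "s > 0" "\<theta> \<ge> 1"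
  shows "\<exists>C>0. \<forall>(f :: real ^ 'n::finite \<Rightarrow> real) j S. f \<in> borel_measurable borel \<longrightarrow> S > 0 \<longrightarrow>
       besov_partial_seminorm m r p \<theta> j f \<le> ennreal S \<longrightarrow> (\<exists>e. Besov_envelope r p m s \<theta> C j f S e)"
proof (cases "\<theta> = top")
  case True
  obtain C where C: "C > 0"
    "\<And>(f :: real ^ 'n \<Rightarrow> real) j S x. f \<in> borel_measurable borel \<Longrightarrow> S > 0 \<Longrightarrow> besov_partial_seminorm m r p top j f \<le> ennreal S \<Longrightarrow>
       Lp_le p (partial_diff m j (2 powr x) f) (C * S * 2 powr (r * x))"
    using Besov_regularize_top[OF assms(1-3)] by blast
  show ?thesis
  proof (intro exI[of _ C] conjI allI impI)
    fix f :: "real ^ 'n \<Rightarrow> real" and j S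
    assume "f \<in> borel_measurable borel" "S > 0" "besov_partial_seminorm m r p \<theta> j f \<le> ennreal S"
    then show "\<exists>e. Besov_envelope r p m s \<theta> C j f S e" using C(2)[of f S j] True assms(4)
      unfolding Besov_envelope_def by (intro exI[of _ "\<lambda>x. 1"]) (auto simp: ge_one_powr_ge_zero)
  qed (rule C(1))
next
  case False
  define t where "t = enn2real \<theta>"
  have t: "\<theta> = ennreal t" "t \<ge> 1" "\<theta> \<noteq> top"
    using ennreal_ge_1_cases[OF assms(5) False] False by (auto simp: t_def)
  obtain C where C: "C > 0" "\<And>(f :: real ^ 'n \<Rightarrow> real) j S. f \<in> borel_measurable borel \<Longrightarrow> S > 0 \<Longrightarrow>
       besov_partial_seminorm m r p (ennreal t) j f \<le> ennreal S \<Longrightarrow>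
       \<exists>e. (\<forall>x. 0 < e x \<and> e x \<le> 2) \<and> (\<forall>x y. e x \<le> 2 powr (s * \<bar>x - y\<bar>) * e y)
         \<and> e \<in> borel_measurable borel
         \<and> (\<forall>x. Lp_le p (partial_diff m j (2 powr x) f) (C * S * 2 powr (r * x) * e x))
         \<and> (\<forall>\<delta> \<phi>. \<delta> > 0 \<longrightarrow> \<phi> \<in> borel_measurable borel \<longrightarrow> (\<forall>y. \<exists>x0. \<forall>x. \<delta> * \<bar>x - x0\<bar> \<le> \<bar>\<phi> x - y\<bar>)
              \<longrightarrow> (\<integral>\<^sup>+h\<in>{0<..}. ennreal (e (\<phi> (log 2 h)) powr t / h) \<partial>lborel) \<le> ennreal (4 / (s * t * \<delta>)))"
    using Besov_regularize_finite[OF assms(1-4) t(2)] by blast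
  show ?thesis
  proof (intro exI[of _ C] conjI allI impI)
    fix f :: "real ^ 'n \<Rightarrow> real" and j S
    assume 1: "f \<in> borel_measurable borel" "S > 0" "besov_partial_seminorm m r p \<theta> j f \<le> ennreal S"
    show "\<exists>e. Besov_envelope r p m s \<theta> C j f S e"
      using C(2)[OF 1(1,2) 1(3)[unfolded t(1)]] t(3) unfolding Besov_envelope_def t_def by blast
  qed (rule C(1))
qed

lemma weighted_norm_le_finite:
  assumes "t > 0" "C \<ge> 0" "S > 0" "D \<ge> 0"
    and N: "\<And>h. h > 0 \<Longrightarrow> N h \<le> ennreal (C * S * h powr a * G (log 2 h))"
    and G0: "\<And>x. G x > 0" and [measurable]: "G \<in> borel_measurable borel"
    and G: "(\<integral>\<^sup>+h\<in>{0<..}. ennreal (G (log 2 h) powr t / h) \<partial>lborel) \<le> ennreal D"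
  shows "weighted_norm a (ennreal t) N \<le> ennreal (C * D powr (1 / t) * S)"
proof -
  have "(\<integral>\<^sup>+h\<in>{0<..}. (ennreal_powr (ennreal (h powr (- a)) * N h) t / ennreal h) \<partial>lebesgue)
     \<le> (\<integral>\<^sup>+h. ennreal ((C * S) powr t) * (ennreal (G (log 2 h) powr t / h) * indicator {0<..} h) \<partial>lebesgue)"
  proof (intro nn_integral_mono)
    fix h :: real
    show "ennreal_powr (ennreal (h powr (- a)) * N h) t / ennreal h * indicator {0<..} h
       \<le> ennreal ((C * S) powr t) * (ennreal (G (log 2 h) powr t / h) * indicator {0<..} h)"
    proof (cases "h > 0")
      case True
      have "ennreal (h powr (- a)) * N h \<le> ennreal (h powr (- a)) * ennreal (C * S * h powr a * G (log 2 h))"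
        by (intro mult_left_mono N True) simp
      also have "\<dots> = ennreal (C * S * G (log 2 h))"
        using True assms(2,3) less_imp_le[OF G0] by (simp add: ennreal_mult[symmetric] powr_minus)
      finally have "ennreal_powr (ennreal (h powr (- a)) * N h) t \<le> ennreal ((C * S * G (log 2 h)) powr t)"
        using assms(1-3) less_imp_le[OF G0] ennreal_powr_mono[of _ "ennreal (C * S * G (log 2 h))" t]
        by (metis ennreal_powr_ennreal less_imp_le mult_nonneg_nonneg)
      then have "ennreal_powr (ennreal (h powr (- a)) * N h) t * ennreal (1 / h)
          \<le> ennreal ((C * S * G (log 2 h)) powr t) * ennreal (1 / h)"
        by (rule mult_right_mono) simp
      also have "\<dots> = ennreal ((C * S) powr t) * ennreal (G (log 2 h) powr t / h)"
        using True by (simp add: ennreal_mult[symmetric] powr_mult)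
      finally show ?thesis using True by (simp add: divide_ennreal_def inverse_ennreal inverse_eq_divide)
    qed simp
  qed
  also have "\<dots> = ennreal ((C * S) powr t) * (\<integral>\<^sup>+h\<in>{0<..}. ennreal (G (log 2 h) powr t / h) \<partial>lborel)"
    unfolding nn_integral_completion by (intro nn_integral_cmult) measurable
  also have "\<dots> \<le> ennreal ((C * S) powr t) * ennreal D"
    by (intro mult_left_mono G) simp
  also have "\<dots> = ennreal ((C * S) powr t * D)" using assms(4) by (simp add: ennreal_mult)
  finally have "ennreal_powr (\<integral>\<^sup>+h\<in>{0<..}. (ennreal_powr (ennreal (h powr (- a)) * N h) t / ennreal h) \<partial>lebesgue) (1 / t)
     \<le> ennreal_powr (ennreal ((C * S) powr t * D)) (1 / t)"
    using assms(1) by (intro ennreal_powr_mono) auto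
  also have "\<dots> = ennreal (((C * S) powr t * D) powr (1 / t))"
    using assms(4) by (intro ennreal_powr_ennreal) auto
  also have "((C * S) powr t * D) powr (1 / t) = C * D powr (1 / t) * S"
    using assms(1-3) by (simp add: powr_mult powr_powr mult_ac)
  finally show ?thesis
    using assms(1) by (simp add: weighted_norm_def)
qed

text \<open>Unlike the integral, the essential supremum is bounded through \<open>esssup_I\<close>,
  which asks for measurability; hence the condition on \<open>N\<close>.\<close>

lemma weighted_norm_le_top:
  assumes "C \<ge> 0" "S > 0" and N: "\<And>h. h > 0 \<Longrightarrow> N h \<le> ennreal (C * S * h powr a * G (log 2 h))"
    and G: "\<And>x. G x \<le> D" and [measurable]: "N \<in> borel_measurable borel"
  shows "weighted_norm a top N \<le> ennreal (C * D * S)"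
proof -
  have "esssup (lebesgue_on {0<..}) (\<lambda>h. ennreal (h powr (- a)) * N h) \<le> ennreal (C * D * S)"
  proof (rule esssup_I)
    have "(\<lambda>h. ennreal (h powr (- a)) * N h) \<in> borel_measurable lborel" by measurable
    then show "(\<lambda>h. ennreal (h powr (- a)) * N h) \<in> borel_measurable (lebesgue_on {0<..})"
      by (intro measurable_restrict_space1 measurable_completion)
    show "AE h in lebesgue_on {0<..}. ennreal (h powr (- a)) * N h \<le> ennreal (C * D * S)"
    proof (rule AE_I2)
      fix h :: real assume "h \<in> space (lebesgue_on {0<..})"
      then have h: "h > 0" by (simp add: space_restrict_space)
      have "ennreal (h powr (- a)) * N h \<le> ennreal (h powr (- a)) * ennreal (C * S * h powr a * G (log 2 h))"
        by (intro mult_left_mono N h) simp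
      also have "\<dots> \<le> ennreal (h powr (- a)) * ennreal (C * S * h powr a * D)"
        using assms(1,2) G by (intro mult_left_mono ennreal_leI) auto
      also have "\<dots> = ennreal (h powr (- a) * (C * S * h powr a * D))"
        by (rule ennreal_mult'[symmetric]) simp
      also have "h powr (- a) * (C * S * h powr a * D) = C * D * S"
        using h by (simp add: powr_minus)
      finally show "ennreal (h powr (- a)) * N h \<le> ennreal (C * D * S)" .
    qed
  qed
  then show ?thesis by (simp add: weighted_norm_def)
qed

lemma AE_lebesgue_shift:
  fixes P :: "'a::euclidean_space \<Rightarrow> bool"
  assumes "AE x in lebesgue. P x"
  shows "AE x in lebesgue. P (x + a)"
proof -
  have "AE x in lborel. P x" using assms by (simp add: AE_completion_iff)
  then obtain N where N: "N \<in> null_sets lborel" "{x. \<not> P x} \<subseteq> N"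
    unfolding eventually_ae_filter by auto
  have [measurable]: "N \<in> sets borel" using N(1) by auto
  have "emeasure lborel {x. x + a \<in> N} = (\<integral>\<^sup>+x. indicator {x. x + a \<in> N} x \<partial>lborel)"
    by (rule nn_integral_indicator[symmetric]) measurable
  also have "\<dots> = (\<integral>\<^sup>+x. indicator N (x + a) \<partial>lborel)"
    by (intro nn_integral_cong) (simp add: indicator_def)
  also have "\<dots> = 0"
    using N(1) by (subst nn_integral_lborel_shift) auto
  finally have "{x. x + a \<in> N} \<in> null_sets lborel" by (intro null_setsI) auto
  then have "AE x in lborel. P (x + a)"
    by (rule AE_I') (use N(2) in auto)
  then show ?thesis by (rule AE_completion)
qed

lemma AE_partial_diff:
  fixes f f' :: "real ^ 'n::finite \<Rightarrow> real"
  assumes "AE x in lebesgue. f x = f' x"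
  shows "AE x in lebesgue. partial_diff k j h f x = partial_diff k j h f' x"
proof -
  have "AE x in lebesgue. \<forall>i\<in>{..k}. f (x + (real i * h) *\<^sub>R axis j 1) = f' (x + (real i * h) *\<^sub>R axis j 1)"
    using AE_lebesgue_shift[OF assms] by (intro AE_finite_allI) auto
  then show ?thesis
    by eventually_elim (auto simp: partial_diff_def intro!: sum.cong)
qed

lemma Lp_norm_AE_cong:
  assumes "AE x in lebesgue. f x = g x"
  shows "Lp_norm p f = Lp_norm p g"
proof -
  have "(\<integral>\<^sup>+x. ennreal (\<bar>f x\<bar> powr p) \<partial>lebesgue) = (\<integral>\<^sup>+x. ennreal (\<bar>g x\<bar> powr p) \<partial>lebesgue)"
    by (rule nn_integral_cong_AE, use assms in eventually_elim) simp
  then show ?thesis by (simp add: Lp_norm_def)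
qed

lemma borel_measurable_lebesgue_shift:
  fixes f :: "'a::euclidean_space \<Rightarrow> real"
  assumes "f \<in> borel_measurable lebesgue"
  shows "(\<lambda>x. f (x + a)) \<in> borel_measurable lebesgue"
proof -
  have "(\<lambda>x. x + a) \<in> lebesgue \<rightarrow>\<^sub>M lebesgue"
  proof (rule measurableI)
    fix S :: "'a set" assume "S \<in> sets lebesgue"
    then have "(\<lambda>x. - a + x) ` S \<in> sets lebesgue" by (rule lebesgue_sets_translation)
    also have "(\<lambda>x. - a + x) ` S = (\<lambda>x. x + a) -` S"
      by (auto simp: image_iff intro!: bexI[of _ "_ + a"])
    finally show "(\<lambda>x. x + a) -` S \<inter> space lebesgue \<in> sets lebesgue" by simp
  qed simp
  from measurable_compose[OF this assms] show ?thesis .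
qed

section \<open>The interpolation exponents\<close>

lemma uniform_lower_bound:
  fixes F :: "'n::finite \<Rightarrow> real"
  assumes "\<And>i. F i > 0"
  obtains \<epsilon> where "\<epsilon> > 0" "\<And>i. \<epsilon> \<le> F i"
proof (rule that[of "Min (range F)"])
  show "Min (range F) > 0" using assms by (subst Min_gr_iff) auto
  show "Min (range F) \<le> F i" for i by (rule Min_le) auto
qed

text \<open>Takes the place of Hoelder's inequality: a product with exponents summing to 1 is at
  most its largest factor, hence at most the sum of the factors.\<close>

lemma two_powr_convex_le:
  fixes a w :: "'i \<Rightarrow> real"
  assumes "finite I" "\<And>i. i \<in> I \<Longrightarrow> w i \<ge> 0" "(\<Sum>i\<in>I. w i) = 1"
  shows "2 powr (\<Sum>i\<in>I. w i * a i) \<le> (\<Sum>i\<in>I. 2 powr a i)"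
proof -
  have "I \<noteq> {}" using assms(3) by auto
  define M where "M = Max (a ` I)"
  have "M \<in> a ` I" unfolding M_def using \<open>I \<noteq> {}\<close> assms(1) by (intro Max_in) auto
  then obtain i0 where i0: "i0 \<in> I" "M = a i0" by auto
  have "(\<Sum>i\<in>I. w i * a i) \<le> (\<Sum>i\<in>I. w i * M)"
    unfolding M_def using assms(1,2) by (intro sum_mono mult_left_mono) auto
  also have "\<dots> = M" by (simp add: sum_distrib_right[symmetric] assms(3))
  finally have "2 powr (\<Sum>i\<in>I. w i * a i) \<le> 2 powr a i0" by (simp add: i0(2))
  also have "\<dots> \<le> (\<Sum>i\<in>I. 2 powr a i)" using i0(1) assms(1) by (intro member_le_sum) auto
  finally show ?thesis .
qed

locale besov_exponents =
  fixes r p q \<beta> \<kappa> \<alpha> :: "'n::finite \<Rightarrow> real" and R P :: real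
  assumes r: "\<And>j. r j > 0" and p: "\<And>j. p j \<ge> 1"
    and R: "R = real CARD('n) * inverse (\<Sum>j\<in>UNIV. 1 / r j)"
    and P: "P = real CARD('n) / R * inverse (\<Sum>j\<in>UNIV. 1 / (p j * r j))"
    and \<beta>: "\<And>j. \<beta> j = 1 / r j * (R / real CARD('n) + 1 / p j - 1 / P)" and \<beta>0: "\<And>j. \<beta> j > 0"
    and pq: "\<And>j. p j < q j"
    and q: "\<And>j. 1 / q j > 1 / P - R / real CARD('n)"
    and \<kappa>: "\<And>j. \<kappa> j = 1 - 1 / (\<beta> j * r j) * (1 / p j - 1 / q j)"
    and \<alpha>: "\<And>j. \<alpha> j = \<kappa> j * r j"
begin

definition b where "b = R / real CARD('n) - 1 / P"

text \<open>The exponents of the weights $e_i$ in $2^{H + T/q_j} = h^{\alpha_j} \prod_i e_i^{\nu_{ji}}$ at $h = 2^{d_j(T)}$.\<close>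

definition \<nu> where "\<nu> j i = (1 - \<kappa> j) * (R / real CARD('n)) / r i + (if i = j then \<kappa> j else 0)"

lemma q0: "q j > 0"
  using p[of j] pq[of j] by linarith

lemma b_gt: "- b < 1 / q j"
  using q[of j] by (simp add: b_def)

lemma sum_r: "(\<Sum>j\<in>UNIV. 1 / r j) > 0"
  using r by (intro sum_pos) auto

lemma sum_pr: "(\<Sum>j\<in>UNIV. 1 / (p j * r j)) > 0"
proof (intro sum_pos)
  fix i show "0 < 1 / (p i * r i)" using r[of i] p[of i] by simp
qed auto

lemma R0: "R > 0"
  unfolding R using sum_r by simp

lemma R_eq: "R / real CARD('n) * (\<Sum>j\<in>UNIV. 1 / r j) = 1"
  using sum_r by (simp add: R)

lemma P_eq: "1 / P = R / real CARD('n) * (\<Sum>j\<in>UNIV. 1 / (p j * r j))"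
  using R0 sum_pr by (simp add: P field_simps)

lemma \<beta>r: "\<beta> j * r j = b + 1 / p j"
  using r[of j] by (simp add: \<beta> b_def)

lemma \<beta>r0: "b + 1 / p j > 0"
  using \<beta>0[of j] r[of j] unfolding \<beta>r[symmetric] by simp

lemma one_minus_\<kappa>: "(1 - \<kappa> j) * (b + 1 / p j) = 1 / p j - 1 / q j"
  using \<beta>r0[of j] by (simp add: \<kappa> \<beta>r)

text \<open>The products of \<kappa> and 1 - \<kappa> with b + 1/p are b + 1/q and 1/p - 1/q. Thus
  \<kappa> > 0 is the lower bound imposed on 1/q, and \<kappa> < 1 is p < q.\<close>

lemma \<kappa>_bounds: "0 < \<kappa> j" "\<kappa> j < 1"
proof -
  have "\<kappa> j * (b + 1 / p j) = b + 1 / q j"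
    using one_minus_\<kappa>[of j] by (simp add: algebra_simps diff_divide_distrib)
  also have "\<dots> > 0" using b_gt[of j] by simp
  finally show "0 < \<kappa> j" using \<beta>r0[of j] by (simp add: zero_less_mult_iff)
  have "1 / p j > 1 / q j" using p[of j] pq[of j] by (simp add: frac_less2)
  then have "(1 - \<kappa> j) * (b + 1 / p j) > 0" using one_minus_\<kappa>[of j] by simp
  then show "\<kappa> j < 1" using \<beta>r0[of j] by (simp add: zero_less_mult_iff)
qed

lemma \<alpha>0: "\<alpha> j > 0"
  using \<kappa>_bounds[of j] r[of j] by (simp add: \<alpha>)

lemma \<nu>_nonneg: "\<nu> j i \<ge> 0"
  using \<kappa>_bounds[of j] r[of i] R0 by (simp add: \<nu>_def)

lemma sum_\<nu>: "(\<Sum>i\<in>UNIV. \<nu> j i * x i) = (1 - \<kappa> j) * (R / real CARD('n) * (\<Sum>i\<in>UNIV. x i / r i)) + \<kappa> j * x j"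
proof -
  have "(\<Sum>i\<in>UNIV. \<nu> j i * x i) = (\<Sum>i\<in>UNIV. (1 - \<kappa> j) * (R / real CARD('n)) * (x i / r i) + (if i = j then \<kappa> j * x i else 0))"
    by (intro sum.cong refl) (simp add: \<nu>_def distrib_right)
  also have "\<dots> = (1 - \<kappa> j) * (R / real CARD('n)) * (\<Sum>i\<in>UNIV. x i / r i) + \<kappa> j * x j"
    by (simp add: sum.distrib sum_distrib_left)
  finally show ?thesis by (simp add: mult.assoc)
qed

lemma sum_\<nu>_1: "(\<Sum>i\<in>UNIV. \<nu> j i) = 1"
  using sum_\<nu>[of j "\<lambda>i. 1"] unfolding R_eq by simp

text \<open>Averaging the equations with the weights (R/n) / r_i removes the individual d_i, which
  add up to T, and yields h - b T. The j-th equation is then mixed in with weight \<kappa>_j; this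
  value of \<kappa>_j turns the coefficient of T into 1/q_j.\<close>

lemma exponent_identity:
  assumes T: "(\<Sum>i\<in>UNIV. d i) = T" and d: "\<And>i. r i * d i + l i = h + T / p i"
  shows "h + T / q j = \<alpha> j * d j + (\<Sum>i\<in>UNIV. \<nu> j i * l i)"
proof -
  let ?c = "R / real CARD('n)"
  have l: "l i / r i = h * (1 / r i) + T * (1 / (p i * r i)) - d i" for i
    using d[of i] r[of i] by (simp add: field_simps)
  have "?c * (\<Sum>i\<in>UNIV. l i / r i) = ?c * (h * (\<Sum>i\<in>UNIV. 1 / r i) + T * (\<Sum>i\<in>UNIV. 1 / (p i * r i)) - T)"
    unfolding l sum_subtractf sum.distrib sum_distrib_left[symmetric] T ..
  also have "\<dots> = h * (?c * (\<Sum>i\<in>UNIV. 1 / r i)) + T * (?c * (\<Sum>i\<in>UNIV. 1 / (p i * r i))) - ?c * T"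
    by (simp add: algebra_simps)
  also have "\<dots> = h - b * T"
    unfolding R_eq P_eq[symmetric] by (simp add: b_def algebra_simps)
  finally have 1: "?c * (\<Sum>i\<in>UNIV. l i / r i) = h - b * T" .
  have lj: "l j = h + T / p j - r j * d j" using d[of j] by simp
  have k: "\<kappa> j / p j - (1 - \<kappa> j) * b = 1 / q j"
    using one_minus_\<kappa>[of j] by (simp add: algebra_simps diff_divide_distrib)
  have "(\<Sum>i\<in>UNIV. \<nu> j i * l i) = (1 - \<kappa> j) * (h - b * T) + \<kappa> j * (h + T / p j - r j * d j)"
    unfolding sum_\<nu> 1 lj ..
  also have "\<dots> = h + (\<kappa> j / p j - (1 - \<kappa> j) * b) * T - \<alpha> j * d j"
    by (simp add: \<alpha> algebra_simps)
  finally show ?thesis unfolding k by simp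
qed

end

context besov_exponents
begin

definition recip :: "ennreal \<Rightarrow> real" where
  "recip \<theta> = (if \<theta> = top then 0 else 1 / enn2real \<theta>)"

text \<open>\<^term>\<open>G\<close> will be $\prod_i e_i(d_i(T))^{\nu_{ji}}$ at the scale $T$ with $d_j(T) = \log_2 h$.\<close>

definition difference_weight :: "('n \<Rightarrow> ennreal) \<Rightarrow> nat \<Rightarrow> real \<Rightarrow> real \<Rightarrow> 'n \<Rightarrow> (real ^ 'n \<Rightarrow> real) \<Rightarrow> real \<Rightarrow> (real \<Rightarrow> real) \<Rightarrow> bool" where
  "difference_weight \<theta> K \<eta> C j f S G \<longleftrightarrow>
     (\<forall>x. 0 < G x \<and> G x \<le> 2) \<and> G \<in> borel_measurable borel \<and> (\<forall>x y. G x \<le> 2 powr (\<eta> * \<bar>x - y\<bar>) * G y)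
     \<and> (\<forall>h>0. Lp_le (q j) (partial_diff K j h f) (C * S * h powr \<alpha> j * G (log 2 h)))
     \<and> (\<forall>h>0. lorentz_norm (q j) 1 (partial_diff K j h f) \<le> ennreal (C * S * h powr \<alpha> j * G (log 2 h)))
     \<and> (\<forall>t>0. 1 / t = (\<Sum>i\<in>UNIV. \<nu> j i * recip (\<theta> i)) \<longrightarrow>
           (\<integral>\<^sup>+h\<in>{0<..}. ennreal (G (log 2 h) powr t / h) \<partial>lborel) \<le> ennreal C)"

definition difference_constant :: "('n \<Rightarrow> nat) \<Rightarrow> ('n \<Rightarrow> ennreal) \<Rightarrow> ('n \<Rightarrow> nat) \<Rightarrow> real \<Rightarrow> real \<Rightarrow> bool" where
  "difference_constant m \<theta> K \<eta> C \<longleftrightarrow> C > 0 \<and> (\<forall>f S j. f \<in> borel_measurable borel \<longrightarrow> finite_levels f \<longrightarrow> S > 0 \<longrightarrow>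
     (\<forall>i. besov_partial_seminorm (m i) (r i) (p i) (\<theta> i) i f \<le> ennreal S) \<longrightarrow>
     (\<exists>G. difference_weight \<theta> (K j) \<eta> C j f S G))"

text \<open>Here scales, iteration and change of order are put together, with all constants fixed
  before f, S and h. The order \<open>K\<close> is arbitrary above \<open>r\<close> because the
  result is applied both to the prescribed orders and to auxiliary ones.\<close>

lemma difference_constant_exists:
  fixes K m :: "'n \<Rightarrow> nat" and \<theta> :: "'n \<Rightarrow> ennreal" and \<eta> :: real
  assumes K: "\<And>j. real (K j) > r j" and m: "\<And>j. real (m j) > r j" and \<theta>: "\<And>j. \<theta> j \<ge> 1" and "\<eta> > 0"
  shows "\<exists>C. difference_constant m \<theta> K \<eta> C"
proof -
  have K1: "1 \<le> K j" and m1: "1 \<le> m j" for j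
    using K[of j] m[of j] r[of j] by (auto intro: Suc_leI)

  \<comment> \<open>Constants that do not depend on the function\<close>
  define Bm where "Bm = (\<Sum>i\<in>UNIV. \<beta> i)"
  have Bm0: "Bm > 0" unfolding Bm_def using \<beta>0 by (intro sum_pos) auto
  have \<beta>Bm: "\<beta> i \<le> Bm" for i unfolding Bm_def using \<beta>0 by (intro member_le_sum) (auto simp: less_imp_le)
  \<comment> \<open>The first bound keeps the rates of the d_i between \<beta>_i / 2 and 2
    \<beta>_i; the second leaves a gap between \<epsilon> - b and 1 / q_i.\<close>
  obtain \<epsilon> where \<epsilon>0: "\<epsilon> > 0" and \<epsilon>: "\<And>i. \<epsilon> \<le> min (\<beta> i / 2) ((1 / q i + b) / 2)"
  proof (rule uniform_lower_bound[of "\<lambda>i. min (\<beta> i / 2) ((1 / q i + b) / 2)"])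
    show "0 < min (\<beta> i / 2) ((1 / q i + b) / 2)" for i using \<beta>0[of i] b_gt[of i] by simp
  qed blast
  have \<epsilon>\<beta>: "\<epsilon> \<le> \<beta> i / 2" and \<epsilon>q: "\<epsilon> \<le> (1 / q i + b) / 2" for i using \<epsilon>[of i] by auto
  \<comment> \<open>\<epsilon> - b bounds the growth of H towards smaller T. The maximum keeps
    \<rho> positive when this number is negative, and still below 1 / q_j.\<close>
  define \<rho> where "\<rho> j = max (\<epsilon> - b) (1 / (2 * q j))" for j
  have \<rho>: "0 < \<rho> j" "\<epsilon> - b \<le> \<rho> j" "\<rho> j < 1 / q j" for j
  proof -
    have "\<epsilon> - b < 1 / q j" using \<epsilon>q[of j] b_gt[of j] by (simp add: field_simps)
    moreover have "1 / (2 * q j) < 1 / q j" using q0[of j] by (simp add: divide_strict_left_mono)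
    ultimately show "\<rho> j < 1 / q j" by (simp add: \<rho>_def)
    show "0 < \<rho> j" "\<epsilon> - b \<le> \<rho> j" using q0[of j] by (auto simp: \<rho>_def less_max_iff_disj)
  qed
  define \<sigma>' where "\<sigma>' = \<bar>b\<bar> + \<epsilon>"
  have \<sigma>': "\<sigma>' \<ge> 0" using \<epsilon>0 by (simp add: \<sigma>'_def)
  \<comment> \<open>The three bounds make r_i x + log_2 e_i(x) nondecreasing, keep the growth
    exponent r_i + s below K_i for Marchaud's inequality, and make the logarithm of the final weight
    \<eta>-Lipschitz.\<close>
  obtain s0 where s00: "s0 > 0" and s0: "\<And>i. s0 \<le> min (r i) (min ((real (K i) - r i) / 2) (\<eta> * \<beta> i / (4 * Bm)))"
  proof (rule uniform_lower_bound[of "\<lambda>i. min (r i) (min ((real (K i) - r i) / 2) (\<eta> * \<beta> i / (4 * Bm)))"])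
    show "0 < min (r i) (min ((real (K i) - r i) / 2) (\<eta> * \<beta> i / (4 * Bm)))" for i
      using r[of i] K[of i] \<beta>0[of i] assms(4) Bm0 by simp
  qed blast
  have p0: "p j > 0" for j using p[of j] by linarith
  obtain s where s: "0 < s" "s \<le> s0" and scales: "\<And>L. (\<And>i x y. \<bar>L i x - L i y\<bar> \<le> s * \<bar>x - y\<bar>) \<Longrightarrow>
       \<exists>d H. (\<forall>T. (\<Sum>i\<in>UNIV. d i T) = T) \<and> (\<forall>i T. r i * d i T + L i (d i T) = H T + T / p i)
         \<and> (\<forall>i T T'. \<bar>(d i T - d i T') - \<beta> i * (T - T')\<bar> \<le> \<epsilon> * \<bar>T - T'\<bar>)
         \<and> (\<forall>T T'. \<bar>(H T - H T') - (R / real CARD('n) - 1 / P) * (T - T')\<bar> \<le> \<epsilon> * \<bar>T - T'\<bar>)"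
    by (rule Lipschitz_scales[OF r p0 R P \<beta> \<beta>0 \<epsilon>0 s00]) blast
  have sr: "s \<le> r i" and sK: "r i + s < real (K i)" and s\<eta>: "s \<le> \<eta> * \<beta> i / (4 * Bm)" for i
  proof -
    have a: "s0 \<le> r i" "s0 \<le> (real (K i) - r i) / 2" "s0 \<le> \<eta> * \<beta> i / (4 * Bm)" using s0[of i] by auto
    then show "s \<le> r i" "s \<le> \<eta> * \<beta> i / (4 * Bm)" using s(2) by linarith+
    show "r i + s < real (K i)" using a(2) s(2) K[of i] by (simp add: field_simps)
  qed
  have "\<exists>C0. C0 > 0 \<and> (\<forall>(f :: real ^ 'n \<Rightarrow> real) S. f \<in> borel_measurable borel \<longrightarrow> S > 0 \<longrightarrow>
       besov_partial_seminorm (m i) (r i) (p i) (\<theta> i) i f \<le> ennreal S \<longrightarrow>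
       (\<exists>e. Besov_envelope (r i) (p i) (m i) s (\<theta> i) C0 i f S e))" for i
    using Besov_regularize[OF r p m1 s(1) \<theta>, of i i i i] by blast
  then obtain C0 where C0: "\<And>i. C0 i > 0" and env: "\<And>i (f :: real ^ 'n \<Rightarrow> real) S. f \<in> borel_measurable borel \<Longrightarrow> S > 0 \<Longrightarrow>
       besov_partial_seminorm (m i) (r i) (p i) (\<theta> i) i f \<le> ennreal S \<Longrightarrow>
       \<exists>e. Besov_envelope (r i) (p i) (m i) s (\<theta> i) (C0 i) i f S e"
    by metis
  have "\<exists>C1. order_constant (m i) (K i) (2 powr (r i + s)) i C1" for i
  proof (rule order_constant_exists)
    have "2 powr (r i + s) < 2 powr real (K i)" using sK by (intro powr_less_mono) auto
    then show "2 powr (r i + s) < 2 ^ K i" by (simp add: powr_realpow)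
  qed (use K1 in simp_all)
  then obtain C1 where order: "\<And>i. order_constant (m i) (K i) (2 powr (r i + s)) i (C1 i)" by metis
  have C1: "C1 i > 0" for i by (rule order_constantD(1)[OF order])
  define W where "W j = 2 ^ K j * real (Suc (K j)) ^ 2" for j
  have W0: "W j > 0" for j by (simp add: W_def)
  \<comment> \<open>One constant for two purposes: it dominates W_j C0_i, for the differences of g,
    and C1_i C0_i, for g itself after the change of order.\<close>
  define B where "B = (\<Sum>i\<in>UNIV. C0 i * (C1 i + (\<Sum>j\<in>UNIV. W j)))"
  have sW: "(\<Sum>j\<in>UNIV. W j) \<ge> W j" for j using W0 by (intro member_le_sum) (auto simp: less_imp_le)
  have sW0: "(\<Sum>j\<in>(UNIV::'n set). W j) > 0" using W0 by (intro sum_pos) auto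
  have Bi: "C0 i * (C1 i + (\<Sum>j\<in>UNIV. W j)) \<le> B" for i
    unfolding B_def using C0 C1 sW0 by (intro member_le_sum) (auto simp: less_imp_le intro!: mult_nonneg_nonneg add_nonneg_nonneg)
  have BW: "W j * C0 i \<le> B" for i j
  proof -
    have "C0 i * W j \<le> C0 i * (C1 i + (\<Sum>j\<in>UNIV. W j))"
      using C0[of i] C1[of i] sW[of j] by (intro mult_left_mono) auto
    then show ?thesis using Bi[of i] by (simp add: mult.commute)
  qed
  have BC: "C1 i * C0 i \<le> B" for i
  proof -
    have "C0 i * C1 i \<le> C0 i * (C1 i + (\<Sum>j\<in>UNIV. W j))"
      using C0[of i] sW0 by (intro mult_left_mono) auto
    then show ?thesis using Bi[of i] by (simp add: mult.commute)
  qed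
  have B0: "B > 0"
    using BC[of undefined] mult_pos_pos[OF C1 C0, of undefined undefined] by linarith
  have "\<exists>D E. distribution_constants p m B (\<epsilon> - b) \<sigma>' (\<rho> j) D E" for j
    using p B0 \<rho> \<sigma>' by (intro distribution_constants_exist) auto
  then obtain D E where DE': "\<And>j. distribution_constants p m B (\<epsilon> - b) \<sigma>' (\<rho> j) (D j) (E j)" by metis
  then have DE: "D j > 0" "E j > 0" for j unfolding distribution_constants_def by blast+
  define cL where "cL j = (q j * E j * (1 / (q j - p j) + 1 / (1 / \<rho> j - q j))) powr (1 / q j) * D j" for j
  define cZ where "cZ j = q j * E j powr (1 / q j) * (1 / (1 - p j / q j) + 1 / (1 / \<rho> j / q j - 1)) * D j" for j
  \<comment> \<open>The sum of the bounds for the integrals of the single weights; \<beta>_i / (4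
    \<beta>_j) is a lower bound for the rate of d_i as a function of d_j. For infinite \<theta>_i
    the summand is 0 by the conventions on \<open>enn2real\<close> and division.\<close>
  define cI where "cI j = (\<Sum>i\<in>UNIV. 4 / (s * enn2real (\<theta> i) * (\<beta> i / (4 * \<beta> j))))" for j
  define C where "C = 1 + (\<Sum>j\<in>UNIV. \<bar>cL j\<bar> + \<bar>cZ j\<bar> + \<bar>cI j\<bar>)"
  have C: "C > 0" "cL j \<le> C" "cZ j \<le> C" "cI j \<le> C" for j
  proof -
    have "\<bar>cL j\<bar> + \<bar>cZ j\<bar> + \<bar>cI j\<bar> \<le> (\<Sum>j\<in>UNIV. \<bar>cL j\<bar> + \<bar>cZ j\<bar> + \<bar>cI j\<bar>)"
      by (rule member_le_sum[of j UNIV "\<lambda>j. \<bar>cL j\<bar> + \<bar>cZ j\<bar> + \<bar>cI j\<bar>"]) auto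
    then show "C > 0" "cL j \<le> C" "cZ j \<le> C" "cI j \<le> C" unfolding C_def by linarith+
  qed
  have "difference_constant m \<theta> K \<eta> C"
    unfolding difference_constant_def
  proof (intro conjI allI impI C(1))
    fix f :: "real ^ 'n \<Rightarrow> real" and S j
    assume f [measurable]: "f \<in> borel_measurable borel" and fin: "finite_levels f"
      and S: "S > 0" and semi: "\<forall>i. besov_partial_seminorm (m i) (r i) (p i) (\<theta> i) i f \<le> ennreal S"

    \<comment> \<open>Weights and scales of a given function\<close>
    have "\<forall>i. \<exists>e. Besov_envelope (r i) (p i) (m i) s (\<theta> i) (C0 i) i f S e"
      using env[OF f S] semi by blast
    then obtain e where e: "\<And>i. Besov_envelope (r i) (p i) (m i) s (\<theta> i) (C0 i) i f S (e i)"
      by metis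
    have e0: "0 < e i x" "e i x \<le> 2" and e_lip: "e i x \<le> 2 powr (s * \<bar>x - y\<bar>) * e i y"
      and e_meas [measurable]: "e i \<in> borel_measurable borel"
      and e_Lp: "Lp_le (p i) (partial_diff (m i) i (2 powr x) f) (C0 i * S * 2 powr (r i * x) * e i x)"
      and e_top: "\<theta> i = top \<Longrightarrow> e i x = 1" for i x y
      using e[of i] unfolding Besov_envelope_def by blast+
    have e_int: "(\<integral>\<^sup>+h\<in>{0<..}. ennreal (e i (\<phi> (log 2 h)) powr enn2real (\<theta> i) / h) \<partial>lborel) \<le> ennreal (4 / (s * enn2real (\<theta> i) * \<delta>))"
      if "\<theta> i \<noteq> top" "\<delta> > 0" "\<phi> \<in> borel_measurable borel" "\<forall>y. \<exists>x0. \<forall>x. \<delta> * \<bar>x - x0\<bar> \<le> \<bar>\<phi> x - y\<bar>" for i \<delta> \<phi>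
      using e[of i] that unfolding Besov_envelope_def by blast
    define L where "L i x = log 2 (e i x)" for i x
    have [measurable]: "L i \<in> borel_measurable borel" for i unfolding L_def by measurable
    have eL: "e i x = 2 powr L i x" for i x using e0(1)[of i x] by (simp add: L_def)
    have L1: "L i x \<le> 1" for i x
      using e0[of i x] log_le_cancel_iff[of 2 "e i x" 2] by (simp add: L_def)
    have L_lip1: "L i x - L i y \<le> s * \<bar>x - y\<bar>" for i x y
    proof -
      have "2 powr L i x \<le> 2 powr (s * \<bar>x - y\<bar> + L i y)"
        using e_lip[of i x y] by (simp add: eL powr_add)
      then show ?thesis by simp
    qed
    have L_lip: "\<bar>L i x - L i y\<bar> \<le> s * \<bar>x - y\<bar>" for i x y
      using L_lip1[of i x y] L_lip1[of i y x] by (simp add: abs_le_iff abs_minus_commute)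
    obtain d H where dsum: "\<And>T. (\<Sum>i\<in>UNIV. d i T) = T" and dH: "\<And>i T. r i * d i T + L i (d i T) = H T + T / p i"
      and dincr: "\<And>i T T'. \<bar>(d i T - d i T') - \<beta> i * (T - T')\<bar> \<le> \<epsilon> * \<bar>T - T'\<bar>"
      and Hincr: "\<And>T T'. \<bar>(H T - H T') - b * (T - T')\<bar> \<le> \<epsilon> * \<bar>T - T'\<bar>"
      using scales[of L] L_lip unfolding b_def by blast
    have dlo: "\<beta> i / 2 * \<bar>T - T'\<bar> \<le> \<bar>d i T - d i T'\<bar>" and dhi: "\<bar>d i T - d i T'\<bar> \<le> 2 * \<beta> i * \<bar>T - T'\<bar>"
      and dmono: "T' \<le> T \<Longrightarrow> d i T' \<le> d i T" for i T T'
    proof -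
      have 1: "\<epsilon> * \<bar>T - T'\<bar> \<le> \<beta> i / 2 * \<bar>T - T'\<bar>" using \<epsilon>\<beta>[of i] by (intro mult_right_mono) auto
      have 2: "\<bar>\<beta> i * (T - T')\<bar> = \<beta> i * \<bar>T - T'\<bar>" using \<beta>0[of i] by (simp add: abs_mult)
      have 3: "0 \<le> \<beta> i * \<bar>T - T'\<bar>" using \<beta>0[of i] by simp
      have 4: "\<beta> i / 2 * \<bar>T - T'\<bar> = (\<beta> i * \<bar>T - T'\<bar>) / 2" "2 * \<beta> i * \<bar>T - T'\<bar> = 2 * (\<beta> i * \<bar>T - T'\<bar>)" by simp_all
      show "\<beta> i / 2 * \<bar>T - T'\<bar> \<le> \<bar>d i T - d i T'\<bar>" "\<bar>d i T - d i T'\<bar> \<le> 2 * \<beta> i * \<bar>T - T'\<bar>"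
        using 1 2 3 dincr[of i T T'] unfolding 4 by linarith+
      assume "T' \<le> T"
      then have "\<beta> i * (T - T') = \<beta> i * \<bar>T - T'\<bar>" by simp
      then show "d i T' \<le> d i T" using 1 3 dincr[of i T T'] unfolding 4 by linarith
    qed
    have dlo': "\<beta> i / 2 * (y - x) \<le> d i y - d i x" and dhi': "d i y - d i x \<le> 2 * \<beta> i * (y - x)" if "x \<le> y" for i x y
      using dlo[of i y x] dhi[of i y x] dmono[OF that, of i] that by simp_all
    have inv: "\<exists>\<tau>. (\<forall>z. d i (\<tau> z) = z) \<and> continuous_on UNIV \<tau>" for i
      by (rule Lipschitz_inverse[of "\<beta> i / 2" "2 * \<beta> i" "d i"]) (use \<beta>0[of i] dlo' dhi' in auto)
    then obtain \<tau> where \<tau>: "\<And>i z. d i (\<tau> i z) = z" and \<tau>cont: "\<And>i. continuous_on UNIV (\<tau> i)" by metis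
    have [measurable]: "\<tau> i \<in> borel_measurable borel" for i
      by (intro borel_measurable_continuous_onI \<tau>cont)
    have [measurable]: "d i \<in> borel_measurable borel" for i
      using dmono by (intro borel_measurable_mono) (auto simp: mono_def)
    have Hdown: "H (T - y) \<le> H T + (\<epsilon> - b) * y" if "y \<ge> 0" for T y
      using Hincr[of "T - y" T] that by (simp add: algebra_simps)
    have Hup: "H (T + y) \<le> H T + \<sigma>' * y" if "y \<ge> 0" for T y
    proof -
      have "b * y \<le> \<bar>b\<bar> * y" using that by (intro mult_right_mono) auto
      then show ?thesis using Hincr[of "T + y" T] that by (simp add: \<sigma>'_def algebra_simps)
    qed
    \<comment> \<open>By s \<le> r_i the function r_i x + L_i x is nondecreasing, so its value at
      log_2 u is at most the value at d_i(T), which the equation for the scales identifies.\<close>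
    have small: "Lp_le (p i) (partial_diff (m i) i u f) (C0 i * S * 2 powr (H T + T / p i))"
      if "0 < u" "u < 2 powr d i T" for i u T
    proof (rule Lp_le_mono)
      define x where "x = log 2 u"
      have u: "u = 2 powr x" using that(1) by (simp add: x_def)
      have x: "x \<le> d i T" using that(2) unfolding u by simp
      show "Lp_le (p i) (partial_diff (m i) i u f) (C0 i * S * 2 powr (r i * x) * e i x)"
        unfolding u by (rule e_Lp)
      have "L i x - L i (d i T) \<le> s * (d i T - x)" using L_lip1[of i x "d i T"] x by simp
      also have "\<dots> \<le> r i * (d i T - x)" using sr x by (intro mult_right_mono) auto
      finally have "r i * x + L i x \<le> H T + T / p i" using dH[of i T] by (simp add: algebra_simps)
      then have "2 powr (r i * x) * e i x \<le> 2 powr (H T + T / p i)"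
        unfolding eL powr_add[symmetric] by simp
      then have "C0 i * S * (2 powr (r i * x) * e i x) \<le> C0 i * S * 2 powr (H T + T / p i)"
        using C0[of i] S by (intro mult_left_mono) auto
      then show "C0 i * S * 2 powr (r i * x) * e i x \<le> C0 i * S * 2 powr (H T + T / p i)" by (simp add: mult.assoc)
    qed (use p0[of i] C0[of i] S e0[of i] in \<open>auto simp: less_imp_le\<close>)
    define \<Lambda> where "\<Lambda> x = (\<Sum>i\<in>UNIV. \<nu> j i * L i (d i (\<tau> j x)))" for x
    define G where "G x = 2 powr \<Lambda> x" for x
    have G0: "G x > 0" for x by (simp add: G_def)
    have G2: "G x \<le> 2" for x
    proof -
      have "\<Lambda> x \<le> (\<Sum>i\<in>UNIV. \<nu> j i * 1)"
        unfolding \<Lambda>_def using \<nu>_nonneg L1 by (intro sum_mono mult_left_mono) auto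
      then have "2 powr \<Lambda> x \<le> 2 powr 1" using sum_\<nu>_1[of j] by (intro powr_mono) auto
      then show ?thesis by (simp add: G_def)
    qed
    have G_meas [measurable]: "G \<in> borel_measurable borel"
      unfolding G_def \<Lambda>_def by measurable
    have G_lip: "G x \<le> 2 powr (\<eta> * \<bar>x - y\<bar>) * G y" for x y
    proof -
      have \<tau>d: "\<bar>\<tau> j x - \<tau> j y\<bar> \<le> 2 / \<beta> j * \<bar>x - y\<bar>"
        using dlo[of j "\<tau> j x" "\<tau> j y"] \<beta>0[of j] by (simp add: \<tau> field_simps)
      have "\<Lambda> x - \<Lambda> y = (\<Sum>i\<in>UNIV. \<nu> j i * (L i (d i (\<tau> j x)) - L i (d i (\<tau> j y))))"
        by (simp add: \<Lambda>_def sum_subtractf right_diff_distrib)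
      also have "\<dots> \<le> (\<Sum>i\<in>UNIV. \<nu> j i * (\<eta> * \<bar>x - y\<bar>))"
      proof (intro sum_mono mult_left_mono \<nu>_nonneg)
        fix i
        have "L i (d i (\<tau> j x)) - L i (d i (\<tau> j y)) \<le> s * \<bar>d i (\<tau> j x) - d i (\<tau> j y)\<bar>" by (rule L_lip1)
        also have "\<dots> \<le> s * (2 * \<beta> i * \<bar>\<tau> j x - \<tau> j y\<bar>)" using s by (intro mult_left_mono dhi) auto
        also have "\<dots> \<le> s * (2 * Bm * (2 / \<beta> j * \<bar>x - y\<bar>))"
          using s \<beta>Bm[of i] \<beta>0[of i] Bm0 \<tau>d by (intro mult_left_mono mult_mono) auto
        also have "\<dots> = s * (4 * Bm / \<beta> j) * \<bar>x - y\<bar>" by simp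
        also have "\<dots> \<le> (\<eta> * \<beta> j / (4 * Bm)) * (4 * Bm / \<beta> j) * \<bar>x - y\<bar>"
          using s\<eta>[of j] Bm0 \<beta>0[of j] by (intro mult_right_mono) auto
        also have "\<dots> = \<eta> * \<bar>x - y\<bar>" using Bm0 \<beta>0[of j] by simp
        finally show "L i (d i (\<tau> j x)) - L i (d i (\<tau> j y)) \<le> \<eta> * \<bar>x - y\<bar>" .
      qed
      also have "\<dots> = \<eta> * \<bar>x - y\<bar>" by (simp add: sum_distrib_right[symmetric] sum_\<nu>_1)
      finally show ?thesis unfolding G_def powr_add[symmetric] by simp
    qed

    \<comment> \<open>Norm bounds at a single step\<close>
    have key: "Lp_le (q j) (partial_diff (K j) j h f) (C * S * h powr \<alpha> j * G (log 2 h)) \<and>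
       lorentz_norm (q j) 1 (partial_diff (K j) j h f) \<le> ennreal (C * S * h powr \<alpha> j * G (log 2 h))" if h: "h > 0" for h
    proof -
      define x where "x = log 2 h"
      have hx: "2 powr (c * x) = h powr c" for c using h by (simp add: x_def powr_def log_def)
      define T0 where "T0 = \<tau> j x"
      have dT0: "d j T0 = x" by (simp add: T0_def \<tau>)
      define g where "g = partial_diff (K j) j h f"
      have g [measurable]: "g \<in> borel_measurable borel" unfolding g_def by measurable
      \<comment> \<open>Differences commute, and the one of order K_j is bounded on L^(p_i) by the
        constant W_j for every step h.\<close>
      have gsmall: "Lp_le (p i) (partial_diff (m i) i u g) (B * S * 2 powr (H T + T / p i))"
        if "0 < u" "u < 2 powr d i T" for T i u
      proof (rule Lp_le_mono)
        have "partial_diff (m i) i u g = partial_diff (K j) j h (partial_diff (m i) i u f)"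
          unfolding g_def by (rule ext) (rule partial_diff_commute)
        moreover have "Lp_le (p i) (partial_diff (K j) j h (partial_diff (m i) i u f))
            (2 ^ K j * real (Suc (K j)) ^ 2 * (C0 i * S * 2 powr (H T + T / p i)))"
          using C0[of i] S p[of i] by (intro Lp_le_partial_diff small that) auto
        ultimately show "Lp_le (p i) (partial_diff (m i) i u g) (W j * (C0 i * S * 2 powr (H T + T / p i)))"
          by (simp add: W_def)
        have "(W j * C0 i) * (S * 2 powr (H T + T / p i)) \<le> B * (S * 2 powr (H T + T / p i))"
          using BW S by (intro mult_right_mono) auto
        then show "W j * (C0 i * S * 2 powr (H T + T / p i)) \<le> B * S * 2 powr (H T + T / p i)"
          by (simp add: mult.assoc)
      qed (use p0[of i] C0[of i] S W0[of j] in auto)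
      \<comment> \<open>The regularized bound for order m_j. The Lipschitz property of the weight
        limits its growth to 2^(r_j + s) per doubling, so the order can be changed to K_j.\<close>
      define A where "A h = C0 j * S * h powr r j * e j (log 2 h)" for h
      have gA: "Lp_le (p j) g (C1 j * A h)"
        unfolding g_def
      proof (rule order_constantD(2)[OF order f fin p _ _ h])
        show "\<forall>h>0. 0 \<le> A h \<and> A (2 * h) \<le> 2 powr (r j + s) * A h"
        proof (intro allI impI conjI)
          fix h :: real assume h: "h > 0"
          show "0 \<le> A h" using C0[of j] S e0(1)[of j "log 2 h"] by (simp add: A_def)
          have "e j (log 2 (2 * h)) \<le> 2 powr s * e j (log 2 h)"
            using e_lip[of j "log 2 (2 * h)" "log 2 h"] h by (simp add: log_mult)
          then have "(C0 j * S * (2 * h) powr r j) * e j (log 2 (2 * h)) \<le> (C0 j * S * (2 * h) powr r j) * (2 powr s * e j (log 2 h))"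
            using C0[of j] S by (intro mult_left_mono) auto
          then show "A (2 * h) \<le> 2 powr (r j + s) * A h"
            by (simp add: A_def powr_mult powr_add mult_ac)
        qed
        show "\<forall>h>0. Lp_le (p j) (partial_diff (m j) j h f) (A h)"
        proof (intro allI impI)
          fix h :: real assume h: "h > 0"
          have "2 powr (r j * log 2 h) = h powr r j" using h by (simp add: powr_def log_def)
          then show "Lp_le (p j) (partial_diff (m j) j h f) (A h)"
            using e_Lp[of j "log 2 h"] h by (simp add: A_def)
        qed
      qed
      have gp: "Lp_le (p j) g (B * S * 2 powr (H T0 + T0 / p j))"
      proof (rule Lp_le_mono[OF gA])
        \<comment> \<open>Since d_j(T0) = x, the j-th equation at T0 identifies h^(r_j) e_j(x) with
          2^(H(T0) + T0 / p_j).\<close>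
        have "h powr r j * e j x = 2 powr (r j * x + L j x)"
          unfolding hx[symmetric] eL powr_add ..
        also have "r j * x + L j x = H T0 + T0 / p j" using dH[of j T0] by (simp add: dT0)
        finally have Ah: "A h = C0 j * S * 2 powr (H T0 + T0 / p j)" by (simp add: A_def x_def mult.assoc)
        have "(C1 j * C0 j) * (S * 2 powr (H T0 + T0 / p j)) \<le> B * (S * 2 powr (H T0 + T0 / p j))"
          using BC S by (intro mult_right_mono) auto
        then show "C1 j * A h \<le> B * S * 2 powr (H T0 + T0 / p j)" by (simp add: Ah mult.assoc)
        show "0 \<le> C1 j * A h" using C1[of j] C0[of j] S by (simp add: Ah)
      qed (rule p0)
      define Y where "Y = D j * S * 2 powr H T0"
      have Y0: "Y > 0" using DE S by (simp add: Y_def)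
      have sys: "scale_system p m B (\<epsilon> - b) \<sigma>' g S H d"
        unfolding scale_system_def using g S gsmall dsum Hdown Hup by blast
      have distb: "emeasure lborel {x. \<bar>g x\<bar> > y} \<le> ennreal (E j * 2 powr T0 * two_powers Y (p j) (1 / \<rho> j) y)"
        if "y > 0" for y
        using DE'[of j] sys gp that unfolding distribution_constants_def Y_def by blast
      have qv: "q j < 1 / \<rho> j" using \<rho>[of j] q0[of j] by (simp add: field_simps)
      note norms = norms_of_distribution_bound[OF g p[of j] pq[of j] qv DE(2)[of j] _ Y0 distb]
      have "H T0 + T0 / q j = \<alpha> j * d j T0 + (\<Sum>i\<in>UNIV. \<nu> j i * L i (d i T0))"
        by (rule exponent_identity[OF dsum dH])
      then have "H T0 + T0 / q j = \<alpha> j * x + \<Lambda> x" by (simp add: \<Lambda>_def dT0 T0_def[symmetric])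
      then have "2 powr H T0 * (2 powr T0) powr (1 / q j) = 2 powr (\<alpha> j * x) * G x"
        by (simp add: powr_powr powr_add[symmetric] G_def)
      also have "2 powr (\<alpha> j * x) = h powr \<alpha> j" by (rule hx)
      finally have sz: "2 powr H T0 * (2 powr T0) powr (1 / q j) = h powr \<alpha> j * G x" .
      have scale: "c * (2 powr T0) powr (1 / q j) * Y = (c * D j) * S * (h powr \<alpha> j * G x)" for c
        unfolding sz[symmetric] Y_def by (simp add: mult_ac)
      have le: "c * S * (h powr \<alpha> j * G x) \<le> C * S * h powr \<alpha> j * G x" if "c \<le> C" for c
      proof -
        have "c * (S * (h powr \<alpha> j * G x)) \<le> C * (S * (h powr \<alpha> j * G x))"
          using that S G0[of x] by (intro mult_right_mono) auto
        then show ?thesis by (simp add: mult.assoc)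
      qed
      have n1: "Lp_le (q j) g (cL j * S * (h powr \<alpha> j * G x))"
        using norms(1) unfolding scale cL_def by simp
      have n0: "0 \<le> cL j * S * (h powr \<alpha> j * G x)"
        using DE(1)[of j] S G0[of x] by (simp add: cL_def)
      have 1: "Lp_le (q j) g (C * S * h powr \<alpha> j * G x)"
        by (rule Lp_le_mono[OF n1 q0 n0 le[OF C(2)]])
      have "lorentz_norm (q j) 1 g \<le> ennreal (cZ j * S * (h powr \<alpha> j * G x))"
        using norms(2) unfolding scale cZ_def by simp
      also have "\<dots> \<le> ennreal (C * S * h powr \<alpha> j * G x)"
        by (intro ennreal_leI le C)
      finally show ?thesis using 1 by (simp add: g_def x_def)
    qed

    \<comment> \<open>Integrability of the product of the weights\<close>
    have int: "(\<integral>\<^sup>+h\<in>{0<..}. ennreal (G (log 2 h) powr t / h) \<partial>lborel) \<le> ennreal C"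
      if t: "t > 0" "1 / t = (\<Sum>i\<in>UNIV. \<nu> j i * recip (\<theta> i))" for t
    proof -
      define I where "I = {i. \<theta> i \<noteq> top}"
      \<comment> \<open>These numbers add up to 1 precisely because 1/t is the \<nu>-average of the
        reciprocals of the \<theta>_i; directions with infinite \<theta>_i get 0.\<close>
      define w where "w i = t * (\<nu> j i * recip (\<theta> i))" for i
      have w_out: "w i = 0" if "i \<notin> I" for i using that by (simp add: w_def recip_def I_def)
      have w0: "w i \<ge> 0" for i using t \<nu>_nonneg[of j i] by (simp add: w_def recip_def)
      have "(\<Sum>i\<in>UNIV. w i) = t * (1 / t)" unfolding w_def t(2) by (simp add: sum_distrib_left)
      moreover have "(\<Sum>i\<in>UNIV. w i) = (\<Sum>i\<in>I. w i)"
        using w_out by (intro sum.mono_neutral_right) auto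
      ultimately have w1: "(\<Sum>i\<in>I. w i) = 1" using t(1) by simp
      have tI: "enn2real (\<theta> i) \<ge> 1" if "i \<in> I" for i
        using ennreal_ge_1_cases[OF \<theta>] that by (simp add: I_def)
      have Gt: "G x powr t \<le> (\<Sum>i\<in>I. e i (d i (\<tau> j x)) powr enn2real (\<theta> i))" for x
      proof -
        have "t * \<Lambda> x = (\<Sum>i\<in>UNIV. t * (\<nu> j i * L i (d i (\<tau> j x))))"
          by (simp add: \<Lambda>_def sum_distrib_left)
        also have "\<dots> = (\<Sum>i\<in>I. t * (\<nu> j i * L i (d i (\<tau> j x))))"
          by (intro sum.mono_neutral_right) (auto simp: I_def L_def e_top)
        also have "\<dots> = (\<Sum>i\<in>I. w i * (enn2real (\<theta> i) * L i (d i (\<tau> j x))))"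
        proof (intro sum.cong refl)
          fix i assume "i \<in> I"
          then show "t * (\<nu> j i * L i (d i (\<tau> j x))) = w i * (enn2real (\<theta> i) * L i (d i (\<tau> j x)))"
            using tI[of i] by (simp add: w_def recip_def I_def)
        qed
        finally have "G x powr t = 2 powr (\<Sum>i\<in>I. w i * (enn2real (\<theta> i) * L i (d i (\<tau> j x))))"
          by (simp add: G_def powr_powr mult.commute)
        also have "\<dots> \<le> (\<Sum>i\<in>I. 2 powr (enn2real (\<theta> i) * L i (d i (\<tau> j x))))"
          using w0 w1 by (intro two_powr_convex_le) auto
        also have "\<dots> = (\<Sum>i\<in>I. e i (d i (\<tau> j x)) powr enn2real (\<theta> i))"
          by (simp add: eL powr_powr mult.commute)
        finally show ?thesis .
      qed
      have "(\<integral>\<^sup>+h\<in>{0<..}. ennreal (G (log 2 h) powr t / h) \<partial>lborel)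
         \<le> (\<integral>\<^sup>+h. (\<Sum>i\<in>I. ennreal (e i (d i (\<tau> j (log 2 h))) powr enn2real (\<theta> i) / h) * indicator {0<..} h) \<partial>lborel)"
      proof (intro nn_integral_mono)
        fix h :: real
        show "ennreal (G (log 2 h) powr t / h) * indicator {0<..} h
           \<le> (\<Sum>i\<in>I. ennreal (e i (d i (\<tau> j (log 2 h))) powr enn2real (\<theta> i) / h) * indicator {0<..} h)"
        proof (cases "h > 0")
          case True
          have "ennreal (G (log 2 h) powr t / h) \<le> ennreal ((\<Sum>i\<in>I. e i (d i (\<tau> j (log 2 h))) powr enn2real (\<theta> i)) / h)"
            using True Gt by (intro ennreal_leI divide_right_mono) auto
          also have "\<dots> = (\<Sum>i\<in>I. ennreal (e i (d i (\<tau> j (log 2 h))) powr enn2real (\<theta> i) / h))"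
            using True by (simp add: sum_divide_distrib)
          finally show ?thesis using True by simp
        qed simp
      qed
      also have "\<dots> = (\<Sum>i\<in>I. (\<integral>\<^sup>+h\<in>{0<..}. ennreal (e i (d i (\<tau> j (log 2 h))) powr enn2real (\<theta> i) / h) \<partial>lborel))"
        by (intro nn_integral_sum) measurable
      also have "\<dots> \<le> (\<Sum>i\<in>I. ennreal (4 / (s * enn2real (\<theta> i) * (\<beta> i / (4 * \<beta> j)))))"
      proof (intro sum_mono)
        fix i assume i: "i \<in> I"
        show "(\<integral>\<^sup>+h\<in>{0<..}. ennreal (e i (d i (\<tau> j (log 2 h))) powr enn2real (\<theta> i) / h) \<partial>lborel)
           \<le> ennreal (4 / (s * enn2real (\<theta> i) * (\<beta> i / (4 * \<beta> j))))"
        proof (rule e_int[where \<phi>="\<lambda>x. d i (\<tau> j x)"])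
          show "\<theta> i \<noteq> top" using i by (simp add: I_def)
          show "\<beta> i / (4 * \<beta> j) > 0" using \<beta>0 by simp
          show "(\<lambda>x. d i (\<tau> j x)) \<in> borel_measurable borel" by measurable
          \<comment> \<open>The witness is the value of d_j at the scale where d_i equals y. The
            rate is the least slope \<beta>_i / 2 of d_i divided by the largest slope 2 \<beta>_j of
            d_j.\<close>
          show "\<forall>y. \<exists>x0. \<forall>x. \<beta> i / (4 * \<beta> j) * \<bar>x - x0\<bar> \<le> \<bar>d i (\<tau> j x) - y\<bar>"
          proof (intro allI exI)
            fix y x
            define T1 where "T1 = \<tau> i y"
            have "\<bar>x - d j T1\<bar> \<le> 2 * \<beta> j * \<bar>\<tau> j x - T1\<bar>"
              using dhi[of j "\<tau> j x" T1] by (simp add: \<tau>)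
            then have "\<beta> i / (4 * \<beta> j) * \<bar>x - d j T1\<bar> \<le> \<beta> i / (4 * \<beta> j) * (2 * \<beta> j * \<bar>\<tau> j x - T1\<bar>)"
              using \<beta>0[of i] \<beta>0[of j] by (intro mult_left_mono) auto
            also have "\<dots> = \<beta> i / 2 * \<bar>\<tau> j x - T1\<bar>" using \<beta>0[of j] by simp
            also have "\<dots> \<le> \<bar>d i (\<tau> j x) - y\<bar>"
              using dlo[of i "\<tau> j x" T1] by (simp add: T1_def \<tau>)
            finally show "\<beta> i / (4 * \<beta> j) * \<bar>x - d j (\<tau> i y)\<bar> \<le> \<bar>d i (\<tau> j x) - y\<bar>"
              by (simp add: T1_def)
          qed
        qed
      qed
      also have "\<dots> \<le> (\<Sum>i\<in>UNIV. ennreal (4 / (s * enn2real (\<theta> i) * (\<beta> i / (4 * \<beta> j)))))"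
        by (intro sum_mono2) auto
      also have "\<dots> = ennreal (cI j)"
        unfolding cI_def using s \<beta>0 by (intro sum_ennreal) (auto simp: less_imp_le intro!: divide_nonneg_nonneg mult_nonneg_nonneg)
      also have "\<dots> \<le> ennreal C" by (intro ennreal_leI C)
      finally show ?thesis .
    qed
    show "\<exists>G. difference_weight \<theta> (K j) \<eta> C j f S G"
      unfolding difference_weight_def using G0 G2 G_meas G_lip key int by (intro exI[of _ G]) blast
  qed
  then show ?thesis by blast
qed

end

text \<open>The weights are normalized by a number S > 0, for which a vanishing seminorm cannot be
  taken; arbitrary positive majorants cover this case.\<close>

lemma le_of_forall_ge:
  fixes X \<sigma> :: ennreal
  assumes "\<sigma> < top" "c > 0" and le: "\<And>S. S > 0 \<Longrightarrow> \<sigma> \<le> ennreal S \<Longrightarrow> X \<le> ennreal (c * S)"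
  shows "X \<le> ennreal c * \<sigma>"
proof (cases \<sigma>)
  case (real s)
  show ?thesis
  proof (cases "s = 0")
    case True
    have all: "X \<le> ennreal \<delta>" if "\<delta> > 0" for \<delta>
      using le[of "\<delta> / c"] that assms(2) real True by simp
    have "X = 0"
    proof (cases X)
      case (real x)
      then show ?thesis using all[of "x / 2"] by (cases "x = 0") auto
    next
      case top
      then show ?thesis using all[of 1] by (simp add: top_unique)
    qed
    then show ?thesis by simp
  next
    case False
    then show ?thesis using le[of s] real assms(2) by (simp add: ennreal_mult)
  qed
qed (use assms(1) in simp)

lemma borel_measurable_partial_diff_lebesgue:
  fixes f :: "real ^ 'n::finite \<Rightarrow> real"
  assumes "f \<in> borel_measurable lebesgue"
  shows "partial_diff k j h f \<in> borel_measurable lebesgue"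
proof -
  have "(\<lambda>x. f (x + (real i * h) *\<^sub>R axis j 1)) \<in> borel_measurable lebesgue" for i
    by (rule borel_measurable_lebesgue_shift[OF assms])
  then have "(\<lambda>x. \<Sum>i\<le>k. (- 1) ^ (k - i) * real (k choose i) * f (x + (real i * h) *\<^sub>R axis j 1)) \<in> borel_measurable lebesgue"
    by (intro borel_measurable_sum borel_measurable_times borel_measurable_const)
  then show ?thesis unfolding partial_diff_def[abs_def] .
qed

text \<open>Needed for the essential supremum over h. The formula by the distribution function
  replaces the supremum over sets in the rearrangement by integrals that are measurable in
  h.\<close>

lemma borel_measurable_lorentz_partial_diff:
  fixes f :: "real ^ 'n::finite \<Rightarrow> real"
  assumes [measurable]: "f \<in> borel_measurable borel" and "q > 0"
  shows "(\<lambda>h. lorentz_norm q 1 (partial_diff k j h f)) \<in> borel_measurable borel"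
proof -
  have eq: "lorentz_norm q 1 (partial_diff k j h f)
     = ennreal q * (\<integral>\<^sup>+y\<in>{0<..}. ennreal_powr (\<integral>\<^sup>+x. of_bool (\<bar>partial_diff k j h f x\<bar> > y) \<partial>lborel) (1 / q) \<partial>lborel)" for h
  proof -
    have "emeasure lborel {x. \<bar>partial_diff k j h f x\<bar> > y} = (\<integral>\<^sup>+x. of_bool (\<bar>partial_diff k j h f x\<bar> > y) \<partial>lborel)" for y
    proof -
      have "emeasure lborel {x. \<bar>partial_diff k j h f x\<bar> > y} = (\<integral>\<^sup>+x. indicator {x. \<bar>partial_diff k j h f x\<bar> > y} x \<partial>lborel)"
        by (rule nn_integral_indicator[symmetric]) measurable
      then show ?thesis by (simp add: indicator_def)
    qed
    then show ?thesis
      using assms(2) lorentz_norm_eq[of "partial_diff k j h f" "partial_diff k j h f" q]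
      by (simp add: measurable_completion)
  qed
  show ?thesis unfolding eq by measurable
qed

lemma Lp_norm_le_of_Lp_le:
  assumes "Lp_le p g A" "p > 0" "A \<ge> 0"
  shows "Lp_norm p g \<le> ennreal A"
proof -
  have "Lp_norm p g \<le> ennreal_powr (ennreal (A powr p)) (1 / p)"
    using assms unfolding Lp_norm_def nn_integral_completion Lp_le_def by (intro ennreal_powr_mono) auto
  also have "\<dots> = ennreal A" using assms by (simp add: ennreal_powr_ennreal powr_powr)
  finally show ?thesis .
qed

text \<open>The exponents \<theta>' are prescribed only through their reciprocals, where the value 0
  stands for \<infinity>.\<close>

lemma one_divide_eq_ennrealD:
  fixes t :: ennreal
  assumes "1 / t = ennreal W" "W \<ge> 0"
  shows "W = 0 \<Longrightarrow> t = top" and "W > 0 \<Longrightarrow> t = ennreal (1 / W)"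
proof -
  have "(W = 0 \<longrightarrow> t = top) \<and> (W > 0 \<longrightarrow> t = ennreal (1 / W))"
  proof (cases t)
    case (real x)
    show ?thesis
    proof (cases "x = 0")
      case True
      then show ?thesis using assms real by (simp add: divide_ennreal_def)
    next
      case False
      then have "1 / t = ennreal (1 / x)" using real divide_ennreal[of 1 x] by simp
      then have "1 / x = W" using assms real by simp
      then show ?thesis using real False by auto
    qed
  next
    case top
    then show ?thesis using assms by simp
  qed
  then show "W = 0 \<Longrightarrow> t = top" and "W > 0 \<Longrightarrow> t = ennreal (1 / W)" by auto
qed

context besov_exponents
begin

lemma recip_nonneg: "recip \<theta> \<ge> 0"
  by (simp add: recip_def)

lemma divide_recip:
  assumes "\<theta> \<ge> 1" "c \<ge> 0"
  shows "ennreal c / \<theta> = ennreal (c * recip \<theta>)"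
proof (cases "\<theta> = top")
  case False
  then show ?thesis
    using ennreal_ge_1_cases[OF assms(1) False] divide_ennreal[of c "enn2real \<theta>"] assms(2)
    by (simp add: recip_def)
qed (simp add: recip_def)

lemma divide_recip_mult:
  assumes "\<theta> \<ge> 1" "c > 0"
  shows "1 / (\<theta> * ennreal c) = ennreal (recip \<theta> / c)"
proof (cases "\<theta> = top")
  case True
  then show ?thesis using assms(2) by (simp add: recip_def ennreal_top_mult)
next
  case False
  note t = ennreal_ge_1_cases[OF assms(1) False]
  have "\<theta> * ennreal c = ennreal (enn2real \<theta> * c)"
    using t assms(2) by (subst t(1)) (simp add: ennreal_mult)
  then show ?thesis
    using t assms(2) False divide_ennreal[of 1 "enn2real \<theta> * c"] by (simp add: recip_def)
qed

text \<open>This is \<open>sum_\<nu>\<close> for the reciprocals of the \<theta>_i: the part of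
  \<nu> that is present in all directions averages them to 1 / \<Theta>. The case z = 0 is that of
  all \<theta>_i infinite, with \<Theta> infinite too.\<close>

lemma recip_interpolated:
  fixes \<theta> :: "'n \<Rightarrow> ennreal"
  assumes \<theta>: "\<And>j. \<theta> j \<ge> 1"
    and \<Theta>: "\<Theta> = ennreal (real CARD('n) / R) * inverse (\<Sum>j\<in>UNIV. 1 / (\<theta> j * ennreal (r j)))"
    and t: "1 / t = ennreal (1 - \<kappa> j) / \<Theta> + ennreal (\<kappa> j) / \<theta> j"
  shows "1 / t = ennreal (\<Sum>i\<in>UNIV. \<nu> j i * recip (\<theta> i))"
proof -
  define z where "z = (\<Sum>i\<in>UNIV. recip (\<theta> i) / r i)"
  have z0: "z \<ge> 0" unfolding z_def using r recip_nonneg by (intro sum_nonneg divide_nonneg_nonneg) (auto simp: less_imp_le)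
  have n0: "real CARD('n) / R > 0" using R0 by simp
  have \<kappa>1: "1 - \<kappa> j > 0" using \<kappa>_bounds[of j] by simp
  have "(\<Sum>i\<in>UNIV. 1 / (\<theta> i * ennreal (r i))) = (\<Sum>i\<in>UNIV. ennreal (recip (\<theta> i) / r i))"
    using \<theta> r by (simp add: divide_recip_mult)
  also have "\<dots> = ennreal z"
    unfolding z_def using r recip_nonneg by (intro sum_ennreal) (auto simp: less_imp_le)
  finally have \<Theta>z: "\<Theta> = ennreal (real CARD('n) / R) * inverse (ennreal z)" unfolding \<Theta> by simp
  have "ennreal (1 - \<kappa> j) / \<Theta> = ennreal ((1 - \<kappa> j) * (R / real CARD('n) * z))"
  proof (cases "z = 0")
    case True
    then have "\<Theta> = top" using R0 by (simp add: \<Theta>z ennreal_mult_top)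
    then show ?thesis using True by simp
  next
    case False
    then have "z > 0" using z0 by simp
    then have "\<Theta> = ennreal (real CARD('n) / R * (1 / z))"
      unfolding \<Theta>z using n0 by (simp add: inverse_ennreal ennreal_mult[symmetric] inverse_eq_divide)
    moreover have "real CARD('n) / R * (1 / z) > 0" using R0 \<open>z > 0\<close> by simp
    ultimately have "ennreal (1 - \<kappa> j) / \<Theta> = ennreal ((1 - \<kappa> j) / (real CARD('n) / R * (1 / z)))"
      using \<kappa>1 by (simp add: divide_ennreal)
    then show ?thesis by simp
  qed
  then have "1 / t = ennreal ((1 - \<kappa> j) * (R / real CARD('n) * z)) + ennreal (\<kappa> j * recip (\<theta> j))"
    using t divide_recip[OF \<theta>] \<kappa>_bounds[of j] by simp
  also have "\<dots> = ennreal ((1 - \<kappa> j) * (R / real CARD('n) * z) + \<kappa> j * recip (\<theta> j))"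
    using \<kappa>_bounds[of j] z0 R0 recip_nonneg by (intro ennreal_plus[symmetric]) auto
  finally show ?thesis unfolding sum_\<nu> z_def .
qed

text \<open>An infinite exponent uses G \<le> 2, a finite one the integral bound, which contributes
  a power of \<open>C\<close>; the sum in the constant serves both.\<close>

lemma weighted_norm_le_of_difference_weight:
  assumes G: "difference_weight \<theta> K \<eta> C j f S G" and "C > 0" "S > 0" "c > 0"
    and t: "1 / t = ennreal (\<Sum>i\<in>UNIV. \<nu> j i * recip (\<theta> i))"
    and N: "\<And>h. h > 0 \<Longrightarrow> N h \<le> ennreal (c * S * h powr \<alpha> j * G (log 2 h))"
    and meas: "N \<in> borel_measurable borel"
  shows "weighted_norm (\<alpha> j) t N \<le> ennreal (c * (2 + C powr (\<Sum>i\<in>UNIV. \<nu> j i * recip (\<theta> i))) * S)"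
proof -
  define w where "w = (\<Sum>i\<in>UNIV. \<nu> j i * recip (\<theta> i))"
  have w0: "w \<ge> 0" unfolding w_def using \<nu>_nonneg recip_nonneg by (intro sum_nonneg) auto
  have G0: "0 < G x" "G x \<le> 2" and G_meas: "G \<in> borel_measurable borel" for x
    using G unfolding difference_weight_def by blast+
  have int: "(\<integral>\<^sup>+h\<in>{0<..}. ennreal (G (log 2 h) powr t / h) \<partial>lborel) \<le> ennreal C" if "t > 0" "1 / t = w" for t
    using G that unfolding difference_weight_def w_def by blast
  show ?thesis
  proof (cases "w = 0")
    case True
    then have "t = top" using one_divide_eq_ennrealD(1)[OF t] w0 by (simp add: w_def)
    then have "weighted_norm (\<alpha> j) t N \<le> ennreal (c * 2 * S)"
      using weighted_norm_le_top[of c S N "\<alpha> j" G 2] assms G0 N by simp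
    also have "\<dots> \<le> ennreal (c * (2 + C powr w) * S)"
      using assms by (intro ennreal_leI mult_right_mono mult_left_mono) auto
    finally show ?thesis unfolding w_def .
  next
    case False
    then have w: "w > 0" using w0 by simp
    then have t': "t = ennreal (1 / w)" using one_divide_eq_ennrealD(2)[OF t] w0 by (simp add: w_def)
    have "weighted_norm (\<alpha> j) t N \<le> ennreal (c * C powr (1 / (1 / w)) * S)"
      unfolding t' using w assms by (intro weighted_norm_le_finite[where G=G] N G0 G_meas int) auto
    also have "\<dots> \<le> ennreal (c * (2 + C powr w) * S)"
      using assms by (intro ennreal_leI mult_right_mono mult_left_mono) auto
    finally show ?thesis unfolding w_def .
  qed
qed

text \<open>Translations preserve null sets, so for every fixed step the differences of f and of a
  Borel function equal to it almost everywhere have the same norms. The Borel version offers the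
  joint measurability in point and step on which Tonelli's theorem relies.\<close>

lemma Borel_representative:
  fixes f :: "real ^ 'n \<Rightarrow> real"
  assumes "f \<in> S0"
  obtains f' where "f' \<in> borel_measurable borel" "finite_levels f'"
    "\<And>k j h p. Lp_norm p (partial_diff k j h f) = Lp_norm p (partial_diff k j h f')"
    "\<And>k j h q. q > 0 \<Longrightarrow> lorentz_norm q 1 (partial_diff k j h f) = lorentz_norm q 1 (partial_diff k j h f')"
proof -
  have f: "f \<in> borel_measurable lebesgue" and fin: "\<And>y. y > 0 \<Longrightarrow> emeasure lebesgue {x. \<bar>f x\<bar> > y} < \<infinity>"
    using assms by (auto simp: S0_def)
  obtain f' where f': "f' \<in> borel_measurable lborel" and ae: "AE x in lborel. f x = f' x"
    using completion_ex_borel_measurable_real[OF f] by blast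
  have f'b [measurable]: "f' \<in> borel_measurable borel" using f' by simp
  have AE: "AE x in lebesgue. f x = f' x" using ae by (rule AE_completion)
  show thesis
  proof (rule that[OF f'b])
    show "finite_levels f'"
      using fin emeasure_level_AE_cong[OF AE f f'b] by simp
    show "Lp_norm p (partial_diff k j h f) = Lp_norm p (partial_diff k j h f')" for k j h p
      by (rule Lp_norm_AE_cong[OF AE_partial_diff[OF AE]])
    show "lorentz_norm q 1 (partial_diff k j h f) = lorentz_norm q 1 (partial_diff k j h f')" if "q > 0" for k j h q
    proof -
      have b: "partial_diff k j h f' \<in> borel_measurable borel" by measurable
      have l: "partial_diff k j h f' \<in> borel_measurable lebesgue"
        using b by (intro measurable_completion) simp
      show ?thesis
        using lorentz_norm_eq[OF AE_partial_diff[OF AE] borel_measurable_partial_diff_lebesgue[OF f] b that]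
          lorentz_norm_eq[OF _ l b that] by simp
    qed
  qed
qed

lemma Besov_embedding_estimates:
  fixes \<theta> \<theta>' :: "'n \<Rightarrow> ennreal" and k m l :: "'n \<Rightarrow> nat"
  assumes \<theta>: "\<And>j. \<theta> j \<ge> 1"
    and \<Theta>: "\<Theta> = ennreal (real CARD('n) / R) * inverse (\<Sum>j\<in>UNIV. 1 / (\<theta> j * ennreal (r j)))"
    and \<theta>': "\<And>j. 1 / \<theta>' j = ennreal (1 - \<kappa> j) / \<Theta> + ennreal (\<kappa> j) / \<theta> j"
    and k: "\<And>j. real (k j) > r j" and m: "\<And>j. real (m j) > r j" and l: "\<And>j. real (l j) > \<alpha> j"
  shows "\<exists>c>0. \<forall>f \<in> besov_space m r p \<theta>. \<forall>j.
      weighted_norm (\<alpha> j) (\<theta>' j) (\<lambda>h. lorentz_norm (q j) 1 (partial_diff (k j) j h f)) \<le> ennreal c * besov_seminorm m r p \<theta> f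
      \<and> besov_partial_seminorm (l j) (\<alpha> j) (q j) (\<theta>' j) j f \<le> ennreal c * besov_seminorm m r p \<theta> f"
proof -
  define w where "w j = (\<Sum>i\<in>UNIV. \<nu> j i * recip (\<theta> i))" for j
  have t: "1 / \<theta>' j = ennreal (w j)" for j
    unfolding w_def by (rule recip_interpolated[OF \<theta> \<Theta> \<theta>'])
  \<comment> \<open>\<eta> limits the growth of the weight beyond h^(\<alpha>_j); half of the gap
    keeps \<alpha>_j + \<eta> below \<open>l j\<close>, as Marchaud's inequality requires.\<close>
  obtain \<eta> where \<eta>0: "\<eta> > 0" and \<eta>: "\<And>j. \<eta> \<le> (real (l j) - \<alpha> j) / 2"
    by (rule uniform_lower_bound[of "\<lambda>j. (real (l j) - \<alpha> j) / 2"]) (use l in auto)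
  have l1: "1 \<le> l j" for j using l[of j] \<alpha>0[of j] by (auto intro: Suc_leI)
  define K where "K j = max (m j) (l j)" for j
  have K: "real (K j) > r j" for j using m[of j] by (simp add: K_def)
  obtain C where C: "difference_constant m \<theta> k \<eta> C"
    using difference_constant_exists[where \<theta>=\<theta>, OF k m \<theta> \<eta>0] by blast
  then have C0: "C > 0" by (simp add: difference_constant_def)
  obtain C' where C': "difference_constant m \<theta> K \<eta> C'"
    using difference_constant_exists[where \<theta>=\<theta>, OF K m \<theta> \<eta>0] by blast
  then have C'0: "C' > 0" by (simp add: difference_constant_def)
  have "\<exists>D. order_constant (K j) (l j) (2 powr (\<alpha> j + \<eta>)) j D" for j
  proof (rule order_constant_exists)
    have "\<alpha> j + \<eta> < real (l j)" using \<eta>[of j] l[of j] by (simp add: field_simps)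
    then have "2 powr (\<alpha> j + \<eta>) < 2 powr real (l j)" by (intro powr_less_mono) auto
    then show "2 powr (\<alpha> j + \<eta>) < 2 ^ l j" by (simp add: powr_realpow)
  qed (use l1 in simp_all)
  then obtain D where D: "\<And>j. order_constant (K j) (l j) (2 powr (\<alpha> j + \<eta>)) j (D j)" by metis
  have D0: "D j > 0" for j by (rule order_constantD(1)[OF D])
  define a where "a j = C * (2 + C powr w j)" for j
  define a' where "a' j = D j * C' * (2 + C' powr w j)" for j
  have a0: "a j > 0" "a' j > 0" for j
    unfolding a_def a'_def using C0 C'0 D0[of j] by (auto intro!: mult_pos_pos add_pos_nonneg)
  define c where "c = (\<Sum>j\<in>UNIV. a j + a' j)"
  have c: "a j \<le> c" "a' j \<le> c" for j
  proof -
    have "a j + a' j \<le> c" unfolding c_def using a0 by (intro member_le_sum) (auto simp: less_imp_le)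
    then show "a j \<le> c" "a' j \<le> c" using a0[of j] by linarith+
  qed
  have c0: "c > 0" using c(1) a0(1) less_le_trans by blast
  show ?thesis
  proof (intro exI[of _ c] conjI ballI allI c0)
    fix f :: "real ^ 'n \<Rightarrow> real" and j
    assume f: "f \<in> besov_space m r p \<theta>"
    then have fS0: "f \<in> S0" and semi: "besov_seminorm m r p \<theta> f < top" by (auto simp: besov_space_def)
    obtain f' where f' [measurable]: "f' \<in> borel_measurable borel" and fin: "finite_levels f'"
      and Lp: "\<And>k j h p. Lp_norm p (partial_diff k j h f) = Lp_norm p (partial_diff k j h f')"
      and lor: "\<And>k j h q. q > 0 \<Longrightarrow> lorentz_norm q 1 (partial_diff k j h f) = lorentz_norm q 1 (partial_diff k j h f')"
      using Borel_representative[OF fS0] by metis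
    have part: "besov_partial_seminorm (m i) (r i) (p i) (\<theta> i) i f' \<le> ennreal S" if "besov_seminorm m r p \<theta> f \<le> ennreal S" for i S
    proof -
      have "besov_partial_seminorm (m i) (r i) (p i) (\<theta> i) i f' = besov_partial_seminorm (m i) (r i) (p i) (\<theta> i) i f"
        unfolding besov_partial_seminorm_def Lp ..
      also have "\<dots> \<le> besov_seminorm m r p \<theta> f"
        unfolding besov_seminorm_def by (rule member_le_sum[of i UNIV "\<lambda>i. besov_partial_seminorm (m i) (r i) (p i) (\<theta> i) i f"]) auto
      also note that
      finally show ?thesis .
    qed
    show "weighted_norm (\<alpha> j) (\<theta>' j) (\<lambda>h. lorentz_norm (q j) 1 (partial_diff (k j) j h f)) \<le> ennreal c * besov_seminorm m r p \<theta> f"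
    proof (rule le_of_forall_ge[OF semi c0])
      fix S :: real assume S: "S > 0" "besov_seminorm m r p \<theta> f \<le> ennreal S"
      obtain G where G: "difference_weight \<theta> (k j) \<eta> C j f' S G"
        using C f' fin S part unfolding difference_constant_def by blast
      have "weighted_norm (\<alpha> j) (\<theta>' j) (\<lambda>h. lorentz_norm (q j) 1 (partial_diff (k j) j h f')) \<le> ennreal (C * (2 + C powr w j) * S)"
        unfolding w_def
      proof (rule weighted_norm_le_of_difference_weight[OF G C0 S(1) C0 t[unfolded w_def]])
        show "(\<lambda>h. lorentz_norm (q j) 1 (partial_diff (k j) j h f')) \<in> borel_measurable borel"
          by (rule borel_measurable_lorentz_partial_diff[OF f' q0])
        show "lorentz_norm (q j) 1 (partial_diff (k j) j h f') \<le> ennreal (C * S * h powr \<alpha> j * G (log 2 h))" if "h > 0" for h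
          using G that unfolding difference_weight_def by blast
      qed
      also have "\<dots> \<le> ennreal (c * S)"
        using c(1)[of j] S(1) by (intro ennreal_leI mult_right_mono) (auto simp: a_def)
      finally show "weighted_norm (\<alpha> j) (\<theta>' j) (\<lambda>h. lorentz_norm (q j) 1 (partial_diff (k j) j h f)) \<le> ennreal (c * S)"
        by (simp add: lor q0)
    qed
    show "besov_partial_seminorm (l j) (\<alpha> j) (q j) (\<theta>' j) j f \<le> ennreal c * besov_seminorm m r p \<theta> f"
    proof (rule le_of_forall_ge[OF semi c0])
      fix S :: real assume S: "S > 0" "besov_seminorm m r p \<theta> f \<le> ennreal S"
      obtain G where G: "difference_weight \<theta> (K j) \<eta> C' j f' S G"
        using C' f' fin S part unfolding difference_constant_def by blast
      have G0: "G x > 0" and G_lip: "G x \<le> 2 powr (\<eta> * \<bar>x - y\<bar>) * G y"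
        and GK: "h > 0 \<Longrightarrow> Lp_le (q j) (partial_diff (K j) j h f') (C' * S * h powr \<alpha> j * G (log 2 h))" for x y h
        using G unfolding difference_weight_def by blast+
      define A where "A h = C' * S * h powr \<alpha> j * G (log 2 h)" for h
      have A0: "A h \<ge> 0" for h using C'0 S(1) G0[of "log 2 h"] by (simp add: A_def)
      have A2: "A (2 * h) \<le> 2 powr (\<alpha> j + \<eta>) * A h" if h: "h > 0" for h
      proof -
        have "G (log 2 (2 * h)) \<le> 2 powr \<eta> * G (log 2 h)"
          using G_lip[of "log 2 (2 * h)" "log 2 h"] h by (simp add: log_mult)
        then have "(C' * S * (2 * h) powr \<alpha> j) * G (log 2 (2 * h)) \<le> (C' * S * (2 * h) powr \<alpha> j) * (2 powr \<eta> * G (log 2 h))"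
          using C'0 S(1) by (intro mult_left_mono) auto
        then show ?thesis by (simp add: A_def powr_mult powr_add mult_ac)
      qed
      have Ll: "Lp_le (q j) (partial_diff (l j) j h f') (D j * A h)" if "h > 0" for h
      proof -
        have 1: "\<forall>h>0. A h \<ge> 0 \<and> A (2 * h) \<le> 2 powr (\<alpha> j + \<eta>) * A h" using A0 A2 by blast
        have 2: "\<forall>h>0. Lp_le (q j) (partial_diff (K j) j h f') (A h)" using GK unfolding A_def by blast
        show ?thesis
          using p[of j] pq[of j] by (intro order_constantD(2)[OF D f' fin _ 1 2 that]) auto
      qed
      have "weighted_norm (\<alpha> j) (\<theta>' j) (\<lambda>h. Lp_norm (q j) (partial_diff (l j) j h f')) \<le> ennreal (D j * C' * (2 + C' powr w j) * S)"
        unfolding w_def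
      proof (rule weighted_norm_le_of_difference_weight[OF G C'0 S(1) _ t[unfolded w_def]])
        show "D j * C' > 0" using D0[of j] C'0 by simp
        show "(\<lambda>h. Lp_norm (q j) (partial_diff (l j) j h f')) \<in> borel_measurable borel"
          unfolding Lp_norm_partial_diff by measurable
        show "Lp_norm (q j) (partial_diff (l j) j h f') \<le> ennreal (D j * C' * S * h powr \<alpha> j * G (log 2 h))" if "h > 0" for h
          using Lp_norm_le_of_Lp_le[OF Ll[OF that] q0] A0[of h] D0[of j] by (simp add: A_def mult.assoc)
      qed
      also have "\<dots> \<le> ennreal (c * S)"
        using c(2)[of j] S(1) by (intro ennreal_leI mult_right_mono) (auto simp: a'_def)
      finally show "besov_partial_seminorm (l j) (\<alpha> j) (q j) (\<theta>' j) j f \<le> ennreal (c * S)"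
        unfolding besov_partial_seminorm_def by (simp add: Lp)
    qed
  qed
qed

end

theorem theorem3:
  fixes r p q \<beta> \<kappa> \<alpha> :: "'n::finite \<Rightarrow> real"
    and \<theta> \<theta>' :: "'n \<Rightarrow> ennreal"
    and R P :: real and \<Theta> :: ennreal
    and k m l :: "'n \<Rightarrow> nat"
  assumes "\<And>j. r j > 0"
    and "\<And>j. p j \<ge> 1"
    and "\<And>j. \<theta> j \<ge> 1"
    and "R = real CARD('n) * inverse (\<Sum>j\<in>UNIV. 1 / r j)"
    and "P = real CARD('n) / R * inverse (\<Sum>j\<in>UNIV. 1 / (p j * r j))"
    and "\<Theta> = ennreal (real CARD('n) / R) * inverse (\<Sum>j\<in>UNIV. 1 / (\<theta> j * ennreal (r j)))"
    and "\<And>j. \<beta> j = 1 / r j * (R / real CARD('n) + 1 / p j - 1 / P)"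
    and "\<And>j. \<beta> j > 0"
    and "\<And>j. p j < q j"
    and "\<And>j. 1 / q j > 1 / P - R / real CARD('n)"
    and "\<And>j. \<kappa> j = 1 - 1 / (\<beta> j * r j) * (1 / p j - 1 / q j)"
    and "\<And>j. \<alpha> j = \<kappa> j * r j"
    and "\<And>j. 1 / \<theta>' j = ennreal (1 - \<kappa> j) / \<Theta> + ennreal (\<kappa> j) / \<theta> j"
    and "\<And>j. real (k j) > r j"
    and "\<And>j. real (m j) > r j"
    and "\<And>j. real (l j) > \<alpha> j"
  shows "(\<exists>c::real. c > 0 \<and> (\<forall>f \<in> besov_space m r p \<theta>. \<forall>j.
            weighted_norm (\<alpha> j) (\<theta>' j) (\<lambda>h. lorentz_norm (q j) 1 (partial_diff (k j) j h f))
              \<le> ennreal c * (\<Sum>i\<in>UNIV. besov_partial_seminorm (m i) (r i) (p i) (\<theta> i) i f)))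
       \<and> seminorm_embedding (besov_space m r p \<theta>) (besov_seminorm m r p \<theta>)
            (besov_space l \<alpha> q \<theta>') (besov_seminorm l \<alpha> q \<theta>')"
proof -
  interpret besov_exponents r p q \<beta> \<kappa> \<alpha> R P
    by unfold_locales (fact assms)+
  obtain c where c0: "c > 0" and c: "\<And>f j. f \<in> besov_space m r p \<theta> \<Longrightarrow>
      weighted_norm (\<alpha> j) (\<theta>' j) (\<lambda>h. lorentz_norm (q j) 1 (partial_diff (k j) j h f)) \<le> ennreal c * besov_seminorm m r p \<theta> f"
    "\<And>f j. f \<in> besov_space m r p \<theta> \<Longrightarrow>
      besov_partial_seminorm (l j) (\<alpha> j) (q j) (\<theta>' j) j f \<le> ennreal c * besov_seminorm m r p \<theta> f"
    using Besov_embedding_estimates[OF assms(3,6,13-16)] by blast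
  have sum: "besov_seminorm l \<alpha> q \<theta>' f \<le> ennreal (real CARD('n) * c) * besov_seminorm m r p \<theta> f"
    if "f \<in> besov_space m r p \<theta>" for f
  proof -
    have "besov_seminorm l \<alpha> q \<theta>' f \<le> (\<Sum>j\<in>(UNIV::'n set). ennreal c * besov_seminorm m r p \<theta> f)"
      unfolding besov_seminorm_def[of l] by (intro sum_mono c(2) that)
    also have "\<dots> = ennreal (real CARD('n) * c) * besov_seminorm m r p \<theta> f"
      using c0 by (simp add: ennreal_mult ennreal_of_nat_eq_real_of_nat mult.assoc)
    finally show ?thesis .
  qed
  have "besov_space m r p \<theta> \<subseteq> besov_space l \<alpha> q \<theta>'"
  proof
    fix f assume f: "f \<in> besov_space m r p \<theta>"
    then have "ennreal (real CARD('n) * c) * besov_seminorm m r p \<theta> f < top"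
      by (simp add: besov_space_def ennreal_mult_less_top)
    then have "besov_seminorm l \<alpha> q \<theta>' f < top"
      using sum[OF f] by (rule le_less_trans[rotated])
    then show "f \<in> besov_space l \<alpha> q \<theta>'"
      using f by (simp add: besov_space_def)
  qed
  moreover have "\<exists>c::real. c > 0 \<and> (\<forall>f\<in>besov_space m r p \<theta>.
      besov_seminorm l \<alpha> q \<theta>' f \<le> ennreal c * besov_seminorm m r p \<theta> f)"
    using sum c0 by (intro exI[of _ "real CARD('n) * c"]) auto
  ultimately have "seminorm_embedding (besov_space m r p \<theta>) (besov_seminorm m r p \<theta>)
            (besov_space l \<alpha> q \<theta>') (besov_seminorm l \<alpha> q \<theta>')"
    unfolding seminorm_embedding_def by blast
  then show ?thesis
    using c0 c(1) unfolding besov_seminorm_def[of m] by blast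
qed

end
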